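(* Let $n\ge 2$. There exists a function $f\in L^1(\mathbb S^n)$ such that $$\limsup_{R\rightarrow\infty}\big|B^{\frac{n-1}{2}}_R f(x)\big|=\infty\quad\text{for almost every } x\in\mathbb S^n,$$ where $$B^{\delta}_R f = \sum_{k\ge 0:\ k(k+n-1)<R^2} \left(1-\frac{k(k+n-1)}{R^2}\right)^\delta \mathrm{proj}_k f,\quad R>0,$$ denotes the Bochner-Riesz mean of order $\delta$ of $f$.
   Context: $\mathbb S^n\subset\mathbb R^{n+1}$ is the unit sphere with the uniform measure $dy$ (normalized to total mass $1$). For $f\in L^1(\mathbb S^n)$ and $k=0,1,\dots$, $\mathrm{proj}_k f$ is the spherical harmonic component of degree $k$ of $f$: $$\mathrm{proj}_k f(x)=\int_{\mathbb S^n} Z_k(x,y) f(y)\,dy,\qquad Z_k(x,y)=\frac{k+\lambda}{\lambda}\,C_k^\lambda(\langle x,y\rangle),\quad \lambda=\frac{n-1}{2},$$ with $C_k^\lambda$ the Gegenbauer polynomial of degree $k$ and index $\lambda$; on $L^2(\mathbb S^n)$ it is the orthogonal projection onto the space of spherical harmonics of degree $k$. (The number $-k(k+n-1)$ is the eigenvalue of the Laplace-Beltrami operator on spherical harmonics of degree $k$.) The sum over $k$ runs over nonnegative integers, and $R$ ranges over positive real numbers. *)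

theory Defs
  imports "HOL-Analysis.Analysis"
begin

text \<open>The normalized uniform (surface) measure on the unit sphere, obtained as the image of the
  uniform probability measure on the unit ball under radial projection \<open>sgn x = x /\<^sub>R norm x\<close>.
  The origin is a null set; it is removed because it has no radial projection.\<close>

definition sphere_measure :: "'a::euclidean_space measure" where
  "sphere_measure =
     distr (restrict_space (uniform_measure lborel (ball 0 1)) (- {0}))
           (restrict_space borel (sphere 0 1)) sgn"

lemma space_sphere_measure [simp]: "space sphere_measure = sphere 0 1"
  by (simp add: sphere_measure_def space_restrict_space)

lemma sets_sphere_measure [simp, measurable_cong]:
  "sets sphere_measure = sets (restrict_space borel (sphere 0 1))"
  by (simp add: sphere_measure_def)

lemma measurable_sgn_sphere:
  "sgn \<in> restrict_space (uniform_measure lborel (ball 0 1)) (- {0})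
        \<rightarrow>\<^sub>M restrict_space borel (sphere (0::'a::euclidean_space) 1)"
proof (rule measurable_restrict_space2)
  show "sgn \<in> space (restrict_space (uniform_measure lborel (ball 0 1)) (- {0::'a})) \<rightarrow> sphere 0 1"
    by (auto simp: space_restrict_space norm_sgn)
  have "(\<lambda>x::'a. x /\<^sub>R norm x) \<in> borel \<rightarrow>\<^sub>M borel"
    by measurable
  then have "sgn \<in> uniform_measure lborel (ball 0 1) \<rightarrow>\<^sub>M (borel :: 'a measure)"
    by (simp add: sgn_div_norm[abs_def]
        measurable_cong_sets[of "uniform_measure lborel (ball (0::'a) 1)" borel borel borel])
  then show "sgn \<in> restrict_space (uniform_measure lborel (ball 0 1)) (- {0::'a}) \<rightarrow>\<^sub>M borel"
    by (rule measurable_restrict_space1)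
qed

lemma emeasure_sphere_measure:
  fixes A :: "'a::euclidean_space set"
  assumes "A \<in> sets borel" "A \<subseteq> sphere 0 1"
  shows "emeasure sphere_measure A =
    emeasure lborel {x \<in> ball 0 1. sgn x \<in> A} / emeasure lborel (ball (0::'a) 1)"
proof -
  have A: "A \<in> sets (restrict_space borel (sphere 0 1))"
    using assms by (auto simp: sets_restrict_space)
  have "0 \<notin> A"
    using assms(2) by auto
  then have eq: "sgn -` A \<inter> - {0} = sgn -` A"
    by auto
  have "(\<lambda>x::'a. x /\<^sub>R norm x) \<in> borel \<rightarrow>\<^sub>M borel"
    by measurable
  then have "(sgn :: 'a \<Rightarrow> 'a) \<in> borel \<rightarrow>\<^sub>M borel"
    by (simp add: sgn_div_norm[abs_def])
  from measurable_sets[OF this assms(1)] have S: "sgn -` A \<in> sets borel"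
    by simp
  have "emeasure sphere_measure A = emeasure (uniform_measure lborel (ball 0 1)) (sgn -` A)"
    unfolding sphere_measure_def
    using \<open>0 \<notin> A\<close>
    by (subst emeasure_distr[OF measurable_sgn_sphere A])
       (auto simp: space_restrict_space eq intro!: emeasure_restrict_space)
  also have "\<dots> = emeasure lborel (ball 0 1 \<inter> sgn -` A) / emeasure lborel (ball (0::'a) 1)"
    using S by (intro emeasure_uniform_measure) auto
  also have "ball 0 1 \<inter> sgn -` A = {x \<in> ball 0 1. sgn x \<in> A}"
    by auto
  finally show ?thesis .
qed

lemma emeasure_sphere_measure_total: "emeasure sphere_measure (sphere (0::'a::euclidean_space) 1) = 1"
proof -
  have "{x \<in> ball 0 1. sgn x \<in> sphere 0 1} = ball 0 1 - {0::'a}"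
    by (auto simp: norm_sgn)
  moreover have "emeasure lborel (ball 0 1 - {0::'a}) = emeasure lborel (ball (0::'a) 1)"
    by (subst emeasure_Diff) auto
  moreover have "emeasure lborel (ball (0::'a) 1) \<noteq> 0"
    using content_ball_pos[of 1 "0::'a"] by (auto simp: measure_def)
  moreover have "emeasure lborel (ball (0::'a) 1) < \<infinity>"
    by (rule emeasure_bounded_finite) simp
  ultimately show ?thesis
    by (subst emeasure_sphere_measure) (auto simp: ennreal_divide_self)
qed

lemma finite_measure_sphere_measure: "finite_measure (sphere_measure :: 'a::euclidean_space measure)"
  by (rule finite_measureI) (simp add: emeasure_sphere_measure_total)

text \<open>The Gegenbauer (ultraspherical) polynomial \<open>C\<^sub>k\<^sup>\<lambda>\<close>, i.e. the coefficient of \<open>r\<^sup>k\<close> in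
  \<open>(1 - 2 t r + r\<^sup>2) powr (- \<lambda>)\<close>.\<close>

definition gegenbauer :: "nat \<Rightarrow> real \<Rightarrow> real \<Rightarrow> real" where
  "gegenbauer k l t =
     (\<Sum>j\<le>k div 2. (- 1) ^ j * pochhammer l (k - j) / (fact j * fact (k - 2 * j))
                     * (2 * t) ^ (k - 2 * j))"

text \<open>In \<open>zonal\<close>, \<open>sphere_proj\<close> and \<open>bochner_riesz\<close> the number \<open>n\<close> is the dimension of
  the sphere, so they are meant for \<open>DIM('a) = n + 1\<close>.\<close>

definition zonal :: "nat \<Rightarrow> nat \<Rightarrow> 'a::euclidean_space \<Rightarrow> 'a \<Rightarrow> real" where
  "zonal n k x y =
     (let l = (real n - 1) / 2 in (real k + l) / l * gegenbauer k l (x \<bullet> y))"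

definition sphere_proj :: "nat \<Rightarrow> nat \<Rightarrow> ('a::euclidean_space \<Rightarrow> real) \<Rightarrow> 'a \<Rightarrow> real" where
  "sphere_proj n k f x = (LINT y|sphere_measure. zonal n k x y * f y)"

definition bochner_riesz ::
  "nat \<Rightarrow> real \<Rightarrow> real \<Rightarrow> ('a::euclidean_space \<Rightarrow> real) \<Rightarrow> 'a \<Rightarrow> real" where
  "bochner_riesz n \<delta> R f x =
     (\<Sum>k | real (k * (k + n - 1)) < R\<^sup>2.
        (1 - real (k * (k + n - 1)) / R\<^sup>2) powr \<delta> * sphere_proj n k f x)"

lemma finite_bochner_riesz_index:
  assumes "n \<ge> 1"
  shows "finite {k. real (k * (k + n - 1)) < R\<^sup>2}"
proof (rule finite_subset)
  show "{k. real (k * (k + n - 1)) < R\<^sup>2} \<subseteq> {.. nat \<lceil>\<bar>R\<bar>\<rceil>}"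
  proof
    fix k assume "k \<in> {k. real (k * (k + n - 1)) < R\<^sup>2}"
    then have k: "real (k * (k + n - 1)) < R\<^sup>2"
      by simp
    have "k \<le> k + n - 1"
      using assms by linarith
    then have "k * k \<le> k * (k + n - 1)"
      by (rule mult_le_mono2)
    then have "real k * real k \<le> real (k * (k + n - 1))"
      by (metis of_nat_le_iff of_nat_mult)
    with k have "(real k)\<^sup>2 < \<bar>R\<bar>\<^sup>2"
      by (simp add: power2_eq_square)
    then have "real k < \<bar>R\<bar>"
      by (rule power_less_imp_less_base) simp
    then have "k \<le> nat \<lceil>\<bar>R\<bar>\<rceil>"
      by linarith
    then show "k \<in> {.. nat \<lceil>\<bar>R\<bar>\<rceil>}"
      by simp
  qed
qed simp

end

theory Submission
  imports Defs "HOL-Complex_Analysis.Complex_Analysis" "HOL-Real_Asymp.Real_Asymp"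
begin

text \<open>Put \<open>\<lambda> = (n - 1) / 2\<close>, \<open>u\<^sub>k = k + \<lambda>\<close> and \<open>M\<^sup>2 = R\<^sup>2 + \<lambda>\<^sup>2\<close>. As \<open>k (k + n - 1) = u\<^sub>k\<^sup>2 - \<lambda>\<^sup>2\<close>, the
mean of order \<open>\<lambda>\<close> integrates against the zonal kernel \<open>K\<^sub>R\<close> (\<open>bochner_kernel\<close>) with
\<open>R ^ (n - 1) * K\<^sub>R (cos \<theta>) = \<Sum>k. (M\<^sup>2 - u\<^sub>k\<^sup>2)\<^sub>+ powr \<lambda> * (u\<^sub>k / \<lambda>) * C\<^sub>k\<^sup>\<lambda> (cos \<theta>)\<close>.
At this order the kernel neither decays nor converges as \<open>R\<close> grows: for fixed \<open>\<theta>\<close> it oscillates in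
\<open>M\<close> with frequencies \<open>\<plusminus> \<theta> + 2 \<pi> m\<close>, and its component of frequency \<open>\<theta>\<close> has an amplitude proportional
to \<open>\<theta> powr (- \<lambda> - 1) * sin \<theta> powr (- \<lambda>)\<close>, which is at least \<open>\<theta> powr (- n)\<close>: just not integrable on
the \<open>n\<close>-dimensional sphere. This logarithmic divergence is what the theorem exploits.

The amplitude is found by a mean in \<open>M\<close> with the weight \<open>exp (- e M)\<close>, \<open>e \<rightarrow> 0\<close>, that is, by the
boundary behaviour of a Laplace transform. Such a mean needs only the leading term of each factor:
the Laplace transform of \<open>(M\<^sup>2 - u\<^sup>2)\<^sub>+ powr \<lambda>\<close> for large \<open>u\<close> (\<open>riesz_laplace_asymp\<close>) and the
Gegenbauer polynomial at a fixed angle for large degree (\<open>gegenbauer_asymp\<close>). The result is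
\<open>kernel_laplace_limit\<close>.

Now let a probability measure with masses \<open>w\<^sub>i\<close> at points \<open>y\<^sub>i\<close> replace \<open>f\<close>, and let the angles \<open>\<theta>\<^sub>i\<close>
between \<open>x\<close> and \<open>y\<^sub>i\<close> be linearly independent over the rationals together with \<open>\<pi>\<close>. The Riesz product
\<open>\<Prod>i. 1 + cos (M * \<theta>\<^sub>i + phase\<^sub>i)\<close> is nonnegative and has mean \<open>1\<close>, and apart from its constant term it shares
with the kernels only the frequencies \<open>\<plusminus> \<theta>\<^sub>i\<close>. Testing against it adds up all amplitudes, so that
the upper limit of \<open>\<bar>\<Sum>i. w\<^sub>i * K\<^sub>R (cos \<theta>\<^sub>i)\<bar>\<close> is at least half the sum of the
\<open>w\<^sub>i * \<theta>\<^sub>i powr (- n)\<close> (\<open>riesz_product_lower_bound\<close>). For sufficiently dense points this sum exceeds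
any bound at every \<open>x\<close> (\<open>weighted_points\<close>), and for almost every choice of the points the angles are
independent for almost every \<open>x\<close> (\<open>generic_points\<close>), because the sets \<open>{y. x \<bullet> y = c}\<close> are null sets.

Spreading the masses over small caps turns the measure into a function of norm \<open>1\<close> in \<open>L\<^sup>1\<close> whose means are
large, at one of finitely many \<open>R\<close>, outside a set of small measure (\<open>large_on_most_of_sphere\<close>).
Finally these functions, with rapidly decreasing coefficients, are summed in a gliding hump. Without a
bound for the maximal function of the partial sums, the new term cannot simply be made to dominate
the old ones; instead the coefficient of the new term is chosen among \<open>q\<close> equally spaced values, and at each \<open>x\<close> outside a small
set at most one of them can fail (\<open>enlarge_on_most_of_sphere\<close>).\<close>

section \<open>The Gamma integral with a complex parameter\<close>

lemma powr_exp_has_integral: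
  fixes a b :: real
  assumes "a > 0" "b > -1"
  shows "has_bochner_integral lborel (\<lambda>v. indicator {0..} v * v powr b * exp (- (a * v)))
           (Gamma (b + 1) * a powr (- (b + 1)))"
proof -
  have 1: "has_bochner_integral lborel (\<lambda>v. indicator {0..} v * v powr b * exp (- v)) (Gamma (b + 1))"
  proof (rule has_bochner_integral_nn_integral)
    show "(\<integral>\<^sup>+ x. ennreal (indicat_real {0..} x * x powr b * exp (- x)) \<partial>lborel) = ennreal (Gamma (b + 1))"
      using Gamma_conv_nn_integral_real[of "b + 1"] assms
      by (simp add: exp_minus divide_inverse)
    show "0 \<le> Gamma (b + 1)"
      using assms by (intro less_imp_le Gamma_real_pos) auto
  qed auto
  have "has_bochner_integral lborel
      (\<lambda>x. indicator {0..} (0 + a * x) * (0 + a * x) powr b * exp (- (0 + a * x))) (Gamma (b + 1) /\<^sub>R \<bar>a\<bar>)"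
    using assms(1) by (subst lborel_has_bochner_integral_real_affine_iff[symmetric, where c = a and t = 0, OF _ ]) (use 1 in auto)
  then have "has_bochner_integral lborel
      (\<lambda>x. a powr (-b) * (indicator {0..} (0 + a * x) * (0 + a * x) powr b * exp (- (0 + a * x)))) (a powr (-b) * (Gamma (b + 1) /\<^sub>R \<bar>a\<bar>))"
    by (intro has_bochner_integral_mult_right) auto
  moreover have "a powr (-b) * (indicator {0..} (0 + a * x) * (0 + a * x) powr b * exp (- (0 + a * x)))
      = indicator {0..} x * x powr b * exp (- (a * x))" for x
    using assms(1) by (auto simp: indicator_def powr_mult powr_minus zero_le_mult_iff)
  moreover have "a powr (-b) * (Gamma (b + 1) /\<^sub>R \<bar>a\<bar>) = Gamma (b + 1) * a powr (- (b + 1))"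
    using assms(1) by (simp add: powr_diff powr_minus field_simps)
  ultimately show ?thesis by (simp only:)
qed

text \<open>The integrand itself need not be integrable, since a divergent Bochner integral has the value \<open>0\<close>.\<close>

lemma norm_integral_le_integral:
  fixes f :: "'a \<Rightarrow> 'b::{banach, second_countable_topology}"
  assumes "integrable M g" "\<And>x. x \<in> space M \<Longrightarrow> norm (f x) \<le> g x"
  shows "norm (integral\<^sup>L M f) \<le> integral\<^sup>L M g"
proof (cases "integrable M f")
  case True
  have "norm (integral\<^sup>L M f) \<le> (LINT x|M. norm (f x))"
    by (rule integral_norm_bound)
  also have "\<dots> \<le> integral\<^sup>L M g"
    using True assms by (intro integral_mono) auto
  finally show ?thesis .
next
  case False
  have "0 \<le> integral\<^sup>L M g"
    by (intro Bochner_Integration.integral_nonneg_AE AE_I2 order_trans[OF norm_ge_zero assms(2)])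
  then show ?thesis using False by (simp add: not_integrable_integral_eq)
qed

definition powr_laplace :: "real \<Rightarrow> complex \<Rightarrow> complex" where
  "powr_laplace b z = (LINT v|lborel. of_real (indicator {0..} v * v powr b) * exp (- (z * of_real v)))"

lemma norm_powr_laplace_integrand:
  "norm (of_real (indicator {0..} v * v powr b) * exp (- (z * of_real v))) =
     indicator {0..} v * v powr b * exp (- (Re z * v))"
  by (simp add: norm_mult)

lemma powr_laplace_integrable:
  assumes "Re z > 0" "b > -1"
  shows "integrable lborel (\<lambda>v. of_real (indicator {0..} v * v powr b) * exp (- (z * of_real v)))"
proof (rule Bochner_Integration.integrable_bound)
  show "integrable lborel (\<lambda>v. indicator {0..} v * v powr b * exp (- (Re z * v)))"
    using powr_exp_has_integral[OF assms] by (simp add: has_bochner_integral_iff)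
  show "(\<lambda>v. of_real (indicator {0..} v * v powr b) * exp (- (z * of_real v))) \<in> borel_measurable lborel"
    by measurable
qed (simp only: norm_powr_laplace_integrand, auto)

lemma powr_laplace_of_real:
  assumes "a > 0" "b > -1"
  shows "powr_laplace b (of_real a) = of_real (Gamma (b + 1) * a powr (- (b + 1)))"
proof -
  have "powr_laplace b (of_real a) =
    (LINT v|lborel. complex_of_real (indicator {0..} v * v powr b * exp (- (a * v))))"
    unfolding powr_laplace_def
    by (intro Bochner_Integration.integral_cong) (simp_all flip: exp_of_real)
  also have "\<dots> = of_real (Gamma (b + 1) * a powr (- (b + 1)))"
    using powr_exp_has_integral[OF assms]
    by (simp only: integral_complex_of_real has_bochner_integral_iff)
  finally show ?thesis .
qed

text \<open>Differentiation under the integral sign. The second-order Taylor bound for the exponential produces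
a factor \<open>exp (norm h * v)\<close>, which half of the real part of \<open>z\<close> absorbs.\<close>

lemma powr_laplace_has_field_derivative:
  assumes "Re z > 0" "b > -1"
  shows "(powr_laplace b has_field_derivative (- powr_laplace (b + 1) z)) (at z)"
proof -
  define x where "x = Re z / 2"
  have x: "x > 0" using assms by (simp add: x_def)
  define C where "C = Gamma (b + 3) * x powr (- (b + 3))"
  have bound: "norm (powr_laplace b (z + h) - powr_laplace b z + h * powr_laplace (b + 1) z) \<le> C * (norm h)\<^sup>2"
    if h: "norm h \<le> x" for h
  proof -
    let ?w = "\<lambda>v. complex_of_real (indicator {0..} v * v powr b)"
    have zh: "Re (z + h) > 0"
      using h abs_Re_le_cmod[of h] x by (simp add: x_def abs_le_iff)
    have i1: "integrable lborel (\<lambda>v. ?w v * exp (- ((z + h) * of_real v)))"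
      by (rule powr_laplace_integrable[OF zh assms(2)])
    have i2: "integrable lborel (\<lambda>v. ?w v * exp (- (z * of_real v)))"
      by (rule powr_laplace_integrable[OF assms])
    have i3: "integrable lborel (\<lambda>v. complex_of_real (indicator {0..} v * v powr (b + 1)) * exp (- (z * of_real v)))"
      using assms by (intro powr_laplace_integrable) auto
    have "powr_laplace b (z + h) - powr_laplace b z + h * powr_laplace (b + 1) z =
      (LINT v|lborel. ?w v * exp (- ((z + h) * of_real v)) - ?w v * exp (- (z * of_real v))
         + h * (complex_of_real (indicator {0..} v * v powr (b + 1)) * exp (- (z * of_real v))))"
      unfolding powr_laplace_def using i1 i2 i3 by simp
    then have "norm (powr_laplace b (z + h) - powr_laplace b z + h * powr_laplace (b + 1) z) =
      norm (LINT v|lborel. ?w v * exp (- ((z + h) * of_real v)) - ?w v * exp (- (z * of_real v))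
         + h * (complex_of_real (indicator {0..} v * v powr (b + 1)) * exp (- (z * of_real v))))"
      by (rule arg_cong)
    also have "\<dots> \<le> (LINT v|lborel. norm h ^ 2 * (indicator {0..} v * v powr (b + 2) * exp (- (x * v))))"
    proof (rule Bochner_Integration.integral_norm_bound_integral)
      show "integrable lborel (\<lambda>v. ?w v * exp (- ((z + h) * of_real v)) - ?w v * exp (- (z * of_real v))
         + h * (complex_of_real (indicator {0..} v * v powr (b + 1)) * exp (- (z * of_real v))))"
        using i1 i2 i3 by simp
      show "integrable lborel (\<lambda>v. norm h ^ 2 * (indicator {0..} v * v powr (b + 2) * exp (- (x * v))))"
        using powr_exp_has_integral[of x "b + 2"] x assms by (simp add: has_bochner_integral_iff)
      fix v :: real
      let ?L = "?w v * exp (- ((z + h) * of_real v)) - ?w v * exp (- (z * of_real v))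
         + h * (complex_of_real (indicator {0..} v * v powr (b + 1)) * exp (- (z * of_real v)))"
      show "norm ?L \<le> norm h ^ 2 * (indicator {0..} v * v powr (b + 2) * exp (- (x * v)))"
      proof (cases "v > 0")
        case True
        have "?L = of_real (v powr b) * exp (- (z * of_real v)) * (exp (- (h * of_real v)) - (1 - h * of_real v))"
        proof -
          have "exp (- ((z + h) * of_real v)) = exp (- (z * of_real v)) * exp (- (h * of_real v))"
            unfolding exp_add[symmetric] by (rule arg_cong[of _ _ exp]) (simp add: algebra_simps)
          moreover define X Y where "X = exp (- (z * of_real v))" and "Y = exp (- (h * of_real v))"
          ultimately have "exp (- ((z + h) * of_real v)) = X * Y" by simp
          then show ?thesis
            using True by (simp add: powr_add flip: X_def Y_def) (simp add: algebra_simps)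
        qed
        also have "norm \<dots> = v powr b * exp (- (Re z * v)) * norm (exp (- (h * of_real v)) - (1 - h * of_real v))"
          by (simp add: norm_mult)
        also have "\<dots> \<le> v powr b * exp (- (Re z * v)) * (exp (x * v) * (norm h * v)\<^sup>2)"
        proof (rule mult_left_mono)
          have "norm (exp (- (h * of_real v)) - (\<Sum>k\<le>1. (- (h * of_real v)) ^ k / fact k))
              \<le> exp \<bar>Re (- (h * of_real v))\<bar> * (norm (- (h * of_real v)) ^ (Suc 1)) / fact 1"
            by (rule Taylor_exp)
          also have "\<dots> = exp \<bar>Re (- (h * of_real v))\<bar> * (norm h * v)\<^sup>2"
            using True by (simp add: norm_mult power2_eq_square)
          also have "\<dots> \<le> exp (x * v) * (norm h * v)\<^sup>2"
          proof (rule mult_right_mono)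
            have "\<bar>Re (- (h * of_real v))\<bar> = \<bar>Re h\<bar> * v"
              using True by (simp add: abs_mult)
            also have "\<dots> \<le> x * v"
              using abs_Re_le_cmod[of h] True h by (intro mult_right_mono) auto
            finally show "exp \<bar>Re (- (h * of_real v))\<bar> \<le> exp (x * v)" by simp
          qed simp
          finally show "norm (exp (- (h * of_real v)) - (1 - h * of_real v)) \<le> exp (x * v) * (norm h * v)\<^sup>2"
            by simp
        qed simp
        also have "\<dots> = (norm h)\<^sup>2 * (v powr (b + 2) * (exp (- (Re z * v)) * exp (x * v)))"
          using True by (simp add: powr_add power2_eq_square)
        also have "exp (- (Re z * v)) * exp (x * v) = exp (- (x * v))"
          unfolding exp_add[symmetric] by (rule arg_cong[of _ _ exp]) (simp add: x_def)
        finally show ?thesis using True by simp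
      next
        case False
        then show ?thesis by (cases "v = 0") (auto simp: indicator_def)
      qed
    qed
    also have "\<dots> = C * (norm h)\<^sup>2"
    proof -
      have *: "b + 2 + 1 = b + 3" by simp
      have "b + 2 > -1" using assms(2) by simp
      from powr_exp_has_integral[OF x this, unfolded *]
      have "(LINT v|lborel. indicator {0..} v * v powr (b + 2) * exp (- (x * v))) = C"
        unfolding C_def by (rule has_bochner_integral_integral_eq)
      then show ?thesis
        by (simp only: integral_mult_right_zero mult.commute)
    qed
    finally show ?thesis .
  qed
  show ?thesis
    unfolding DERIV_def
  proof (rule Lim_null[THEN iffD2], rule Lim_null_comparison)
    show "((\<lambda>h. C * norm h) \<longlongrightarrow> 0) (at (0::complex))"
      by (auto intro!: tendsto_eq_intros)
    have "eventually (\<lambda>h::complex. h \<noteq> 0 \<and> norm h < x) (at 0)"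
      using x by (auto simp: eventually_at intro!: exI[of _ x])
    then show "\<forall>\<^sub>F h in at 0. norm ((powr_laplace b (z + h) - powr_laplace b z) / h - - powr_laplace (b + 1) z)
        \<le> C * norm h"
    proof eventually_elim
      case (elim h)
      then have "norm ((powr_laplace b (z + h) - powr_laplace b z) / h - - powr_laplace (b + 1) z)
         = norm (powr_laplace b (z + h) - powr_laplace b z + h * powr_laplace (b + 1) z) / norm h"
        by (simp add: field_simps flip: norm_divide)
      also have "\<dots> \<le> C * (norm h)\<^sup>2 / norm h"
        using bound[of h] elim by (intro divide_right_mono) auto
      finally show ?case using elim by (simp add: power2_eq_square)
    qed
  qed
qed

text \<open>Both sides are holomorphic in the right half plane, and they agree on the positive real axis.\<close>

lemma powr_laplace_eq:
  assumes "Re z > 0" "b > -1"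
  shows "powr_laplace b z = of_real (Gamma (b + 1)) * z powr (of_real (- (b + 1)))"
proof -
  let ?S = "{w. Re w > 0}"
  let ?f = "\<lambda>w. powr_laplace b w - of_real (Gamma (b + 1)) * w powr (of_real (- (b + 1)))"
  have nz: "w \<notin> \<real>\<^sub>\<le>\<^sub>0" if "Re w > 0" for w
    using that by (auto simp: complex_nonpos_Reals_iff)
  have holo: "?f holomorphic_on ?S"
    unfolding holomorphic_on_def
  proof safe
    fix w assume "Re w > 0"
    then show "?f field_differentiable at w within ?S"
      using powr_laplace_has_field_derivative[OF _ assms(2), of w] nz
      by (intro derivative_intros field_differentiable_powr_of_int)
         (auto simp: field_differentiable_def intro: has_field_derivative_at_within
               intro!: derivative_eq_intros)
  qed
  have "?f z = 0"
  proof (rule analytic_continuation[OF holo])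
    show "open ?S" by (rule open_halfspace_Re_gt)
    show "connected ?S" by (intro convex_connected convex_halfspace_Re_gt)
    show "of_real ` {0<..} \<subseteq> ?S" by auto
    show "1 \<in> ?S" by simp
    show "z \<in> ?S" using assms by simp
    show "(1::complex) islimpt of_real ` {0<..}"
      unfolding islimpt_approachable
    proof (intro allI impI)
      fix e :: real assume "e > 0"
      then show "\<exists>x'\<in>of_real ` {0<..}. x' \<noteq> (1::complex) \<and> dist x' 1 < e"
        by (intro bexI[of _ "of_real (1 + e / 2)"])
           (auto simp: dist_norm norm_divide intro!: image_eqI[of _ _ "1 + e / 2"])
    qed
    fix w :: complex assume "w \<in> of_real ` {0<..}"
    then obtain a where a: "w = of_real a" "a > 0" by auto
    show "?f w = 0"
      unfolding a(1) using a(2) assms(2)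
      by (subst powr_laplace_of_real) (simp_all add: powr_of_real[symmetric])
  qed
  then show ?thesis by simp
qed


text \<open>Of interest because the bound does not involve \<open>Re z\<close>, although the integral ceases to converge
absolutely as \<open>Re z \<rightarrow> 0\<close>.\<close>

lemma norm_powr_laplace_le:
  assumes "Re z > 0" "b > -1" "Im z \<noteq> 0"
  shows "norm (powr_laplace b z) \<le> Gamma (b + 1) * \<bar>Im z\<bar> powr (- (b + 1))"
proof -
  have "norm (z powr of_real (- (b + 1))) = norm z powr (- (b + 1))"
    using assms by (auto simp: powr_def)
  also have "\<dots> \<le> \<bar>Im z\<bar> powr (- (b + 1))"
    by (rule powr_mono2') (use assms abs_Im_le_cmod in auto)
  finally show ?thesis
    using assms Gamma_real_pos[of "b + 1"]
    by (simp add: powr_laplace_eq norm_mult mult_left_mono)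
qed

lemma convex_horizontal_line: "convex {w. Im w = c}"
proof -
  have "{w. Im w = c} = {w. \<i> \<bullet> w = c}" by (auto simp: inner_complex_def)
  then show ?thesis by (metis convex_hyperplane)
qed

text \<open>The mean value inequality on a horizontal line, along which the derivative is bounded in terms of
\<open>Im z\<close> alone.\<close>

lemma powr_laplace_diff_le:
  assumes "Re z > 0" "b > -1" "Im z \<noteq> 0" "q \<ge> 0"
  shows "norm (powr_laplace b (z + of_real q) - powr_laplace b z)
           \<le> Gamma (b + 2) * \<bar>Im z\<bar> powr (- (b + 2)) * q"
proof -
  let ?S = "{w. Re w > 0 \<and> Im w = Im z}"
  have "norm (powr_laplace b (z + of_real q) - powr_laplace b z)
      \<le> Gamma (b + 2) * \<bar>Im z\<bar> powr (- (b + 2)) * norm (z + of_real q - z)"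
  proof (rule field_differentiable_bound[where S = ?S])
    have "?S = {w. Re w > 0} \<inter> {w. Im w = Im z}" by auto
    then show "convex ?S"
      by (simp add: convex_Int convex_halfspace_Re_gt convex_horizontal_line)
  next
    fix w assume w: "w \<in> ?S"
    then show "(powr_laplace b has_field_derivative (- powr_laplace (b + 1) w)) (at w within ?S)"
      using powr_laplace_has_field_derivative[of w b] assms
      by (auto intro: has_field_derivative_at_within)
    show "norm (- powr_laplace (b + 1) w) \<le> Gamma (b + 2) * \<bar>Im z\<bar> powr (- (b + 2))"
    proof -
      have "b + 1 + 1 = b + 2" by simp
      then show ?thesis
        using norm_powr_laplace_le[of w "b + 1"] w assms(2,3) by (simp only: norm_minus_cancel) simp
    qed
  qed (use assms in auto)
  then show ?thesis using assms by simp
qed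

section \<open>The Laplace transform of a Riesz weight\<close>

text \<open>The factor \<open>(c + v) powr (- m)\<close> is what remains of a power of \<open>c + v\<close> with positive exponent
after an integral power has been split off and expanded.\<close>

definition shifted_laplace :: "real \<Rightarrow> real \<Rightarrow> real \<Rightarrow> complex \<Rightarrow> complex" where
  "shifted_laplace b m c s =
     (LINT v|lborel. of_real (indicator {0..} v * v powr b * (c + v) powr (- m)) * exp (- (s * of_real v)))"

lemma shifted_laplace_integrable:
  assumes "Re s > 0" "b > -1" "m > 0" "c > 0"
  shows "integrable lborel
    (\<lambda>v. of_real (indicator {0..} v * v powr b * (c + v) powr (- m)) * exp (- (s * of_real v)))"
proof (rule Bochner_Integration.integrable_bound)
  show "integrable lborel (\<lambda>v. c powr (- m) * (indicator {0..} v * v powr b * exp (- (Re s * v))))"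
    using powr_exp_has_integral[of "Re s" b] assms by (simp add: has_bochner_integral_iff)
  show "(\<lambda>v. of_real (indicator {0..} v * v powr b * (c + v) powr (- m)) * exp (- (s * of_real v)))
      \<in> borel_measurable lborel"
    by measurable
  show "AE v in lborel. norm (complex_of_real (indicator {0..} v * v powr b * (c + v) powr (- m)) * exp (- (s * of_real v)))
      \<le> norm (c powr (- m) * (indicator {0..} v * v powr b * exp (- (Re s * v))))"
  proof (rule AE_I2)
    fix v :: real
    show "norm (complex_of_real (indicator {0..} v * v powr b * (c + v) powr (- m)) * exp (- (s * of_real v)))
      \<le> norm (c powr (- m) * (indicator {0..} v * v powr b * exp (- (Re s * v))))"
    proof (cases "v \<ge> 0")
      case True
      then have "(c + v) powr (- m) \<le> c powr (- m)"
        using assms by (intro powr_mono2') auto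
      with True show ?thesis
        by (simp add: norm_mult mult_ac mult_left_mono)
    qed simp
  qed
qed

text \<open>Expressing the negative power of \<open>c + v\<close> as a Gamma integral in a new variable \<open>q\<close> moves the
oscillation into \<open>powr_laplace\<close>, which is explicit. The integral over \<open>q\<close> converges absolutely,
uniformly as \<open>Re s \<rightarrow> 0\<close>; the integral over \<open>v\<close> does not.\<close>

lemma shifted_laplace_eq:
  assumes "Re s > 0" "b > -1" "m > 0" "c > 0"
  shows "of_real (Gamma m) * shifted_laplace b m c s =
    (LINT q|lborel. of_real (indicator {0..} q * q powr (m - 1) * exp (- (c * q))) * powr_laplace b (s + of_real q))"
proof -
  define F where "F = (\<lambda>v q::real. complex_of_real (indicator {0..} v * v powr b *
      (indicator {0..} q * q powr (m - 1) * exp (- ((c + v) * q)))) * exp (- (s * of_real v)))"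
  have Fq: "F v q = (complex_of_real (indicator {0..} v * v powr b) * exp (- (s * of_real v)))
          * of_real (indicator {0..} q * q powr (m - 1) * exp (- ((c + v) * q)))" for v q
    by (simp add: F_def)
  have Fv: "F v q = of_real (indicator {0..} q * q powr (m - 1) * exp (- (c * q))) *
     (complex_of_real (indicator {0..} v * v powr b) * exp (- ((s + of_real q) * of_real v)))" for v q
  proof -
    have "exp (- ((s + of_real q) * of_real v)) = exp (- (s * of_real v)) * complex_of_real (exp (- (v * q)))"
      by (simp add: algebra_simps flip: exp_of_real exp_add)
    moreover have "exp (- ((c + v) * q)) = exp (- (c * q)) * exp (- (v * q))"
      by (simp add: algebra_simps flip: exp_add)
    ultimately show ?thesis by (simp add: F_def)
  qed
  have inner: "has_bochner_integral lborel (\<lambda>q. indicator {0..} q * q powr (m - 1) * exp (- ((c + v) * q)))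
     (Gamma m * (c + v) powr (- m))" if "v \<ge> 0" for v
    using powr_exp_has_integral[of "c + v" "m - 1"] that assms by simp
  have int_q: "integrable lborel (F v)" for v
  proof (cases "v \<ge> 0")
    case True
    show ?thesis unfolding Fq[abs_def]
      using inner[OF True]
      by (intro integrable_mult_right) (simp only: complex_of_real_integrable_eq has_bochner_integral_iff)
  qed (simp add: F_def)
  have int_F: "(LINT q|lborel. F v q) =
     of_real (Gamma m) * (of_real (indicator {0..} v * v powr b * (c + v) powr (- m)) * exp (- (s * of_real v)))" for v
  proof (cases "v \<ge> 0")
    case True
    show ?thesis unfolding Fq
      using inner[OF True]
      by (simp only: integral_mult_right_zero integral_complex_of_real has_bochner_integral_iff) (simp add: mult_ac)
  qed (simp add: F_def)
  have int_normF: "(LINT q|lborel. norm (F v q)) =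
     Gamma m * norm (of_real (indicator {0..} v * v powr b * (c + v) powr (- m)) * exp (- (s * of_real v)))" for v
  proof (cases "v \<ge> 0")
    case True
    have "norm (F v q) = (indicator {0..} v * v powr b * exp (- (Re s * v))) * 
        (indicator {0..} q * q powr (m - 1) * exp (- ((c + v) * q)))" for q
      unfolding Fq by (simp add: norm_mult)
    then show ?thesis
      using inner[OF True]
      by (simp only: integral_mult_right_zero has_bochner_integral_iff) (simp add: norm_mult mult_ac)
  qed (simp add: F_def)
  have prod: "integrable (lborel \<Otimes>\<^sub>M lborel) (case_prod F)"
  proof (rule lborel_pair.Fubini_integrable)
    show "(case_prod F) \<in> borel_measurable (lborel \<Otimes>\<^sub>M lborel)"
      unfolding F_def by measurable
    show "integrable lborel (\<lambda>x. LINT y|lborel. norm (case_prod F (x, y)))"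
      using shifted_laplace_integrable[OF assms]
      by (simp only: prod.case int_normF) (intro integrable_mult_right integrable_norm)
  qed (use int_q in auto)
  have "of_real (Gamma m) * shifted_laplace b m c s = (LINT v|lborel. LINT q|lborel. F v q)"
    unfolding int_F shifted_laplace_def by simp
  also have "\<dots> = (LINT q|lborel. LINT v|lborel. F v q)"
    using lborel_pair.Fubini_integral[OF prod] by simp
  also have "\<dots> = (LINT q|lborel. of_real (indicator {0..} q * q powr (m - 1) * exp (- (c * q))) * powr_laplace b (s + of_real q))"
    unfolding Fv powr_laplace_def by simp
  finally show ?thesis .
qed


lemma shifted_laplace_le:
  assumes "Re s > 0" "b > -1" "m > 0" "c > 0" "Im s \<noteq> 0"
  shows "norm (shifted_laplace b m c s) \<le> Gamma (b + 1) * \<bar>Im s\<bar> powr (- (b + 1)) * c powr (- m)"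
proof -
  let ?B = "Gamma (b + 1) * \<bar>Im s\<bar> powr (- (b + 1))"
  have G: "Gamma m > 0" using assms by (intro Gamma_real_pos)
  have i: "has_bochner_integral lborel (\<lambda>q. indicator {0..} q * q powr (m - 1) * exp (- (c * q))) (Gamma m * c powr (- m))"
    using powr_exp_has_integral[of c "m - 1"] assms by simp
  have "norm (of_real (Gamma m) * shifted_laplace b m c s)
     \<le> (LINT q|lborel. (indicator {0..} q * q powr (m - 1) * exp (- (c * q))) * ?B)"
    unfolding shifted_laplace_eq[OF assms(1-4)]
  proof (rule norm_integral_le_integral)
    show "integrable lborel (\<lambda>q. (indicator {0..} q * q powr (m - 1) * exp (- (c * q))) * ?B)"
      using i by (intro integrable_mult_left) (simp add: has_bochner_integral_iff)
    fix q :: real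
    show "norm (of_real (indicator {0..} q * q powr (m - 1) * exp (- (c * q))) * powr_laplace b (s + of_real q))
        \<le> (indicator {0..} q * q powr (m - 1) * exp (- (c * q))) * ?B"
    proof (cases "q \<ge> 0")
      case True
      have "norm (powr_laplace b (s + of_real q)) \<le> ?B"
        using norm_powr_laplace_le[of "s + of_real q" b] assms True by simp
      then show ?thesis
        using True by (simp add: norm_mult mult_left_mono)
    qed simp
  qed
  also have "\<dots> = Gamma m * c powr (- m) * ?B"
    using i by (simp add: has_bochner_integral_iff)
  finally have "Gamma m * norm (shifted_laplace b m c s) \<le> Gamma m * (?B * c powr (- m))"
    using G by (simp add: norm_mult mult_ac)
  then show ?thesis using G by simp
qed

text \<open>The main term comes from freezing \<open>powr_laplace b (s + q)\<close> at \<open>q = 0\<close>. The error is linear in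
\<open>q\<close>, and under the weight \<open>exp (- c q)\<close> a factor \<open>q\<close> is worth \<open>1 / c\<close>.\<close>

lemma shifted_laplace_diff_le:
  assumes "Re s > 0" "b > -1" "m > 0" "c > 0" "Im s \<noteq> 0"
  shows "norm (shifted_laplace b m c s - of_real (c powr (- m)) * powr_laplace b s)
    \<le> Gamma (b + 2) * \<bar>Im s\<bar> powr (- (b + 2)) * m * c powr (- (m + 1))"
proof -
  let ?B = "Gamma (b + 2) * \<bar>Im s\<bar> powr (- (b + 2))"
  have G: "Gamma m > 0" using assms by (intro Gamma_real_pos)
  have i: "has_bochner_integral lborel (\<lambda>q. indicator {0..} q * q powr (m - 1) * exp (- (c * q))) (Gamma m * c powr (- m))"
    using powr_exp_has_integral[of c "m - 1"] assms by simp
  have i': "has_bochner_integral lborel (\<lambda>q. indicator {0..} q * q powr m * exp (- (c * q))) (Gamma (m + 1) * c powr (- (m + 1)))"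
    using powr_exp_has_integral[of c "m"] assms by simp
  let ?w = "\<lambda>q. complex_of_real (indicator {0..} q * q powr (m - 1) * exp (- (c * q)))"
  have int1: "integrable lborel (\<lambda>q. ?w q * powr_laplace b (s + of_real q))"
  proof (rule Bochner_Integration.integrable_bound)
    show "integrable lborel (\<lambda>q. (indicator {0..} q * q powr (m - 1) * exp (- (c * q))) * (Gamma (b + 1) * \<bar>Im s\<bar> powr (- (b + 1))))"
      using i by (intro integrable_mult_left) (simp add: has_bochner_integral_iff)
    have "(\<lambda>q. ?w q * powr_laplace b (s + of_real q)) = (\<lambda>q. ?w q * (indicator {0..} q *\<^sub>R powr_laplace b (s + of_real q)))"
      by (auto simp: fun_eq_iff indicator_def)
    moreover have "continuous_on {0..} (\<lambda>q. powr_laplace b (s + of_real q))"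
    proof -
      have "continuous_on {w. Re w > 0} (powr_laplace b)"
        using powr_laplace_has_field_derivative[OF _ assms(2)]
        by (intro continuous_at_imp_continuous_on ballI) (auto intro: DERIV_isCont)
      then show ?thesis
        by (rule continuous_on_compose2) (use assms in \<open>auto intro!: continuous_intros\<close>)
    qed
    then have "(\<lambda>q. indicator {0..} q *\<^sub>R powr_laplace b (s + of_real q)) \<in> borel_measurable borel"
      by (intro borel_measurable_continuous_on_indicator) auto
    then have "(\<lambda>q. ?w q * (indicator {0..} q *\<^sub>R powr_laplace b (s + of_real q))) \<in> borel_measurable lborel"
      by measurable
    ultimately show "(\<lambda>q. ?w q * powr_laplace b (s + of_real q)) \<in> borel_measurable lborel"
      by (simp only:)
    show "AE q in lborel. norm (?w q * powr_laplace b (s + of_real q))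
       \<le> norm ((indicator {0..} q * q powr (m - 1) * exp (- (c * q))) * (Gamma (b + 1) * \<bar>Im s\<bar> powr (- (b + 1))))"
    proof (rule AE_I2)
      fix q :: real
      show "norm (?w q * powr_laplace b (s + of_real q))
       \<le> norm ((indicator {0..} q * q powr (m - 1) * exp (- (c * q))) * (Gamma (b + 1) * \<bar>Im s\<bar> powr (- (b + 1))))"
      proof (cases "q \<ge> 0")
        case True
        have "norm (powr_laplace b (s + of_real q)) \<le> \<bar>Gamma (b + 1) * \<bar>Im s\<bar> powr (- (b + 1))\<bar>"
          using norm_powr_laplace_le[of "s + of_real q" b] assms True by simp
        then show ?thesis
          using True by (simp add: norm_mult abs_mult[of "_ * _" "_ * _"] mult_left_mono)
      qed simp
    qed
  qed
  have int2: "has_bochner_integral lborel ?w (of_real (Gamma m * c powr (- m)))"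
    using i by (rule has_bochner_integral_of_real)
  have "of_real (Gamma m) * (shifted_laplace b m c s - of_real (c powr (- m)) * powr_laplace b s)
     = (LINT q|lborel. ?w q * powr_laplace b (s + of_real q)) - of_real (Gamma m * c powr (- m)) * powr_laplace b s"
    using shifted_laplace_eq[OF assms(1-4)] by (simp add: algebra_simps)
  also have "\<dots> = (LINT q|lborel. ?w q * powr_laplace b (s + of_real q) - ?w q * powr_laplace b s)"
    using int1 int2 by (subst Bochner_Integration.integral_diff) (simp_all only: has_bochner_integral_iff integrable_mult_left integral_mult_left_zero)
  finally have "norm (of_real (Gamma m) * (shifted_laplace b m c s - of_real (c powr (- m)) * powr_laplace b s))
      = norm (LINT q|lborel. ?w q * powr_laplace b (s + of_real q) - ?w q * powr_laplace b s)"
    by (rule arg_cong)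
  also have "\<dots> \<le> (LINT q|lborel. (indicator {0..} q * q powr m * exp (- (c * q))) * ?B)"
  proof (rule norm_integral_le_integral)
    show "integrable lborel (\<lambda>q. (indicator {0..} q * q powr m * exp (- (c * q))) * ?B)"
      using i' by (intro integrable_mult_left) (simp add: has_bochner_integral_iff)
    fix q :: real
    show "norm (?w q * powr_laplace b (s + of_real q) - ?w q * powr_laplace b s)
        \<le> (indicator {0..} q * q powr m * exp (- (c * q))) * ?B"
    proof (cases "q > 0")
      case True
      have "norm (?w q * powr_laplace b (s + of_real q) - ?w q * powr_laplace b s) =
         q powr (m - 1) * exp (- (c * q)) * norm (powr_laplace b (s + of_real q) - powr_laplace b s)"
        using True by (simp add: norm_mult flip: right_diff_distrib)
      also have "\<dots> \<le> q powr (m - 1) * exp (- (c * q)) * (?B * q)"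
        using powr_laplace_diff_le[of s b q] assms True by (intro mult_left_mono) auto
      also have "\<dots> = (indicator {0..} q * q powr m * exp (- (c * q))) * ?B"
        using True by (simp add: powr_diff)
      finally show ?thesis .
    next
      case False
      then show ?thesis by (cases "q = 0") auto
    qed
  qed
  also have "\<dots> = Gamma (m + 1) * c powr (- (m + 1)) * ?B"
    using i' by (simp add: has_bochner_integral_iff)
  also have "Gamma (m + 1) = m * Gamma m"
    using assms(3) by (intro Gamma_plus1) auto
  finally have "Gamma m * norm (shifted_laplace b m c s - of_real (c powr (- m)) * powr_laplace b s)
       \<le> Gamma m * (?B * m * c powr (- (m + 1)))"
    using G by (simp add: norm_mult mult_ac)
  then show ?thesis using G by simp
qed


text \<open>The Laplace transform in \<open>M\<close> of the truncated power \<open>(M\<^sup>2 - u\<^sup>2)\<^sub>+ powr l\<close>; up to a constant and powers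
of \<open>u\<close> and \<open>s\<close> it is a modified Bessel function of the second kind.\<close>

definition riesz_laplace :: "real \<Rightarrow> complex \<Rightarrow> real \<Rightarrow> complex" where
  "riesz_laplace l s u =
     (LINT M|lborel. of_real (indicator {u..} M * (M\<^sup>2 - u\<^sup>2) powr l) * exp (- (s * of_real M)))"

text \<open>A crude bound that ignores all oscillation. It serves to interchange sums and integrals.\<close>

lemma riesz_laplace_bound:
  fixes e l u :: real
  assumes "e > 0" "l \<ge> 0" "u \<ge> 0"
  shows "integrable lborel (\<lambda>M. indicator {u..} M * (M\<^sup>2 - u\<^sup>2) powr l * exp (- (e * M)))"
    and "(LINT M|lborel. indicator {u..} M * (M\<^sup>2 - u\<^sup>2) powr l * exp (- (e * M)))
       \<le> Gamma (2 * l + 1) * (e / 2) powr (- (2 * l + 1)) * exp (- (e / 2 * u))"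
proof -
  let ?g = "\<lambda>M. exp (- (e / 2 * u)) * (indicator {0..} M * M powr (2 * l) * exp (- (e / 2 * M)))"
  have i: "has_bochner_integral lborel ?g (exp (- (e / 2 * u)) * (Gamma (2 * l + 1) * (e / 2) powr (- (2 * l + 1))))"
    using assms powr_exp_has_integral[of "e / 2" "2 * l"]
    by (intro has_bochner_integral_mult_right) auto
  have le: "indicator {u..} M * (M\<^sup>2 - u\<^sup>2) powr l * exp (- (e * M)) \<le> ?g M" for M
  proof (cases "M \<ge> u")
    case True
    have "u\<^sup>2 \<le> M\<^sup>2" using True assms by (intro power_mono) auto
    then have "(M\<^sup>2 - u\<^sup>2) powr l \<le> (M\<^sup>2) powr l"
      using assms by (intro powr_mono2) auto
    also have "(M\<^sup>2) powr l = M powr (2 * l)"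
      using True assms by (cases "M = 0") (auto simp: powr_powr powr_numeral[symmetric] simp del: powr_numeral)
    finally have 1: "(M\<^sup>2 - u\<^sup>2) powr l \<le> M powr (2 * l)" .
    have "exp (- (e * M)) = exp (- (e / 2 * M)) * exp (- (e / 2 * M))"
      unfolding exp_add[symmetric] by (rule arg_cong[of _ _ exp]) simp
    also have "\<dots> \<le> exp (- (e / 2 * u)) * exp (- (e / 2 * M))"
      using True assms by (intro mult_right_mono) auto
    finally have 2: "exp (- (e * M)) \<le> exp (- (e / 2 * u)) * exp (- (e / 2 * M))" .
    have "(M\<^sup>2 - u\<^sup>2) powr l * exp (- (e * M)) \<le> M powr (2 * l) * (exp (- (e / 2 * u)) * exp (- (e / 2 * M)))"
      using 1 2 by (intro mult_mono) auto
    with True assms show ?thesis by (simp add: mult_ac)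
  qed simp
  show I: "integrable lborel (\<lambda>M. indicator {u..} M * (M\<^sup>2 - u\<^sup>2) powr l * exp (- (e * M)))"
  proof (rule Bochner_Integration.integrable_bound)
    show "integrable lborel ?g" using i by (simp only: has_bochner_integral_iff)
    show "AE M in lborel. norm (indicator {u..} M * (M\<^sup>2 - u\<^sup>2) powr l * exp (- (e * M))) \<le> norm (?g M)"
      by (rule AE_I2) (use le in \<open>auto simp: abs_mult\<close>)
  qed measurable
  have "(LINT M|lborel. indicator {u..} M * (M\<^sup>2 - u\<^sup>2) powr l * exp (- (e * M))) \<le> integral\<^sup>L lborel ?g"
    using le i I by (intro integral_mono) (auto simp only: has_bochner_integral_iff)
  also have "\<dots> = Gamma (2 * l + 1) * (e / 2) powr (- (2 * l + 1)) * exp (- (e / 2 * u))"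
    using has_bochner_integral_integral_eq[OF i] by (simp add: mult_ac)
  finally show "(LINT M|lborel. indicator {u..} M * (M\<^sup>2 - u\<^sup>2) powr l * exp (- (e * M)))
       \<le> Gamma (2 * l + 1) * (e / 2) powr (- (2 * l + 1)) * exp (- (e / 2 * u))" .
qed

lemma riesz_laplace_shift:
  assumes "u \<ge> 0"
  shows "riesz_laplace l s u = exp (- (s * of_real u)) *
    (LINT v|lborel. of_real (indicator {0..} v * v powr l * (2 * u + v) powr l) * exp (- (s * of_real v)))"
proof -
  have "riesz_laplace l s u = (LINT v|lborel. of_real (indicator {u..} (u + 1 * v) * ((u + 1 * v)\<^sup>2 - u\<^sup>2) powr l) * exp (- (s * of_real (u + 1 * v))))"
    unfolding riesz_laplace_def by (subst lborel_integral_real_affine[where c = 1 and t = u]) auto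
  also have "\<dots> = (LINT v|lborel. exp (- (s * of_real u)) * (of_real (indicator {0..} v * v powr l * (2 * u + v) powr l) * exp (- (s * of_real v))))"
  proof (intro Bochner_Integration.integral_cong refl)
    fix v :: real
    have "(u + v)\<^sup>2 - u\<^sup>2 = v * (2 * u + v)" by (simp add: power2_eq_square algebra_simps)
    moreover have "exp (- (s * of_real (u + v))) = exp (- (s * of_real u)) * exp (- (s * of_real v))"
      unfolding exp_add[symmetric] by (rule arg_cong[of _ _ exp]) (simp add: algebra_simps)
    ultimately show "of_real (indicator {u..} (u + 1 * v) * ((u + 1 * v)\<^sup>2 - u\<^sup>2) powr l) * exp (- (s * of_real (u + 1 * v)))
      = exp (- (s * of_real u)) * (of_real (indicator {0..} v * v powr l * (2 * u + v) powr l) * exp (- (s * of_real v)))"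
      using assms by (cases "v \<ge> 0") (simp_all add: powr_mult)
  qed
  finally show ?thesis by simp
qed

text \<open>After the substitution \<open>M = u + v\<close> the weight is \<open>v powr l * (2 * u + v) powr l\<close>. Splitting the
second factor into an integral power and a negative power and expanding the former gives a finite sum of
shifted Laplace transforms in which every additional factor \<open>v\<close> costs a factor \<open>u\<close>. The essential point
is that \<open>C\<close> is independent of \<open>Re s\<close>.\<close>

lemma riesz_laplace_asymp:
  assumes "l > 0" "t \<noteq> 0"
  shows "\<exists>C\<ge>0. \<forall>s u. Re s > 0 \<longrightarrow> \<bar>Im s\<bar> = \<bar>t\<bar> \<longrightarrow> 2 * u \<ge> 1 \<longrightarrow>
     norm (riesz_laplace l s u - exp (- (s * of_real u)) * of_real ((2 * u) powr l) * powr_laplace l s)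
       \<le> C * (2 * u) powr (l - 1) * exp (- (Re s * u))"
proof -
  \<comment> \<open>any natural number above \<open>l\<close> will do\<close>
  define N where "N = nat \<lceil>l\<rceil> + 1"
  define m where "m = real N - l"
  have m: "m > 0" unfolding m_def N_def using assms by linarith
  define B where "B = (\<lambda>i::nat. real (N choose i) * (Gamma (l + real i + 1) * \<bar>t\<bar> powr (- (l + real i + 1))))"
  define C where "C = Gamma (l + 2) * \<bar>t\<bar> powr (- (l + 2)) * m + (\<Sum>i\<in>{1..N}. B i)"
  have B: "B i \<ge> 0" for i
    using assms by (auto simp: B_def intro!: mult_nonneg_nonneg less_imp_le[OF Gamma_real_pos])
  have "C \<ge> 0"
    unfolding C_def using assms m B
    by (intro add_nonneg_nonneg mult_nonneg_nonneg sum_nonneg less_imp_le[OF Gamma_real_pos]) auto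
  moreover have "norm (riesz_laplace l s u - exp (- (s * of_real u)) * of_real ((2 * u) powr l) * powr_laplace l s)
       \<le> C * (2 * u) powr (l - 1) * exp (- (Re s * u))"
    if s: "Re s > 0" "\<bar>Im s\<bar> = \<bar>t\<bar>" and u: "2 * u \<ge> 1" for s u
  proof -
    let ?c = "2 * u"
    have Ims: "Im s \<noteq> 0" using s assms by auto
    let ?I = "\<lambda>i::nat. shifted_laplace (l + real i) m ?c s"
    have "(LINT v|lborel. of_real (indicator {0..} v * v powr l * (?c + v) powr l) * exp (- (s * of_real v)))
      = (LINT v|lborel. (\<Sum>i\<le>N. of_real (real (N choose i) * ?c ^ (N - i)) *
           (of_real (indicator {0..} v * v powr (l + real i) * (?c + v) powr (- m)) * exp (- (s * of_real v)))))"
    proof (intro Bochner_Integration.integral_cong refl)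
      fix v :: real
      show "of_real (indicator {0..} v * v powr l * (?c + v) powr l) * exp (- (s * of_real v)) =
         (\<Sum>i\<le>N. of_real (real (N choose i) * ?c ^ (N - i)) *
           (of_real (indicator {0..} v * v powr (l + real i) * (?c + v) powr (- m)) * exp (- (s * of_real v))))"
      proof (cases "v > 0")
        case True
        have "(?c + v) powr l = (?c + v) powr (real N + (- m))" by (simp add: m_def)
        also have "\<dots> = (?c + v) ^ N * (?c + v) powr (- m)"
          using True u unfolding powr_add by (subst powr_realpow) auto
        also have "(?c + v) ^ N = (v + ?c) ^ N" by (simp add: add.commute)
        also have "\<dots> = (\<Sum>i\<le>N. real (N choose i) * v ^ i * ?c ^ (N - i))"
          by (rule binomial_ring)
        finally have "v powr l * (?c + v) powr l = (\<Sum>i\<le>N. real (N choose i) * ?c ^ (N - i) * (v powr (l + real i) * (?c + v) powr (- m)))"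
          using True by (simp add: sum_distrib_left sum_distrib_right powr_add powr_realpow mult_ac)
        then have "complex_of_real (v powr l * (?c + v) powr l) = of_real (\<Sum>i\<le>N. real (N choose i) * ?c ^ (N - i) * (v powr (l + real i) * (?c + v) powr (- m)))"
          by (rule arg_cong)
        with True show ?thesis
          by (simp add: sum_distrib_left sum_distrib_right mult_ac)
      next
        case False
        then show ?thesis by (cases "v = 0") auto
      qed
    qed
    also have "\<dots> = (\<Sum>i\<le>N. of_real (real (N choose i) * ?c ^ (N - i)) * ?I i)"
      unfolding shifted_laplace_def using s u m assms
      by (subst Bochner_Integration.integral_sum)
         (auto intro!: integrable_mult_right shifted_laplace_integrable simp del: of_real_mult)
    finally have eq: "riesz_laplace l s u = exp (- (s * of_real u)) * (\<Sum>i\<le>N. of_real (real (N choose i) * ?c ^ (N - i)) * ?I i)"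
      using riesz_laplace_shift[of u l s] u by simp
    have split: "(\<Sum>i\<le>N. of_real (real (N choose i) * ?c ^ (N - i)) * ?I i) = of_real (?c ^ N) * ?I 0 +
       (\<Sum>i\<in>{1..N}. of_real (real (N choose i) * ?c ^ (N - i)) * ?I i)"
    proof -
      have "{..N} = insert 0 {1..N}" by auto
      then show ?thesis by (simp only:) (subst sum.insert; simp)
    qed
    have cl: "?c powr l = ?c ^ N * ?c powr (- m)"
    proof -
      have "?c powr l = ?c powr (real N + (- m))" by (simp add: m_def)
      also have "\<dots> = ?c ^ N * ?c powr (- m)"
        using u unfolding powr_add by (subst powr_realpow) auto
      finally show ?thesis .
    qed
    have "riesz_laplace l s u - exp (- (s * of_real u)) * of_real ((2 * u) powr l) * powr_laplace l s =
       exp (- (s * of_real u)) * (of_real (?c ^ N) * (?I 0 - of_real (?c powr (- m)) * powr_laplace l s) + 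
        (\<Sum>i\<in>{1..N}. of_real (real (N choose i) * ?c ^ (N - i)) * ?I i))"
      unfolding eq split cl by (simp add: algebra_simps)
    then have "norm (riesz_laplace l s u - exp (- (s * of_real u)) * of_real ((2 * u) powr l) * powr_laplace l s) =
       exp (- (Re s * u)) * norm (of_real (?c ^ N) * (?I 0 - of_real (?c powr (- m)) * powr_laplace l s) + 
        (\<Sum>i\<in>{1..N}. of_real (real (N choose i) * ?c ^ (N - i)) * ?I i))"
      by (simp add: norm_mult)
    also have "\<dots> \<le> exp (- (Re s * u)) * (C * ?c powr (l - 1))"
    proof (rule mult_left_mono)
      have "norm (of_real (?c ^ N) * (?I 0 - of_real (?c powr (- m)) * powr_laplace l s))
         \<le> ?c ^ N * (Gamma (l + 2) * \<bar>t\<bar> powr (- (l + 2)) * m * ?c powr (- (m + 1)))"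
        using shifted_laplace_diff_le[of s l m ?c] s u m assms Ims
        by (simp add: norm_mult norm_power mult_left_mono)
      also have "\<dots> = Gamma (l + 2) * \<bar>t\<bar> powr (- (l + 2)) * m * (?c ^ N * ?c powr (- (m + 1)))"
        by simp
      also have "?c ^ N * ?c powr (- (m + 1)) = ?c powr (l - 1)"
      proof -
        have "?c ^ N * ?c powr (- (m + 1)) = ?c powr (real N + - (m + 1))"
          using u unfolding powr_add by (subst powr_realpow) auto
        also have "real N + - (m + 1) = l - 1" by (simp add: m_def)
        finally show ?thesis .
      qed
      finally have 1: "norm (of_real (?c ^ N) * (?I 0 - of_real (?c powr (- m)) * powr_laplace l s))
          \<le> Gamma (l + 2) * \<bar>t\<bar> powr (- (l + 2)) * m * ?c powr (l - 1)" .
      have 2: "norm (\<Sum>i\<in>{1..N}. of_real (real (N choose i) * ?c ^ (N - i)) * ?I i) \<le> (\<Sum>i\<in>{1..N}. B i * ?c powr (l - 1))"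
      proof (rule sum_norm_le)
        fix i assume i: "i \<in> {1..N}"
        have "norm (of_real (real (N choose i) * ?c ^ (N - i)) * ?I i) = real (N choose i) * ?c ^ (N - i) * norm (?I i)"
          using u by (simp add: norm_mult norm_power)
        also have "\<dots> \<le> real (N choose i) * ?c ^ (N - i) * (Gamma (l + real i + 1) * \<bar>t\<bar> powr (- (l + real i + 1)) * ?c powr (- m))"
          using shifted_laplace_le[of s "l + real i" m ?c] s u m assms Ims
          by (intro mult_left_mono) auto
        also have "\<dots> = B i * (?c ^ (N - i) * ?c powr (- m))" by (simp add: B_def)
        also have "?c ^ (N - i) * ?c powr (- m) = ?c powr (real (N - i) + - m)"
          using u unfolding powr_add by (subst powr_realpow) auto
        also have "B i * \<dots> \<le> B i * ?c powr (l - 1)"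
          using i u B by (intro mult_left_mono powr_mono) (auto simp: m_def of_nat_diff)
        finally show "norm (of_real (real (N choose i) * ?c ^ (N - i)) * ?I i) \<le> B i * ?c powr (l - 1)" .
      qed
      show "norm (of_real (?c ^ N) * (?I 0 - of_real (?c powr (- m)) * powr_laplace l s) + 
        (\<Sum>i\<in>{1..N}. of_real (real (N choose i) * ?c ^ (N - i)) * ?I i)) \<le> C * ?c powr (l - 1)"
        using norm_triangle_mono[OF 1 2] by (simp only: C_def distrib_right sum_distrib_right)
    qed simp
    finally show ?thesis by (simp add: mult_ac)
  qed
  ultimately show ?thesis by blast
qed

section \<open>Binomial weights and Abel means\<close>

text \<open>The Taylor coefficients of \<open>(1 - x) powr (- l)\<close>. For \<open>l = \<lambda>\<close> they measure the size of the Gegenbauer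
polynomial of degree \<open>k\<close>; for \<open>l = n\<close> they replace the weights \<open>k ^ (n - 1)\<close>, to which they are
asymptotically proportional, because their power series are explicit.\<close>

definition binom_coeff :: "real \<Rightarrow> nat \<Rightarrow> real" where
  "binom_coeff l k = pochhammer l k / fact k"

lemma binom_coeff_pos: "l > 0 \<Longrightarrow> binom_coeff l k > 0"
  by (simp add: binom_coeff_def pochhammer_pos)

lemma binom_coeff_0 [simp]: "binom_coeff l 0 = 1"
  by (simp add: binom_coeff_def)

lemma binom_coeff_Suc: "(real k + 1) * binom_coeff l (Suc k) = (l + real k) * binom_coeff l k"
proof -
  have nz: "real k + 1 \<noteq> 0" by linarith
  have f: "fact (Suc k) = (real k + 1) * fact k" by (simp add: add.commute)
  have "(real k + 1) * binom_coeff l (Suc k) = (real k + 1) * (pochhammer l (Suc k) / ((real k + 1) * fact k))"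
    by (simp only: binom_coeff_def f)
  also have "\<dots> = pochhammer l (Suc k) / fact k"
    using nz by simp
  also have "\<dots> = (l + real k) * binom_coeff l k"
    by (simp add: binom_coeff_def pochhammer_Suc mult_ac)
  finally show ?thesis .
qed

lemma binom_coeff_sums:
  fixes z :: complex
  assumes "norm z < 1"
  shows "(\<lambda>k. of_real (binom_coeff l k) * z ^ k) sums (1 - z) powr (- of_real l)"
proof -
  have "(\<lambda>k. (- of_real l gchoose k) * (- z) ^ k) sums (1 + (- z)) powr (- of_real l)"
    using assms by (intro gen_binomial_complex) simp
  moreover have "(- of_real l gchoose k) * (- z) ^ k = of_real (binom_coeff l k) * z ^ k" for k
  proof -
    have "(- of_real l gchoose k) * (- z) ^ k = ((-1) ^ k * (-1) ^ k) * (pochhammer (of_real l) k / fact k) * z ^ k"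
      by (simp add: gbinomial_pochhammer power_minus[of z])
    also have "(-1) ^ k * (-1) ^ k = (1 :: complex)"
      by (simp flip: power_mult_distrib)
    finally show ?thesis by (simp add: binom_coeff_def pochhammer_of_real)
  qed
  ultimately show ?thesis by simp
qed

lemma binom_coeff_sums_real:
  assumes "0 \<le> r" "r < 1"
  shows "(\<lambda>k. binom_coeff l k * r ^ k) sums (1 - r) powr (- l)"
proof -
  have "(\<lambda>k. complex_of_real (binom_coeff l k * r ^ k)) sums (1 - of_real r) powr (- of_real l)"
    using binom_coeff_sums[of "of_real r" l] assms by simp
  also have "(1 - complex_of_real r) powr (- of_real l) = of_real ((1 - r) powr (- l))"
    using assms by (simp flip: powr_of_real)
  finally show ?thesis by (simp only: sums_of_real_iff)
qed

lemma binom_coeff_abs_summable: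
  assumes "norm (z :: complex) < 1" "l > 0"
  shows "summable (\<lambda>k. norm (of_real (binom_coeff l k) * z ^ k))"
  using binom_coeff_sums_real[of "norm z" l] binom_coeff_pos[OF assms(2)] assms
  by (simp add: norm_mult norm_power sums_iff less_imp_le)

text \<open>The weights \<open>binom_coeff l k * r ^ k\<close> have the total mass \<open>(1 - r) powr (- l)\<close>, which tends to
infinity, so a fixed number of terms is negligible in the mean.\<close>

lemma binom_coeff_abel_null:
  fixes g :: "nat \<Rightarrow> complex"
  assumes "l > 0" "g \<longlonglongrightarrow> 0"
  shows "((\<lambda>r. of_real ((1 - r) powr l) * (\<Sum>k. of_real (binom_coeff l k * r ^ k) * g k)) \<longlongrightarrow> 0) (at_left 1)"
proof -
  let ?a = "binom_coeff l"
  have a: "?a k \<ge> 0" for k using binom_coeff_pos[OF assms(1)] less_imp_le by blast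
  have "Bseq g" using assms(2) by (intro convergent_imp_Bseq) (auto simp: convergent_def)
  then obtain B where B: "B > 0" "\<And>k. norm (g k) \<le> B" by (auto elim: BseqE)
  show ?thesis
    unfolding tendsto_iff
  proof (intro allI impI)
    fix e :: real assume e: "e > 0"
    from assms(2) have "eventually (\<lambda>k. norm (g k) < e / 2) sequentially"
      using e by (intro order_tendstoD(2)[OF tendsto_norm_zero]) auto
    then obtain N where N: "\<And>k. k \<ge> N \<Longrightarrow> norm (g k) < e / 2"
      by (auto simp: eventually_at_top_linorder)
    define S where "S = (\<Sum>k<N. ?a k * B)"
    have "((\<lambda>r. (1 - r) powr l * S) \<longlongrightarrow> (1 - 1) powr l * S) (at_left 1)"
      using assms(1) by (intro tendsto_intros) (auto simp: eventually_at_filter)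
    then have "((\<lambda>r. (1 - r) powr l * S) \<longlongrightarrow> 0) (at_left 1)" using assms(1) by simp
    then have "eventually (\<lambda>r. (1 - r) powr l * S < e / 2) (at_left 1)"
      using e by (intro order_tendstoD) auto
    moreover have "eventually (\<lambda>r::real. 0 < r \<and> r < 1) (at_left 1)"
      by (intro eventually_conj eventually_at_left_real) (auto simp: eventually_at_left_field intro!: exI[of _ 0])
    ultimately show "eventually (\<lambda>r. dist (of_real ((1 - r) powr l) * (\<Sum>k. of_real (?a k * r ^ k) * g k)) 0 < e) (at_left 1)"
    proof eventually_elim
      case (elim r)
      have s: "(\<lambda>k. ?a k * r ^ k) sums (1 - r) powr (- l)"
        using elim by (intro binom_coeff_sums_real) auto
      have le: "norm (of_real (?a k * r ^ k) * g k) \<le> (if k < N then ?a k * B else 0) + e / 2 * (?a k * r ^ k)" for k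
      proof (cases "k < N")
        case True
        have "?a k * r ^ k * norm (g k) \<le> ?a k * 1 * B"
          using a elim B by (intro mult_mono mult_nonneg_nonneg power_le_one) auto
        moreover have "0 \<le> e / 2 * (?a k * r ^ k)" using e a elim by simp
        ultimately show ?thesis using True a elim by (simp add: norm_mult norm_power)
      next
        case False
        then have "?a k * r ^ k * norm (g k) \<le> ?a k * r ^ k * (e / 2)"
          using a elim N[of k] by (intro mult_left_mono mult_nonneg_nonneg) auto
        then show ?thesis using False a elim by (simp add: norm_mult norm_power mult_ac)
      qed
      have s2: "(\<lambda>k. (if k < N then ?a k * B else 0) + e / 2 * (?a k * r ^ k)) sums (S + e / 2 * (1 - r) powr (- l))"
        unfolding S_def
        by (intro sums_add sums_mult s) (use sums_If_finite_set[of "{..<N}" "\<lambda>k. ?a k * B"] in auto)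
      have "norm (\<Sum>k. of_real (?a k * r ^ k) * g k) \<le> S + e / 2 * (1 - r) powr (- l)"
        using norm_suminf_le[of "\<lambda>k. of_real (?a k * r ^ k) * g k", OF le] s2 by (simp only: sums_iff)
      then have "(1 - r) powr l * norm (\<Sum>k. of_real (?a k * r ^ k) * g k) \<le> (1 - r) powr l * (S + e / 2 * (1 - r) powr (- l))"
        by (intro mult_left_mono) auto
      also have "\<dots> = (1 - r) powr l * S + e / 2"
        using elim by (simp add: algebra_simps powr_minus)
      also have "\<dots> < e" using elim by simp
      finally show ?case by (simp add: norm_mult)
    qed
  qed
qed

section \<open>Asymptotics of Gegenbauer polynomials at a fixed angle\<close>

text \<open>The summands of the defining formula, continued by \<open>0\<close>, so that polynomials of different degrees can
be compared term by term over one index range.\<close>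

definition gegenbauer_summand :: "real \<Rightarrow> real \<Rightarrow> nat \<Rightarrow> nat \<Rightarrow> real" where
  "gegenbauer_summand l t k j = (if 2 * j \<le> k then (- 1) ^ j * pochhammer l (k - j) / (fact j * fact (k - 2 * j))
                     * (2 * t) ^ (k - 2 * j) else 0)"

lemma gegenbauer_eq_sum_summand:
  assumes "k \<le> K" shows "gegenbauer k l t = (\<Sum>j\<le>K. gegenbauer_summand l t k j)"
proof -
  have "gegenbauer k l t = (\<Sum>j\<le>k div 2. gegenbauer_summand l t k j)"
    unfolding gegenbauer_def by (intro sum.cong) (auto simp: gegenbauer_summand_def)
  also have "\<dots> = (\<Sum>j\<le>K. gegenbauer_summand l t k j)"
    using assms by (intro sum.mono_neutral_left) (auto simp: gegenbauer_summand_def)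
  finally show ?thesis .
qed

lemma gegenbauer_summand_recurrence:
  "(real k + 2) * gegenbauer_summand l t (k + 2) j =
     2 * (real k + 1 + l) * t * gegenbauer_summand l t (k + 1) j
     - (real k + 2 * l) * (case j of 0 \<Rightarrow> 0 | Suc i \<Rightarrow> gegenbauer_summand l t k i)"
proof -
  consider "2 * j \<le> k + 1" | "2 * j = k + 2" | "2 * j > k + 2" by linarith
  then show ?thesis
  proof cases
    case 1
    then obtain p where p: "k + 1 = p + 2 * j" by (metis le_add_diff_inverse2)
    show ?thesis
    proof (cases j)
      case 0
      then have k: "k + 1 = p" "real k = real p - 1" using p by auto
      have nz: "real k + 2 \<noteq> 0" by linarith
      have f: "fact (k + 2) = (real k + 2) * fact (k + 1)"
        by (simp only: add_2_eq_Suc' Suc_eq_plus1[symmetric] fact_Suc of_nat_Suc) simp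
      have q: "pochhammer l (k + 2) = pochhammer l (k + 1) * (l + (real k + 1))"
        by (simp only: add_2_eq_Suc' Suc_eq_plus1[symmetric] pochhammer_Suc of_nat_Suc) simp
      define X Y where "X = pochhammer l (k + 1)" and "Y = (fact (k + 1) :: real)"
      have "Y \<noteq> 0" by (simp add: Y_def)
      have E: "gegenbauer_summand l t (k + 2) 0 = X * (l + (real k + 1)) / ((real k + 2) * Y) * (2 * t) ^ (k + 2)"
        "gegenbauer_summand l t (k + 1) 0 = X / Y * (2 * t) ^ (k + 1)"
        unfolding gegenbauer_summand_def X_def Y_def f[symmetric] q[symmetric] by simp_all
      show ?thesis unfolding 0 nat.case E using nz \<open>Y \<noteq> 0\<close>
        by (simp add: divide_simps)
    next
      case (Suc i)
      have k: "k = p + 2 * i + 1" using p Suc by simp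
      have e: "k + 2 - j = Suc (p + i + 1)" "k + 2 - 2 * j = Suc p" "k + 1 - j = p + i + 1" "k + 1 - 2 * j = p"
          "k - i = p + i + 1" "k - 2 * i = Suc p" "2 * j \<le> k + 2" "2 * j \<le> k + 1" "2 * i \<le> k"
        using k Suc by auto
      define A P Fi Fp T where "A = (- 1 :: real) ^ i" and "P = pochhammer l (p + i + 1)"
        and "Fi = (fact i :: real)" and "Fp = (fact p :: real)" and "T = (2 * t) ^ p"
      note defs = A_def P_def Fi_def Fp_def T_def
      have nz: "real i + 1 \<noteq> 0" "real p + 1 \<noteq> 0" "Fi \<noteq> 0" "Fp \<noteq> 0" by (simp_all add: Fi_def Fp_def)
      have fS: "fact (Suc q) = (real q + 1) * (fact q :: real)" for q by (simp add: add.commute)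
      have 1: "gegenbauer_summand l t (k + 2) j =
         (- A) * (P * (l + real (p + i + 1))) / (((real i + 1) * Fi) * ((real p + 1) * Fp)) * (2 * t * T)"
        unfolding gegenbauer_summand_def e unfolding Suc defs pochhammer_Suc fS using k by simp
      have 2: "gegenbauer_summand l t (k + 1) j = (- A) * P / (((real i + 1) * Fi) * Fp) * T"
        unfolding gegenbauer_summand_def e unfolding Suc defs pochhammer_Suc fS using k by simp
      have 3: "gegenbauer_summand l t k i = A * P / (Fi * ((real p + 1) * Fp)) * (2 * t * T)"
        unfolding gegenbauer_summand_def e unfolding defs pochhammer_Suc fS using e(9) by simp
      have kr: "real k = real p + 2 * real i + 1" using k by simp
      show ?thesis unfolding 1 2 unfolding Suc nat.case 3 kr using nz
        by (simp add: divide_simps) (simp add: algebra_simps)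
    qed
  next
    case 2
    then obtain i where i: "j = Suc i" by (cases j) auto
    then have k: "k = 2 * i" using 2 by simp
    have nz: "real i + 1 \<noteq> 0" by linarith
    have e: "2 * i + 2 - Suc i = Suc i" "2 * i - i = i" "2 * i + 1 - Suc i = i" by auto
    show ?thesis unfolding i k gegenbauer_summand_def using nz
      by (simp add: e pochhammer_Suc divide_simps) (simp add: algebra_simps)
  next
    case 3
    then show ?thesis by (auto simp: gegenbauer_summand_def split: nat.splits)
  qed
qed

lemma gegenbauer_recurrence:
  "(real k + 2) * gegenbauer (k + 2) l t =
     2 * (real k + 1 + l) * t * gegenbauer (k + 1) l t - (real k + 2 * l) * gegenbauer k l t"
proof -
  have "(\<Sum>j\<le>k+2. case j of 0 \<Rightarrow> 0 | Suc i \<Rightarrow> gegenbauer_summand l t k i) = (\<Sum>j\<le>k+1. gegenbauer_summand l t k j)"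
  proof -
    have "{..k+2} = {..Suc (k+1)}" by simp
    then show ?thesis by (simp only: sum.atMost_Suc_shift) simp
  qed
  then have "(\<Sum>j\<le>k+2. (real k + 2) * gegenbauer_summand l t (k + 2) j) =
      2 * (real k + 1 + l) * t * (\<Sum>j\<le>k+2. gegenbauer_summand l t (k + 1) j) - (real k + 2 * l) * (\<Sum>j\<le>k+1. gegenbauer_summand l t k j)"
    by (simp only: gegenbauer_summand_recurrence sum_subtractf sum_distrib_left[symmetric])
  moreover have "gegenbauer k l t = (\<Sum>j\<le>k+1. gegenbauer_summand l t k j)"
      "gegenbauer (k + 1) l t = (\<Sum>j\<le>k+2. gegenbauer_summand l t (k + 1) j)"
      "gegenbauer (k + 2) l t = (\<Sum>j\<le>k+2. gegenbauer_summand l t (k + 2) j)"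
    by (intro gegenbauer_eq_sum_summand; simp)+
  ultimately show ?thesis by (simp only: sum_distrib_left[symmetric])
qed

lemma gegenbauer_0: "gegenbauer 0 l t = 1" and gegenbauer_1: "gegenbauer 1 l t = 2 * l * t"
  by (simp_all add: gegenbauer_def)

text \<open>For \<open>w\<close> and \<open>v\<close> with sum \<open>2 * t\<close> and product \<open>1\<close> the generating function
\<open>(1 - 2 * t * X + X\<^sup>2) powr (- l)\<close> splits into two binomial series. Their product satisfies a linear differential
equation of first order, which amounts to the three-term recurrence.\<close>

lemma gegenbauer_convolution:
  fixes w v :: complex
  assumes "w * v = 1" "w + v = 2 * of_real t"
  shows "of_real (gegenbauer k l t) =
     (\<Sum>i\<le>k. (of_real (binom_coeff l i) * w ^ i) * (of_real (binom_coeff l (k - i)) * v ^ (k - i)))"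
proof -
  define F where "F = (\<lambda>w::complex. Abs_fps (\<lambda>k. of_real (binom_coeff l k) * w ^ k))"
  have F: "(1 - fps_const w * fps_X) * fps_deriv (F w) = fps_const (of_real l * w) * F w" for w
  proof (rule fps_ext)
    fix k
    have b: "(1 + of_nat k) * complex_of_real (binom_coeff l (Suc k)) = (of_real l + of_nat k) * of_real (binom_coeff l k)" for k
    proof -
      have "complex_of_real ((real k + 1) * binom_coeff l (Suc k)) = of_real ((l + real k) * binom_coeff l k)"
        by (simp only: binom_coeff_Suc)
      then show ?thesis by (simp add: add.commute)
    qed
    show "fps_nth ((1 - fps_const w * fps_X) * fps_deriv (F w)) k = fps_nth (fps_const (of_real l * w) * F w) k"
    proof (cases k)
      case 0
      then show ?thesis using b[of 0] by (simp add: F_def algebra_simps)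
    next
      case (Suc m)
      have "fps_nth ((1 - fps_const w * fps_X) * fps_deriv (F w)) k = ((1 + of_nat k) * of_real (binom_coeff l (Suc k))) * w ^ Suc k
           - of_nat k * of_real (binom_coeff l k) * w ^ Suc k"
        using Suc by (simp add: F_def algebra_simps)
      also have "\<dots> = fps_nth (fps_const (of_real l * w) * F w) k"
        unfolding b by (simp add: F_def algebra_simps)
      finally show ?thesis .
    qed
  qed
  define P where "P = F w * F v"
  have "(1 - fps_const w * fps_X) * (1 - fps_const v * fps_X) * fps_deriv P =
     fps_const (of_real l) * (fps_const w * (1 - fps_const v * fps_X) + fps_const v * (1 - fps_const w * fps_X)) * P"
  proof -
    have "(1 - fps_const w * fps_X) * (1 - fps_const v * fps_X) * fps_deriv P =
      (1 - fps_const v * fps_X) * F v * ((1 - fps_const w * fps_X) * fps_deriv (F w)) +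
      (1 - fps_const w * fps_X) * F w * ((1 - fps_const v * fps_X) * fps_deriv (F v))"
      unfolding P_def fps_deriv_mult by (simp only: algebra_simps)
    also have "\<dots> = (1 - fps_const v * fps_X) * F v * (fps_const (of_real l * w) * F w) +
      (1 - fps_const w * fps_X) * F w * (fps_const (of_real l * v) * F v)"
      unfolding F ..
    also have "\<dots> = fps_const (of_real l) * (fps_const w * (1 - fps_const v * fps_X) + fps_const v * (1 - fps_const w * fps_X)) * P"
      unfolding P_def fps_const_mult[symmetric] by (simp only: algebra_simps)
    finally show ?thesis .
  qed
  moreover have "(1 - fps_const w * fps_X) * (1 - fps_const v * fps_X) = 1 - fps_const (w + v) * fps_X + fps_const (w * v) * fps_X * fps_X"
    unfolding fps_const_mult[symmetric] fps_const_add[symmetric] by (simp only: algebra_simps) simp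
  moreover have "fps_const w * (1 - fps_const v * fps_X) + fps_const v * (1 - fps_const w * fps_X) = fps_const (w + v) - fps_const (2 * (w * v)) * fps_X"
  proof -
    have "fps_const (2 * (w * v)) = fps_const w * fps_const v + fps_const v * fps_const w"
      by (simp add: mult.commute)
    then show ?thesis unfolding fps_const_add[symmetric] by (simp only: algebra_simps mult_1_left)
  qed
  ultimately have ode: "(1 - fps_const (2 * of_real t) * fps_X + fps_X * fps_X) * fps_deriv P =
     fps_const (of_real l) * (fps_const (2 * of_real t) - fps_const 2 * fps_X) * P"
    using assms by simp
  let ?p = "fps_nth P"
  have p0: "?p 0 = 1" by (simp add: P_def F_def)
  have p1: "?p 1 = 2 * of_real l * of_real t"
    using arg_cong[OF ode, of "\<lambda>f. fps_nth f 0"] p0 by (simp add: algebra_simps)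
  have rec: "(of_nat k + 2) * ?p (k + 2) = 2 * (of_nat k + 1 + of_real l) * of_real t * ?p (k + 1) - (of_nat k + 2 * of_real l) * ?p k" for k
    using arg_cong[OF ode, of "\<lambda>f. fps_nth f (Suc k)"]
    by (cases k) (simp_all add: algebra_simps)
  have "?p k = of_real (gegenbauer k l t) \<and> ?p (Suc k) = of_real (gegenbauer (Suc k) l t)" for k
  proof (induction k)
    case 0
    then show ?case using p0 p1 gegenbauer_0 gegenbauer_1 by simp
  next
    case (Suc k)
    have nz: "(of_nat k + 2 :: complex) \<noteq> 0" by (metis of_nat_Suc of_nat_add of_nat_eq_0_iff of_nat_numeral add_2_eq_Suc' nat.simps(3))
    have "(of_nat k + 2) * ?p (k + 2) = of_real ((real k + 2) * gegenbauer (k + 2) l t)"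
      unfolding rec gegenbauer_recurrence using Suc by simp
    then have "(of_nat k + 2) * ?p (k + 2) = (of_nat k + 2) * of_real (gegenbauer (k + 2) l t)"
      by simp
    then have "?p (k + 2) = of_real (gegenbauer (k + 2) l t)" using nz by simp
    with Suc show ?case by simp
  qed
  then have "of_real (gegenbauer k l t) = ?p k" by simp
  also have "\<dots> = (\<Sum>i\<le>k. (of_real (binom_coeff l i) * w ^ i) * (of_real (binom_coeff l (k - i)) * v ^ (k - i)))"
    unfolding P_def by (simp add: fps_mult_nth F_def atLeast0AtMost)
  finally show ?thesis .
qed


text \<open>For the quotients \<open>c\<^sub>k\<close> of \<open>gegenbauer\<close> and \<open>binom_coeff\<close> the three-term recurrence is a summable
perturbation of \<open>c\<^sub>k\<^sub>+\<^sub>2 = 2 * cos \<theta> * c\<^sub>k\<^sub>+\<^sub>1 - c\<^sub>k\<close>. The quantity below is a first integral of the unperturbed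
recurrence, and the \<open>c\<^sub>k\<close> can be recovered from it since they are real.\<close>

definition gegenbauer_amp :: "real \<Rightarrow> real \<Rightarrow> nat \<Rightarrow> complex" where
  "gegenbauer_amp l \<theta> k = cis (- (real k * \<theta>)) *
     (of_real (gegenbauer (k + 1) l (cos \<theta>) / binom_coeff l (k + 1))
      - cis (- \<theta>) * of_real (gegenbauer k l (cos \<theta>) / binom_coeff l k))"

lemma gegenbauer_normalized_recurrence:
  fixes t :: real
  assumes "l > 0"
  defines "c \<equiv> \<lambda>k. gegenbauer k l t / binom_coeff l k"
  shows "c (k + 2) = 2 * t * c (k + 1) - (1 - l * (l - 1) / ((real k + 1 + l) * (real k + l))) * c k"
proof -
  define a where "a = binom_coeff l"
  have a: "a k > 0" for k using assms by (simp add: a_def binom_coeff_pos)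
  have g: "gegenbauer k l t = a k * c k" for k using a[of k] by (simp add: c_def a_def)
  have pos: "real k + l > 0" "real k + 1 + l > 0" using assms(1) by auto
  have a1: "a k * (real k + l) = (real k + 1) * a (k + 1)" 
    using binom_coeff_Suc[of k l] by (simp add: a_def algebra_simps)
  have a2: "(real k + 2) * a (k + 2) = (real k + 1 + l) * a (k + 1)"
    using binom_coeff_Suc[of "k + 1" l] by (simp add: a_def algebra_simps)
  have "a (k + 1) * (real k + 1 + l) * (real k + l) * c (k + 2)
      = (real k + l) * ((real k + 2) * a (k + 2) * c (k + 2))"
    unfolding a2 by (simp only: mult_ac)
  also have "\<dots> = (real k + l) * ((real k + 2) * gegenbauer (k + 2) l t)"
    unfolding g by (simp only: mult_ac)
  also have "\<dots> = a (k + 1) * ((real k + l) * (real k + 1 + l) * 2 * t * c (k + 1)) - (real k + 2 * l) * (a k * (real k + l)) * c k"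
    unfolding gegenbauer_recurrence unfolding g by (simp add: algebra_simps)
  also have "\<dots> = a (k + 1) * ((real k + l) * (real k + 1 + l) * 2 * t * c (k + 1) - (real k + 2 * l) * (real k + 1) * c k)"
    unfolding a1 by (simp add: algebra_simps)
  also have "(real k + 2 * l) * (real k + 1) = (real k + 1 + l) * (real k + l) - l * (l - 1)"
    by (simp add: algebra_simps)
  finally have "(real k + 1 + l) * (real k + l) * c (k + 2) =
     (real k + l) * (real k + 1 + l) * 2 * t * c (k + 1) - ((real k + 1 + l) * (real k + l) - l * (l - 1)) * c k"
    using a[of "k + 1"] by simp
  then have "c (k + 2) = ((real k + l) * (real k + 1 + l) * 2 * t * c (k + 1) - ((real k + 1 + l) * (real k + l) - l * (l - 1)) * c k) / ((real k + 1 + l) * (real k + l))"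
    using pos by (simp add: eq_divide_eq mult_ac)
  also have "\<dots> = 2 * t * c (k + 1) - (1 - l * (l - 1) / ((real k + 1 + l) * (real k + l))) * c k"
    using pos by (simp add: diff_divide_distrib left_diff_distrib)
  finally show ?thesis .
qed

lemma summable_gegenbauer_perturbation:
  assumes "l > 0"
  shows "summable (\<lambda>k. \<bar>l * (l - 1) / ((real k + 1 + l) * (real k + l))\<bar>)"
proof (rule summable_comparison_test_ev)
  show "summable (\<lambda>k. \<bar>l * (l - 1)\<bar> * inverse ((real k) ^ 2))"
    by (intro summable_mult inverse_power_summable) auto
  show "\<forall>\<^sub>F k in sequentially. norm \<bar>l * (l - 1) / ((real k + 1 + l) * (real k + l))\<bar> \<le> \<bar>l * (l - 1)\<bar> * inverse ((real k) ^ 2)"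
    using eventually_gt_at_top[of 0]
  proof eventually_elim
    case (elim k)
    have "(real k) ^ 2 \<le> (real k + 1 + l) * (real k + l)"
      unfolding power2_eq_square using assms by (intro mult_mono) auto
    then have "\<bar>l * (l - 1)\<bar> / ((real k + 1 + l) * (real k + l)) \<le> \<bar>l * (l - 1)\<bar> / (real k) ^ 2"
      using elim assms by (intro divide_left_mono) auto
    then show ?case using assms by (simp add: abs_divide abs_mult divide_inverse)
  qed
qed

text \<open>The increments of \<open>gegenbauer_amp\<close> are bounded by a summable sequence times its modulus, so by a discrete
Gronwall argument it is bounded, and then its increments are summable.\<close>

lemma gegenbauer_amp_first_integral:
  assumes "l > 0" "0 < \<theta>" "\<theta> < pi"
  shows "convergent (gegenbauer_amp l \<theta>)"
    and "gegenbauer k l (cos \<theta>) / binom_coeff l k = Im (cis (real k * \<theta>) * gegenbauer_amp l \<theta> k) / sin \<theta>"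
proof -
  define c where "c = (\<lambda>k. gegenbauer k l (cos \<theta>) / binom_coeff l k)"
  define e where "e = (\<lambda>k. l * (l - 1) / ((real k + 1 + l) * (real k + l)))"
  define p where "p = gegenbauer_amp l \<theta>"
  have s: "sin \<theta> > 0" using assms by (intro sin_gt_zero)
  have pdef: "p k = cis (- (real k * \<theta>)) * (of_real (c (k + 1)) - cis (- \<theta>) * of_real (c k))" for k
    unfolding p_def gegenbauer_amp_def c_def ..
  have cp: "c k = Im (cis (real k * \<theta>) * p k) / sin \<theta>" for k
  proof -
    have "cis (real k * \<theta>) * p k = of_real (c (k + 1)) - cis (- \<theta>) * of_real (c k)"
      unfolding pdef mult.assoc[symmetric] cis_mult by simp
    then show ?thesis using s by (simp add: cis.ctr)
  qed
  then show "gegenbauer k l (cos \<theta>) / binom_coeff l k = Im (cis (real k * \<theta>) * gegenbauer_amp l \<theta> k) / sin \<theta>"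
    by (simp add: c_def p_def)
  have cle: "\<bar>c k\<bar> \<le> norm (p k) / sin \<theta>" for k
  proof -
    have "\<bar>Im (cis (real k * \<theta>) * p k)\<bar> \<le> norm (cis (real k * \<theta>) * p k)" by (rule abs_Im_le_cmod)
    then show ?thesis using s unfolding cp[of k] by (simp add: norm_mult divide_right_mono)
  qed
  have step: "p (Suc k) = p k + cis (- (real (k + 1) * \<theta>)) * of_real (e k * c k)" for k
  proof -
    have r: "c (k + 2) = 2 * cos \<theta> * c (k + 1) - (1 - e k) * c k"
      unfolding c_def e_def by (rule gegenbauer_normalized_recurrence[OF assms(1)])
    have cis2: "complex_of_real (2 * cos \<theta>) = cis \<theta> + cis (- \<theta>)"
      by (simp add: complex_eq_iff)
    have "of_real (c (k + 2)) - cis (- \<theta>) * of_real (c (k + 1)) =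
        cis \<theta> * of_real (c (k + 1)) - of_real (c k) + of_real (e k * c k)"
    proof -
      have "complex_of_real (c (k + 2)) = of_real (2 * cos \<theta>) * of_real (c (k + 1)) - (1 - of_real (e k)) * of_real (c k)"
        unfolding r by simp
      then show ?thesis unfolding cis2 by (simp add: algebra_simps)
    qed
    also have "\<dots> = cis \<theta> * (of_real (c (k + 1)) - cis (- \<theta>) * of_real (c k)) + of_real (e k * c k)"
      by (simp add: right_diff_distrib cis_mult mult.assoc[symmetric])
    finally have "p (Suc k) = cis (- (real (k + 1) * \<theta>)) * (cis \<theta> * (of_real (c (k + 1)) - cis (- \<theta>) * of_real (c k)) + of_real (e k * c k))"
      unfolding pdef by (simp add: numeral_2_eq_2)
    also have "cis (- (real (k + 1) * \<theta>)) * (cis \<theta> * (of_real (c (k + 1)) - cis (- \<theta>) * of_real (c k)) + of_real (e k * c k))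
       = (cis (- (real (k + 1) * \<theta>)) * cis \<theta>) * (of_real (c (k + 1)) - cis (- \<theta>) * of_real (c k)) + cis (- (real (k + 1) * \<theta>)) * of_real (e k * c k)"
      by (simp only: distrib_left mult.assoc)
    also have "cis (- (real (k + 1) * \<theta>)) * cis \<theta> = cis (- (real k * \<theta>))"
      by (simp add: cis_mult algebra_simps)
    finally show ?thesis unfolding pdef .
  qed
  have sume: "summable (\<lambda>k. \<bar>e k\<bar>)"
    unfolding e_def by (rule summable_gegenbauer_perturbation[OF assms(1)])
  have "norm (p k) \<le> norm (p 0) * exp ((\<Sum>j<k. \<bar>e j\<bar>) / sin \<theta>)" for k
  proof (induction k)
    case (Suc k)
    have "norm (p (Suc k)) \<le> norm (p k) + norm (cis (- (real (k + 1) * \<theta>)) * of_real (e k * c k))"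
      unfolding step by (rule norm_triangle_ineq)
    also have "\<dots> = norm (p k) + \<bar>e k\<bar> * \<bar>c k\<bar>"
      by (simp add: norm_mult abs_mult)
    also have "\<dots> \<le> norm (p k) + \<bar>e k\<bar> * (norm (p k) / sin \<theta>)"
      by (intro add_left_mono mult_left_mono cle) auto
    also have "\<dots> = norm (p k) * (1 + \<bar>e k\<bar> / sin \<theta>)" by (simp add: algebra_simps)
    also have "\<dots> \<le> norm (p k) * exp (\<bar>e k\<bar> / sin \<theta>)"
      by (intro mult_left_mono exp_ge_add_one_self) auto
    also have "\<dots> \<le> (norm (p 0) * exp ((\<Sum>j<k. \<bar>e j\<bar>) / sin \<theta>)) * exp (\<bar>e k\<bar> / sin \<theta>)"
      by (intro mult_right_mono Suc) auto
    also have "\<dots> = norm (p 0) * exp ((\<Sum>j<Suc k. \<bar>e j\<bar>) / sin \<theta>)"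
      by (simp add: add_divide_distrib exp_add)
    finally show ?case .
  qed simp
  also have "norm (p 0) * exp ((\<Sum>j<k. \<bar>e j\<bar>) / sin \<theta>) \<le> norm (p 0) * exp ((\<Sum>j. \<bar>e j\<bar>) / sin \<theta>)" for k
    using s by (intro mult_left_mono) (auto intro!: divide_right_mono sum_le_suminf sume)
  finally obtain B where B: "\<And>k. norm (p k) \<le> B" by blast
  have "summable (\<lambda>k. p (Suc k) - p k)"
  proof (rule summable_comparison_test')
    show "summable (\<lambda>k. \<bar>e k\<bar> * (B / sin \<theta>))" by (intro summable_mult2 sume)
    fix k :: nat
    have "norm (p (Suc k) - p k) = \<bar>e k\<bar> * \<bar>c k\<bar>"
      unfolding step by (simp add: norm_mult abs_mult)
    also have "\<bar>c k\<bar> \<le> B / sin \<theta>"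
      using cle[of k] divide_right_mono[OF B[of k], of "sin \<theta>"] s by linarith
    finally show "norm (p (Suc k) - p k) \<le> \<bar>e k\<bar> * (B / sin \<theta>)"
      by (simp add: mult_left_mono)
  qed
  then have "(\<lambda>n. (\<Sum>k<n. p (Suc k) - p k)) \<longlonglongrightarrow> (\<Sum>k. p (Suc k) - p k)"
    by (rule summable_LIMSEQ)
  then have "(\<lambda>n. p n - p 0) \<longlonglongrightarrow> (\<Sum>k. p (Suc k) - p k)"
    by (simp add: sum_lessThan_telescope)
  from tendsto_add[OF this tendsto_const[of "p 0"]] show "convergent (gegenbauer_amp l \<theta>)"
    unfolding p_def[symmetric] convergent_def by auto
qed


text \<open>The limit of \<open>gegenbauer_amp\<close> provides \<open>P\<close>. To find its modulus, sum the generating function along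
the radius through \<open>cis (- \<theta>)\<close>. There it equals \<open>(1 - r) powr (- l) * (1 - r * cis (- 2 * \<theta>)) powr (- l)\<close>,
while termwise only the part of the asymptotic formula that does not oscillate survives, contributing
\<open>P * (1 - r) powr (- l)\<close>. Hence \<open>P = (1 - cis (- 2 * \<theta>)) powr (- l)\<close>.\<close>

lemma gegenbauer_asymp:
  assumes "l > 0" "0 < \<theta>" "\<theta> < pi"
  shows "\<exists>P. norm P = (2 * sin \<theta>) powr (- l) \<and>
     (\<lambda>k. of_real (gegenbauer k l (cos \<theta>) / binom_coeff l k)
            - (P * cis (real k * \<theta>) + cnj P * cis (- (real k * \<theta>)))) \<longlonglongrightarrow> 0"
proof -
  define c where "c = (\<lambda>k. gegenbauer k l (cos \<theta>) / binom_coeff l k)"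
  define p where "p = gegenbauer_amp l \<theta>"
  have s: "sin \<theta> > 0" using assms by (intro sin_gt_zero)
  obtain q where q: "p \<longlonglongrightarrow> q"
    using gegenbauer_amp_first_integral(1)[OF assms] unfolding p_def convergent_def by auto
  define P where "P = q / (2 * \<i> * of_real (sin \<theta>))"
  have P: "P * cis x + cnj P * cis (- x) = of_real (Im (cis x * q) / sin \<theta>)" for x
    using s unfolding P_def by (simp add: complex_eq_iff Re_divide Im_divide power2_eq_square field_simps)
  define g where "g = (\<lambda>k. of_real (c k) - (P * cis (real k * \<theta>) + cnj P * cis (- (real k * \<theta>))))"
  have g0: "g \<longlonglongrightarrow> 0"
  proof (rule Lim_null_comparison)
    have "(\<lambda>k. norm (p k - q) / sin \<theta>) \<longlonglongrightarrow> norm (q - q) / sin \<theta>"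
      by (intro tendsto_intros q) (use s in auto)
    then show "(\<lambda>k. norm (p k - q) / sin \<theta>) \<longlonglongrightarrow> 0" by simp
    show "\<forall>\<^sub>F k in sequentially. norm (g k) \<le> norm (p k - q) / sin \<theta>"
    proof (intro always_eventually allI)
      fix k
      have "g k = of_real (Im (cis (real k * \<theta>) * (p k - q)) / sin \<theta>)"
        unfolding g_def P c_def gegenbauer_amp_first_integral(2)[OF assms] p_def
        by (simp add: right_diff_distrib diff_divide_distrib del: of_real_divide flip: of_real_diff)
      then have "norm (g k) = \<bar>Im (cis (real k * \<theta>) * (p k - q))\<bar> / sin \<theta>"
        using s by (simp only: norm_of_real) simp
      also have "\<dots> \<le> norm (cis (real k * \<theta>) * (p k - q)) / sin \<theta>"
        using s by (intro divide_right_mono abs_Im_le_cmod) auto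
      finally show "norm (g k) \<le> norm (p k - q) / sin \<theta>" by (simp add: norm_mult)
    qed
  qed
  define g' where "g' = (\<lambda>k. g k * cis (- (real k * \<theta>)))"
  have g'0: "g' \<longlonglongrightarrow> 0"
    using tendsto_norm_zero[OF g0] by (intro tendsto_norm_zero_cancel[of g']) (simp add: g'_def norm_mult)
  define z where "z = cis (- 2 * \<theta>)"
  have nz: "1 - z \<notin> \<real>\<^sub>\<le>\<^sub>0"
  proof -
    have "Re (1 - z) = 2 * (sin \<theta>)\<^sup>2" by (simp add: z_def cos_double_sin)
    with s show ?thesis by (simp add: complex_nonpos_Reals_iff)
  qed
  have lim_z: "((\<lambda>r. (1 - of_real r * z) powr (- of_real l)) \<longlongrightarrow> (1 - z) powr (- of_real l)) (at_left 1)"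
  proof (rule tendsto_powr_complex[OF nz _ tendsto_const])
    have "((\<lambda>r. 1 - of_real r * z) \<longlongrightarrow> 1 - of_real 1 * z) (at_left (1::real))"
      by (intro tendsto_intros)
    then show "((\<lambda>r. 1 - of_real r * z) \<longlongrightarrow> 1 - z) (at_left (1::real))" by simp
  qed
  have lim0: "((\<lambda>r::real. (1 - r) powr l) \<longlongrightarrow> 0) (at_left 1)"
  proof -
    have "((\<lambda>r::real. (1 - r) powr l) \<longlongrightarrow> (1 - 1) powr l) (at_left 1)"
      using assms(1) by (intro tendsto_intros) (auto simp: eventually_at_filter)
    then show ?thesis using assms(1) by simp
  qed
  have ev: "eventually (\<lambda>r::real. 0 < r \<and> r < 1) (at_left 1)"
    by (auto simp: eventually_at_left_field intro!: exI[of _ 0])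
  have key: "(1 - of_real r * z) powr (- of_real l) =
      P + cnj P * (of_real ((1 - r) powr l) * (1 - of_real r * z) powr (- of_real l))
        + of_real ((1 - r) powr l) * (\<Sum>k. of_real (binom_coeff l k * r ^ k) * g' k)"
    if r: "0 < r" "r < 1" for r
  proof -
    let ?a = "\<lambda>k. complex_of_real (binom_coeff l k)"
    have nr: "norm (complex_of_real r) < 1" "norm (of_real r * z) < 1"
      using r by (simp_all add: norm_mult z_def)
    have "(\<lambda>k. \<Sum>i\<le>k. (?a i * of_real r ^ i) * (?a (k - i) * (of_real r * z) ^ (k - i))) sums
       ((\<Sum>k. ?a k * of_real r ^ k) * (\<Sum>k. ?a k * (of_real r * z) ^ k))"
      using nr assms(1) by (intro Cauchy_product_sums binom_coeff_abs_summable)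
    moreover have "(\<Sum>i\<le>k. (?a i * of_real r ^ i) * (?a (k - i) * (of_real r * z) ^ (k - i)))
       = of_real (gegenbauer k l (cos \<theta>)) * (of_real r * cis (- \<theta>)) ^ k" for k
    proof -
      have e1: "of_real r * z = cis (- \<theta>) * (of_real r * cis (- \<theta>))"
        by (simp add: z_def cis_mult)
      have e2: "complex_of_real r = cis \<theta> * (of_real r * cis (- \<theta>))"
        by (simp add: cis_mult)
      have "(\<Sum>i\<le>k. (?a i * of_real r ^ i) * (?a (k - i) * (of_real r * z) ^ (k - i)))
        = (\<Sum>i\<le>k. ((?a i * cis \<theta> ^ i) * (?a (k - i) * cis (- \<theta>) ^ (k - i))) * (of_real r * cis (- \<theta>)) ^ k)"
      proof (intro sum.cong refl)
        fix i assume "i \<in> {..k}"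
        then have "(of_real r * cis (- \<theta>)) ^ k = (of_real r * cis (- \<theta>)) ^ i * (of_real r * cis (- \<theta>)) ^ (k - i)"
          by (simp flip: power_add)
        moreover have "complex_of_real r ^ i = cis \<theta> ^ i * (of_real r * cis (- \<theta>)) ^ i"
          by (subst e2) (rule power_mult_distrib)
        moreover have "(of_real r * z) ^ (k - i) = cis (- \<theta>) ^ (k - i) * (of_real r * cis (- \<theta>)) ^ (k - i)"
          by (subst e1) (rule power_mult_distrib)
        ultimately show "(?a i * of_real r ^ i) * (?a (k - i) * (of_real r * z) ^ (k - i)) =
           ((?a i * cis \<theta> ^ i) * (?a (k - i) * cis (- \<theta>) ^ (k - i))) * (of_real r * cis (- \<theta>)) ^ k"
          by (simp only: mult_ac)
      qed
      also have "\<dots> = of_real (gegenbauer k l (cos \<theta>)) * (of_real r * cis (- \<theta>)) ^ k"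
        unfolding sum_distrib_right[symmetric]
        by (subst gegenbauer_convolution[of "cis \<theta>" "cis (- \<theta>)"]) (simp_all add: cis_mult complex_eq_iff)
      finally show ?thesis .
    qed
    moreover have "(\<Sum>k. ?a k * of_real r ^ k) = of_real ((1 - r) powr (- l))"
      using binom_coeff_sums[OF nr(1), of l] r by (simp add: sums_iff flip: powr_of_real)
    moreover have "(\<Sum>k. ?a k * (of_real r * z) ^ k) = (1 - of_real r * z) powr (- of_real l)"
      using binom_coeff_sums[OF nr(2), of l] by (simp add: sums_iff)
    ultimately have S1: "(\<lambda>k. of_real (gegenbauer k l (cos \<theta>)) * (of_real r * cis (- \<theta>)) ^ k) sums
       (of_real ((1 - r) powr (- l)) * (1 - of_real r * z) powr (- of_real l))"
      by simp
    have expand: "of_real (gegenbauer k l (cos \<theta>)) * (of_real r * cis (- \<theta>)) ^ k =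
        P * (?a k * of_real r ^ k) + cnj P * (?a k * (of_real r * z) ^ k) + of_real (binom_coeff l k * r ^ k) * g' k" for k
    proof -
      have "gegenbauer k l (cos \<theta>) = binom_coeff l k * c k"
        using binom_coeff_pos[OF assms(1), of k] by (simp add: c_def)
      then have 1: "complex_of_real (gegenbauer k l (cos \<theta>)) = ?a k * (g k + (P * cis (real k * \<theta>) + cnj P * cis (- (real k * \<theta>))))"
        by (simp add: g_def)
      have 2: "(of_real r * cis (- \<theta>)) ^ k = of_real r ^ k * cis (- (real k * \<theta>))"
        using Complex.DeMoivre[of "- \<theta>" k] by (simp add: power_mult_distrib)
      have 3: "(of_real r * z) ^ k = of_real r ^ k * (cis (- (real k * \<theta>)) * cis (- (real k * \<theta>)))"
        by (simp add: power_mult_distrib Complex.DeMoivre z_def cis_mult mult_ac)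
      have 4: "cis (real k * \<theta>) * cis (- (real k * \<theta>)) = 1" by (simp add: cis_mult)
      have "?a k * (g k + (P * cis (real k * \<theta>) + cnj P * cis (- (real k * \<theta>)))) * (of_real r ^ k * cis (- (real k * \<theta>)))
        = P * (?a k * of_real r ^ k) * (cis (real k * \<theta>) * cis (- (real k * \<theta>))) + cnj P * (?a k * (of_real r ^ k * (cis (- (real k * \<theta>)) * cis (- (real k * \<theta>)))))
           + of_real (binom_coeff l k * r ^ k) * g k * cis (- (real k * \<theta>))"
        by (simp add: algebra_simps)
      then show ?thesis unfolding 1 2 3 4 g'_def by (simp only: mult_1_right mult.assoc)
    qed
    have sA: "(\<lambda>k. ?a k * of_real r ^ k) sums of_real ((1 - r) powr (- l))"
      using binom_coeff_sums[OF nr(1), of l] r by (simp flip: powr_of_real)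
    have sB: "(\<lambda>k. ?a k * (of_real r * z) ^ k) sums (1 - of_real r * z) powr (- of_real l)"
      using binom_coeff_sums[OF nr(2), of l] by simp
    let ?D = "complex_of_real ((1 - r) powr (- l)) * (1 - of_real r * z) powr (- of_real l)
         - P * of_real ((1 - r) powr (- l)) - cnj P * (1 - of_real r * z) powr (- of_real l)"
    have "(\<lambda>k. of_real (gegenbauer k l (cos \<theta>)) * (of_real r * cis (- \<theta>)) ^ k
        - P * (?a k * of_real r ^ k) - cnj P * (?a k * (of_real r * z) ^ k)) sums ?D"
      by (intro sums_diff S1 sums_mult sA sB)
    then have "(\<lambda>k. of_real (binom_coeff l k * r ^ k) * g' k) sums ?D"
      unfolding expand by simp
    then have S: "(\<Sum>k. of_real (binom_coeff l k * r ^ k) * g' k) = ?D" by (simp add: sums_iff)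
    have A: "complex_of_real ((1 - r) powr l) * of_real ((1 - r) powr (- l)) = 1"
      using r by (simp flip: of_real_mult powr_add)
    have eq: "Z = P + cnj P * (x * Z) + x * (y * Z - P * y - cnj P * Z)" if "x * y = 1" for x y Z :: complex
    proof -
      have "x * (y * Z - P * y - cnj P * Z) = (x * y) * Z - P * (x * y) - cnj P * (x * Z)"
        by (simp only: algebra_simps)
      then show ?thesis unfolding that by simp
    qed
    show ?thesis unfolding S by (rule eq[OF A])
  qed
  have "((\<lambda>r. P + cnj P * (of_real ((1 - r) powr l) * (1 - of_real r * z) powr (- of_real l))
        + of_real ((1 - r) powr l) * (\<Sum>k. of_real (binom_coeff l k * r ^ k) * g' k))
      \<longlongrightarrow> P + cnj P * (of_real 0 * (1 - z) powr (- of_real l)) + 0) (at_left 1)"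
    by (intro tendsto_intros lim_z lim0 binom_coeff_abel_null[OF assms(1) g'0])
  then have "((\<lambda>r. (1 - of_real r * z) powr (- of_real l)) \<longlongrightarrow> P) (at_left 1)"
    using eventually_mono[OF ev key[symmetric]] by (elim Lim_transform_eventually[THEN tendsto_eq_rhs]) auto
  from tendsto_unique[OF _ this lim_z] have "P = (1 - z) powr (- of_real l)"
    by simp
  then have "norm P = norm (1 - z) powr (- l)"
    using nz by (auto simp: powr_def complex_nonpos_Reals_iff)
  also have "norm (1 - z) = 2 * sin \<theta>"
  proof -
    have "(norm (1 - z))\<^sup>2 = (1 - cos (2 * \<theta>))\<^sup>2 + (sin (2 * \<theta>))\<^sup>2"
      by (simp add: z_def cmod_power2)
    also have "\<dots> = 2 - 2 * cos (2 * \<theta>)"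
      using sin_cos_squared_add[of "2 * \<theta>"] by (simp add: power2_eq_square algebra_simps)
    also have "\<dots> = (2 * sin \<theta>)\<^sup>2" by (simp add: cos_double_sin power2_eq_square)
    finally have "(norm (1 - z))\<^sup>2 = (2 * sin \<theta>)\<^sup>2" .
    then show ?thesis by (rule power2_eq_imp_eq) (use s in simp_all)
  qed
  finally have "norm P = (2 * sin \<theta>) powr (- l)" .
  with g0 show ?thesis unfolding g_def c_def by blast
qed


lemma binom_coeff_rGamma_series:
  assumes "l > 0" "k > 0"
  shows "binom_coeff l k = rGamma_series l k * real k powr l / (l + real k)"
proof -
  have "l + real k > 0" using assms by simp
  then show ?thesis using assms
    by (simp add: binom_coeff_def rGamma_series_def pochhammer_Suc powr_def divide_simps)
qed

text \<open>Both families of binomial weights are compared with powers of \<open>k\<close> through Gauss's limit formula for the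
Gamma function. The exponents match because \<open>2 * l = n - 1\<close>: this is where the order is critical.\<close>

lemma gegenbauer_weight_limit:
  assumes "n \<ge> 2"
  defines "l \<equiv> (real n - 1) / 2"
  shows "(\<lambda>k. (real k + l) / l * (2 * (real k + l)) powr l * binom_coeff l k / binom_coeff (real n) k)
      \<longlonglongrightarrow> 2 powr l * Gamma (real n) / (l * Gamma l)"
proof -
  have l: "l > 0" using assms by simp
  have n: "real n = 2 * l + 1" unfolding l_def by (simp add: field_simps)
  have ev: "\<forall>\<^sub>F k in sequentially.
     (2 powr l / l) * ((real k + l) / real k) powr l * ((real n + real k) / real k) * (rGamma_series l k / rGamma_series (real n) k)
     = (real k + l) / l * (2 * (real k + l)) powr l * binom_coeff l k / binom_coeff (real n) k"
    using eventually_gt_at_top[of 0]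
  proof eventually_elim
    case (elim k)
    have nn: "real n > 0" using assms by simp
    have k: "real k > 0" using elim by simp
    have R: "rGamma_series (real n) k \<noteq> 0"
      using binom_coeff_rGamma_series[OF nn elim] binom_coeff_pos[OF nn, of k] by auto
    define x y where "x = rGamma_series l k" and "y = rGamma_series (real n) k"
    define w where "w = real k powr l"
    have w: "w > 0" using k by (simp add: w_def)
    have kn: "real k powr real n = w * w * real k"
    proof -
      have "real n = l + l + 1" using n by simp
      then show ?thesis unfolding w_def using k by (simp only: powr_add) simp
    qed
    have f1: "((real k + l) / real k) powr l = (real k + l) powr l / w"
      using k l by (simp add: powr_divide w_def)
    have f2: "(2 * (real k + l)) powr l = 2 powr l * (real k + l) powr l"
      using k l by (subst powr_mult) auto
    have f3: "binom_coeff l k = x * w / (real k + l)"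
      using binom_coeff_rGamma_series[OF l elim] by (simp add: x_def w_def add.commute)
    have f4: "binom_coeff (real n) k = y * (w * w * real k) / (real n + real k)"
      using binom_coeff_rGamma_series[OF nn elim] by (simp only: y_def kn)
    have f5: "real n + real k > 0" "real k + l > 0" using k nn l by auto
    have f6: "(a / l) * (U / w) * (N / q) * (x / y) = K / l * (a * U) * (x * w / K) / (y * (w * w * q) / N)"
      if "N > 0" "K > 0" "q > 0" for a U N q K :: real
      using that w R l by (simp add: y_def field_simps)
    show ?case
      unfolding f1 f2 f3 f4 x_def[symmetric] y_def[symmetric] by (rule f6) (use f5 k in auto)
  qed
  have 1: "(\<lambda>k. (real k + l) / real k) \<longlonglongrightarrow> 1" "(\<lambda>k. (real n + real k) / real k) \<longlonglongrightarrow> 1"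
    by real_asymp+
  have "Gamma (real n) > 0" using assms(1) by (intro Gamma_real_pos) auto
  then have "rGamma (real n) \<noteq> 0" by (simp add: rGamma_inverse_Gamma)
  then have "(\<lambda>k. (2 powr l / l) * ((real k + l) / real k) powr l * ((real n + real k) / real k) * (rGamma_series l k / rGamma_series (real n) k))
     \<longlonglongrightarrow> (2 powr l / l) * 1 powr l * 1 * (rGamma l / rGamma (real n))"
    by (intro tendsto_intros 1 rGamma_series_LIMSEQ) auto
  then have "(\<lambda>k. (2 powr l / l) * ((real k + l) / real k) powr l * ((real n + real k) / real k) * (rGamma_series l k / rGamma_series (real n) k))
     \<longlonglongrightarrow> 2 powr l * Gamma (real n) / (l * Gamma l)"
    by (simp add: rGamma_inverse_Gamma divide_simps mult_ac)
  then show ?thesis by (rule Lim_transform_eventually) (rule ev)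
qed

text \<open>The factor \<open>(2 * (k + l)) powr l\<close> anticipates the main term of \<open>riesz_laplace_asymp\<close>.\<close>

lemma gegenbauer_weighted_asymp:
  assumes "n \<ge> 2" "0 < \<theta>" "\<theta> < pi"
  defines "l \<equiv> (real n - 1) / 2"
  shows "\<exists>P. norm P = Gamma (real n) * sin \<theta> powr (- l) / (l * Gamma l) \<and>
     (\<lambda>k. of_real ((real k + l) / l * gegenbauer k l (cos \<theta>) * (2 * (real k + l)) powr l / binom_coeff (real n) k)
            - (P * cis (real k * \<theta>) + cnj P * cis (- (real k * \<theta>)))) \<longlonglongrightarrow> 0"
proof -
  have l: "l > 0" using assms by simp
  have s: "sin \<theta> > 0" using assms by (intro sin_gt_zero)
  define \<rho> where "\<rho> = 2 powr l * Gamma (real n) / (l * Gamma l)"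
  define w where "w = (\<lambda>k. (real k + l) / l * (2 * (real k + l)) powr l * binom_coeff l k / binom_coeff (real n) k)"
  have w: "w \<longlonglongrightarrow> \<rho>" unfolding w_def \<rho>_def l_def by (rule gegenbauer_weight_limit[OF assms(1)])
  have \<rho>: "\<rho> > 0" unfolding \<rho>_def using l assms(1) by (simp add: Gamma_real_pos)
  obtain P where P: "norm P = (2 * sin \<theta>) powr (- l)"
    "(\<lambda>k. of_real (gegenbauer k l (cos \<theta>) / binom_coeff l k)
            - (P * cis (real k * \<theta>) + cnj P * cis (- (real k * \<theta>)))) \<longlonglongrightarrow> 0"
    using gegenbauer_asymp[OF l assms(2,3)] by blast
  define T where "T = (\<lambda>k. P * cis (real k * \<theta>) + cnj P * cis (- (real k * \<theta>)))"
  define g where "g = (\<lambda>k. of_real (gegenbauer k l (cos \<theta>) / binom_coeff l k) - T k)"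
  have g: "g \<longlonglongrightarrow> 0" using P(2) by (simp add: g_def T_def)
  have BT: "norm (T k) \<le> 2 * norm P" for k
    unfolding T_def mult_2 by (rule norm_triangle_mono) (simp_all add: norm_mult)
  have "(\<lambda>k. of_real (w k) * g k + of_real (w k - \<rho>) * T k) \<longlonglongrightarrow> 0"
  proof -
    have "(\<lambda>k. of_real (w k) * g k) \<longlonglongrightarrow> of_real \<rho> * 0"
      by (intro tendsto_intros w g)
    moreover have "(\<lambda>k. of_real (w k - \<rho>) * T k) \<longlonglongrightarrow> 0"
    proof (rule Lim_null_comparison)
      have "(\<lambda>k. \<bar>w k - \<rho>\<bar> * (2 * norm P)) \<longlonglongrightarrow> \<bar>\<rho> - \<rho>\<bar> * (2 * norm P)"
        by (intro tendsto_intros w)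
      then show "(\<lambda>k. \<bar>w k - \<rho>\<bar> * (2 * norm P)) \<longlonglongrightarrow> 0" by simp
      show "\<forall>\<^sub>F k in sequentially. norm (of_real (w k - \<rho>) * T k) \<le> \<bar>w k - \<rho>\<bar> * (2 * norm P)"
        by (intro always_eventually allI) (simp only: norm_mult norm_of_real mult_left_mono[OF BT] abs_ge_zero)
    qed
    ultimately show ?thesis using tendsto_add by fastforce
  qed
  moreover have "of_real (w k) * g k + of_real (w k - \<rho>) * T k =
     of_real ((real k + l) / l * gegenbauer k l (cos \<theta>) * (2 * (real k + l)) powr l / binom_coeff (real n) k)
            - ((of_real \<rho> * P) * cis (real k * \<theta>) + cnj (of_real \<rho> * P) * cis (- (real k * \<theta>)))" for k
  proof -
    have b: "binom_coeff l k \<noteq> 0" using binom_coeff_pos[OF l, of k] by simp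
    have "(real k + l) / l * gegenbauer k l (cos \<theta>) * (2 * (real k + l)) powr l / binom_coeff (real n) k
        = w k * (gegenbauer k l (cos \<theta>) / binom_coeff l k)"
      unfolding w_def using b by simp
    then have 1: "complex_of_real ((real k + l) / l * gegenbauer k l (cos \<theta>) * (2 * (real k + l)) powr l / binom_coeff (real n) k)
        = of_real (w k) * (g k + T k)"
      unfolding g_def by simp
    have 2: "(of_real \<rho> * P) * cis (real k * \<theta>) + cnj (of_real \<rho> * P) * cis (- (real k * \<theta>)) = of_real \<rho> * T k"
      unfolding T_def by (simp add: algebra_simps)
    show ?thesis unfolding 1 2 by (simp add: algebra_simps)
  qed
  moreover have "norm (of_real \<rho> * P) = Gamma (real n) * sin \<theta> powr (- l) / (l * Gamma l)"
  proof -
    have "(2 * sin \<theta>) powr (- l) = 2 powr (- l) * sin \<theta> powr (- l)"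
      using s by (simp add: powr_mult)
    moreover have "2 powr l * 2 powr (- l) = (1::real)" by (simp flip: powr_add)
    ultimately have "\<rho> * norm P = Gamma (real n) * sin \<theta> powr (- l) / (l * Gamma l)"
      unfolding \<rho>_def P by (simp add: field_simps)
    then show ?thesis using \<rho> by (simp add: norm_mult)
  qed
  ultimately show ?thesis by (intro exI[of _ "of_real \<rho> * P"]) simp
qed

section \<open>Resonances of the kernel\<close>

lemma binom_coeff_bounded_summable:
  fixes h :: "nat \<Rightarrow> complex"
  assumes "l > 0" "0 \<le> r" "r < 1" "\<And>k. norm (h k) \<le> B"
  shows "summable (\<lambda>k. of_real (binom_coeff l k * r ^ k) * h k)"
proof (rule summable_comparison_test')
  show "summable (\<lambda>k. B * (binom_coeff l k * r ^ k))"
    using binom_coeff_sums_real[OF assms(2,3), of l] by (intro summable_mult) (simp add: sums_iff)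
  fix k :: nat
  have "binom_coeff l k * r ^ k \<ge> 0" using binom_coeff_pos[OF assms(1), of k] assms by simp
  then show "norm (of_real (binom_coeff l k * r ^ k) * h k) \<le> B * (binom_coeff l k * r ^ k)"
    using mult_right_mono[OF assms(4)[of k], of "binom_coeff l k * r ^ k"]
    by (simp only: norm_mult norm_of_real) (simp add: mult_ac)
qed

lemma exp_abel_transfer:
  fixes F :: "real \<Rightarrow> complex"
  assumes "((\<lambda>r. of_real ((1 - r) powr real n) * F r) \<longlongrightarrow> L) (at_left 1)"
  shows "((\<lambda>e. of_real (e ^ n) * F (exp (- e))) \<longlongrightarrow> L) (at_right 0)"
proof -
  have "filterlim (\<lambda>e::real. exp (- e)) (at_left 1) (at_right 0)"
    by real_asymp
  from filterlim_compose[OF assms this]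
  have 1: "((\<lambda>e. of_real ((1 - exp (- e)) powr real n) * F (exp (- e))) \<longlongrightarrow> L) (at_right 0)" .
  have "((\<lambda>e::real. e / (1 - exp (- e))) \<longlongrightarrow> 1) (at_right 0)"
    by real_asymp
  then have 2: "((\<lambda>e::real. (e / (1 - exp (- e))) ^ n) \<longlongrightarrow> 1 ^ n) (at_right 0)"
    by (rule tendsto_power)
  have "((\<lambda>e. of_real ((e / (1 - exp (- e))) ^ n) * (of_real ((1 - exp (- e)) powr real n) * F (exp (- e)))) \<longlongrightarrow> of_real (1 ^ n) * L) (at_right 0)"
    by (intro tendsto_mult tendsto_of_real 1 2)
  moreover have "eventually (\<lambda>e::real. e > 0) (at_right 0)" by (simp add: eventually_at_right_less)
  then have "eventually (\<lambda>e. of_real ((e / (1 - exp (- e))) ^ n) * (of_real ((1 - exp (- e)) powr real n) * F (exp (- e))) = of_real (e ^ n) * F (exp (- e))) (at_right 0)"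
  proof eventually_elim
    case (elim e)
    then have "1 - exp (- e) > 0" by simp
    then have "(e / (1 - exp (- e))) ^ n * (1 - exp (- e)) powr real n = e ^ n"
      by (simp add: powr_realpow power_divide)
    then show ?case by (metis mult.assoc of_real_mult)
  qed
  ultimately have "((\<lambda>e. of_real (e ^ n) * F (exp (- e))) \<longlongrightarrow> of_real (1 ^ n) * L) (at_right 0)"
    by (rule Lim_transform_eventually)
  then show ?thesis by simp
qed

lemma abel_frequency:
  fixes z :: complex
  assumes "norm z = 1" "n > 0"
  shows "((\<lambda>r. of_real ((1 - r) powr real n) * (1 - of_real r * z) powr (- of_real (real n))) \<longlongrightarrow> (if z = 1 then 1 else 0)) (at_left 1)"
proof -
  have ev: "eventually (\<lambda>r::real. 0 < r \<and> r < 1) (at_left 1)"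
    by (auto simp: eventually_at_left_field intro!: exI[of _ 0])
  show ?thesis
  proof (cases "z = 1")
    case True
    have "eventually (\<lambda>r. 1 = of_real ((1 - r) powr real n) * (1 - of_real r * z) powr (- of_real (real n))) (at_left 1)"
      using ev
    proof eventually_elim
      case (elim r)
      have "(1 - of_real r * z) powr (- of_real (real n)) = of_real ((1 - r) powr (- real n))"
        using True elim powr_of_real[of "1 - r" "- real n"] by simp
      then show ?case using elim by (simp flip: of_real_mult powr_add)
    qed
    from Lim_transform_eventually[OF tendsto_const this] True show ?thesis by simp
  next
    case False
    have "((\<lambda>r::real. (1 - r) powr real n) \<longlongrightarrow> (1 - 1) powr real n) (at_left 1)"
      using assms(2) by (intro tendsto_intros) (auto simp: eventually_at_filter)
    then have 1: "((\<lambda>r::real. (1 - r) powr real n) \<longlongrightarrow> 0) (at_left 1)"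
      using assms(2) by simp
    have "((\<lambda>r. of_real ((1 - r) powr real n) * inverse ((1 - of_real r * z) ^ n)) \<longlongrightarrow> of_real 0 * inverse ((1 - of_real 1 * z) ^ n)) (at_left (1::real))"
      using False by (intro tendsto_intros 1) auto
    moreover have "eventually (\<lambda>r. of_real ((1 - r) powr real n) * inverse ((1 - of_real r * z) ^ n) = 
        of_real ((1 - r) powr real n) * (1 - of_real r * z) powr (- of_real (real n))) (at_left 1)"
      using ev
    proof eventually_elim
      case (elim r)
      have "1 - of_real r * z \<noteq> 0"
      proof
        assume "1 - of_real r * z = 0"
        then have "norm (of_real r * z) = 1" by simp
        then show False using elim assms by (simp add: norm_mult)
      qed
      then show ?case by (simp add: powr_minus powr_nat')
    qed
    ultimately have "((\<lambda>r. of_real ((1 - r) powr real n) * (1 - of_real r * z) powr (- of_real (real n))) \<longlongrightarrow> of_real 0 * inverse ((1 - of_real 1 * z) ^ n)) (at_left 1)"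
      by (rule Lim_transform_eventually)
    then show ?thesis using False by simp
  qed
qed

text \<open>An Abel mean annihilates every frequency except \<open>0\<close>.\<close>

lemma trig_abel_mean:
  fixes h :: "nat \<Rightarrow> complex"
  assumes n: "n > 0"
    and h: "(\<lambda>k. h k - (P * cis (real k * a) + Q * cis (real k * b))) \<longlonglongrightarrow> 0"
  shows "((\<lambda>e. of_real (e ^ n) * (\<Sum>k. of_real (binom_coeff (real n) k * exp (- e) ^ k) * h k)) \<longlongrightarrow>
           (if cis a = 1 then P else 0) + (if cis b = 1 then Q else 0)) (at_right 0)"
proof (rule exp_abel_transfer)
  define g where "g = (\<lambda>k. h k - (P * cis (real k * a) + Q * cis (real k * b)))"
  have ev: "eventually (\<lambda>r::real. 0 < r \<and> r < 1) (at_left 1)"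
    by (auto simp: eventually_at_left_field intro!: exI[of _ 0])
  have "Bseq g" using h unfolding g_def by (intro convergent_imp_Bseq) (auto simp: convergent_def)
  then obtain B where B: "\<And>k. norm (g k) \<le> B" unfolding Bseq_def by auto
  have key: "(\<Sum>k. of_real (binom_coeff (real n) k * r ^ k) * h k) =
      P * (1 - of_real r * cis a) powr (- of_real (real n)) + Q * (1 - of_real r * cis b) powr (- of_real (real n))
      + (\<Sum>k. of_real (binom_coeff (real n) k * r ^ k) * g k)" if r: "0 < r" "r < 1" for r
  proof -
    have s: "(\<lambda>k. of_real (binom_coeff (real n) k) * (of_real r * cis x) ^ k) sums (1 - of_real r * cis x) powr (- of_real (real n))" for x
      using r by (intro binom_coeff_sums) (simp add: norm_mult)
    have sg: "summable (\<lambda>k. of_real (binom_coeff (real n) k * r ^ k) * g k)"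
      using r n B by (intro binom_coeff_bounded_summable) auto
    have "(\<lambda>k. P * (of_real (binom_coeff (real n) k) * (of_real r * cis a) ^ k) + Q * (of_real (binom_coeff (real n) k) * (of_real r * cis b) ^ k)
         + of_real (binom_coeff (real n) k * r ^ k) * g k) sums
       (P * (1 - of_real r * cis a) powr (- of_real (real n)) + Q * (1 - of_real r * cis b) powr (- of_real (real n))
      + (\<Sum>k. of_real (binom_coeff (real n) k * r ^ k) * g k))"
      by (intro sums_add sums_mult s summable_sums sg)
    moreover have "P * (of_real (binom_coeff (real n) k) * (of_real r * cis a) ^ k) + Q * (of_real (binom_coeff (real n) k) * (of_real r * cis b) ^ k)
         + of_real (binom_coeff (real n) k * r ^ k) * g k = of_real (binom_coeff (real n) k * r ^ k) * h k" for k
      unfolding power_mult_distrib Complex.DeMoivre g_def by (simp add: algebra_simps)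
    ultimately show ?thesis by (simp add: sums_iff)
  qed
  let ?w = "\<lambda>r. complex_of_real ((1 - r) powr real n)"
  have n': "real n > 0" using n by simp
  have "((\<lambda>r. P * (?w r * (1 - of_real r * cis a) powr (- of_real (real n))) + Q * (?w r * (1 - of_real r * cis b) powr (- of_real (real n)))
      + ?w r * (\<Sum>k. of_real (binom_coeff (real n) k * r ^ k) * g k)) \<longlongrightarrow>
      P * (if cis a = 1 then 1 else 0) + Q * (if cis b = 1 then 1 else 0) + 0) (at_left 1)"
    by (intro tendsto_add tendsto_mult tendsto_const abel_frequency binom_coeff_abel_null n n' h[folded g_def]) (simp_all add: norm_cis)
  moreover have "eventually (\<lambda>r. P * (?w r * (1 - of_real r * cis a) powr (- of_real (real n))) + Q * (?w r * (1 - of_real r * cis b) powr (- of_real (real n)))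
      + ?w r * (\<Sum>k. of_real (binom_coeff (real n) k * r ^ k) * g k) = ?w r * (\<Sum>k. of_real (binom_coeff (real n) k * r ^ k) * h k)) (at_left 1)"
    using ev
  proof eventually_elim
    case (elim r)
    then show ?case using key[of r] by (simp only: distrib_left mult_ac)
  qed
  ultimately show "((\<lambda>r. ?w r * (\<Sum>k. of_real (binom_coeff (real n) k * r ^ k) * h k)) \<longlongrightarrow>
      (if cis a = 1 then P else 0) + (if cis b = 1 then Q else 0)) (at_left 1)"
    by (rule Lim_transform_eventually[THEN tendsto_eq_rhs]) auto
qed

text \<open>The zonal function as a function of the inner product alone.\<close>

definition zonal_coeff :: "nat \<Rightarrow> nat \<Rightarrow> real \<Rightarrow> real" where
  "zonal_coeff n k t = (real k + (real n - 1) / 2) / ((real n - 1) / 2) * gegenbauer k ((real n - 1) / 2) t"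

text \<open>By \<open>kernel_laplace_integral\<close> this is the Laplace transform in \<open>M\<close> of the Riesz sum.\<close>

definition kernel_laplace :: "nat \<Rightarrow> real \<Rightarrow> complex \<Rightarrow> complex" where
  "kernel_laplace n \<theta> s = (\<Sum>k. of_real (zonal_coeff n k (cos \<theta>)) *
       riesz_laplace ((real n - 1) / 2) s (real k + (real n - 1) / 2))"

text \<open>Up to lower-order terms the \<open>k\<close>-th summand at \<open>s = e + \<i> t\<close> is a constant times a weight
\<open>binom_coeff n k * exp (- e * k)\<close> times \<open>(P * cis (k * \<theta>) + cnj P * cis (- k * \<theta>)) * cis (- k * t)\<close>.
The Abel mean of this detects whether \<open>t\<close> is congruent to \<open>\<theta>\<close> or to \<open>- \<theta>\<close> modulo \<open>2 * pi\<close>.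
The factor \<open>\<theta> powr (- \<lambda> - 1)\<close> in the resonance stems from \<open>powr_laplace \<lambda> (\<i> * \<theta>)\<close>, and the
factor \<open>sin \<theta> powr (- \<lambda>)\<close> from the amplitude \<open>P\<close>.\<close>

lemma kernel_laplace_limit:
  assumes n: "n \<ge> 2" and \<theta>: "0 < \<theta>" "\<theta> < pi"
  shows "\<exists>L. norm L = Gamma (real n) * \<theta> powr (- ((real n + 1) / 2)) * sin \<theta> powr (- ((real n - 1) / 2)) \<and>
    (\<forall>t. t \<noteq> 0 \<longrightarrow> (t = \<theta> \<or> t = - \<theta> \<or> (cis (\<theta> - t) \<noteq> 1 \<and> cis (\<theta> + t) \<noteq> 1)) \<longrightarrow>
      ((\<lambda>e. of_real (e ^ n) * kernel_laplace n \<theta> (Complex e t)) \<longlongrightarrow>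
        (if t = \<theta> then L else if t = - \<theta> then cnj L else 0)) (at_right 0))"
proof -
  define l where "l = (real n - 1) / 2"
  have l: "l \<ge> 1 / 2" "l > 0" using n by (auto simp: l_def)
  have s: "sin \<theta> > 0" using \<theta> by (intro sin_gt_zero)
  let ?b = "binom_coeff (real n)"
  have b: "?b k > 0" for k using n by (intro binom_coeff_pos) auto
  define a where "a = (\<lambda>k. zonal_coeff n k (cos \<theta>))"
  define G where "G = (\<lambda>k. a k * (2 * (real k + l)) powr l / ?b k)"
  obtain P where P: "norm P = Gamma (real n) * sin \<theta> powr (- l) / (l * Gamma l)"
    "(\<lambda>k. of_real (G k) - (P * cis (real k * \<theta>) + cnj P * cis (- (real k * \<theta>)))) \<longlonglongrightarrow> 0"
    using gegenbauer_weighted_asymp[OF n \<theta>] unfolding G_def a_def zonal_coeff_def l_def by blast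
  define L where "L = of_real (Gamma (l + 1)) * (\<i> * of_real \<theta>) powr (of_real (- (l + 1))) * cis (- (l * \<theta>)) * P"
  have normL: "norm L = Gamma (real n) * \<theta> powr (- (l + 1)) * sin \<theta> powr (- l)"
  proof -
    have G: "Gamma l \<noteq> 0" using Gamma_real_pos[OF l(2)] by linarith
    have "norm ((\<i> * of_real \<theta>) powr (of_real (- (l + 1)))) = \<theta> powr (- (l + 1))"
      using \<theta> by (simp add: powr_def norm_mult)
    moreover have "Gamma (l + 1) = l * Gamma l" using l by (intro Gamma_plus1) auto
    ultimately show ?thesis
      using l s G by (simp add: L_def norm_mult P)
  qed
  have lim: "((\<lambda>e. of_real (e ^ n) * kernel_laplace n \<theta> (Complex e t)) \<longlongrightarrow>
        of_real (Gamma (l + 1)) * (\<i> * of_real t) powr (of_real (- (l + 1))) * cis (- (l * t)) *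
        ((if cis (\<theta> - t) = 1 then P else 0) + (if cis (- \<theta> - t) = 1 then cnj P else 0))) (at_right 0)"
    if t: "t \<noteq> 0" for t
  proof -
    obtain C where C: "C \<ge> 0" "\<And>s u. Re s > 0 \<Longrightarrow> \<bar>Im s\<bar> = \<bar>t\<bar> \<Longrightarrow> 2 * u \<ge> 1 \<Longrightarrow>
     norm (riesz_laplace l s u - exp (- (s * of_real u)) * of_real ((2 * u) powr l) * powr_laplace l s)
       \<le> C * (2 * u) powr (l - 1) * exp (- (Re s * u))"
      using riesz_laplace_asymp[OF l(2) t] by blast
    define h where "h = (\<lambda>k. of_real (G k) * cis (- (real k * t)))"
    \<comment> \<open>\<open>h\<close> carries the main term of the \<open>k\<close>-th summand, \<open>g\<close> majorizes its error\<close>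
    define g where "g = (\<lambda>k. complex_of_real (C * \<bar>G k\<bar> / (2 * (real k + l))))"
    have hP: "(\<lambda>k. h k - (P * cis (real k * (\<theta> - t)) + cnj P * cis (real k * (- \<theta> - t)))) \<longlonglongrightarrow> 0"
    proof -
      have "h k - (P * cis (real k * (\<theta> - t)) + cnj P * cis (real k * (- \<theta> - t))) =
        (of_real (G k) - (P * cis (real k * \<theta>) + cnj P * cis (- (real k * \<theta>)))) * cis (- (real k * t))" for k
        unfolding h_def by (simp add: algebra_simps cis_mult)
      then show ?thesis using tendsto_norm_zero[OF P(2)]
        by (subst tendsto_norm_zero_iff[symmetric]) (simp add: norm_mult)
    qed
    have "Bseq (\<lambda>k. of_real (G k) - (P * cis (real k * \<theta>) + cnj P * cis (- (real k * \<theta>))))"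
      using P(2) by (intro convergent_imp_Bseq) (auto simp: convergent_def)
    then obtain B0 where B0: "\<And>k. norm (of_real (G k) - (P * cis (real k * \<theta>) + cnj P * cis (- (real k * \<theta>)))) \<le> B0"
      unfolding Bseq_def by auto
    define B where "B = B0 + 2 * norm P"
    have GB: "\<bar>G k\<bar> \<le> B" for k
    proof -
      have "norm (P * cis (real k * \<theta>) + cnj P * cis (- (real k * \<theta>))) \<le> norm P + norm P"
        by (rule norm_triangle_mono) (simp_all add: norm_mult)
      from norm_triangle_mono[OF B0[of k] this] show ?thesis by (simp add: B_def)
    qed
    have ng: "norm (g k) = C * \<bar>G k\<bar> / (2 * (real k + l))" for k
      unfolding g_def norm_of_real using C(1) l by simp
    have gn: "g k = of_real (norm (g k))" for k
      unfolding ng unfolding g_def ..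
    have g0: "g \<longlonglongrightarrow> 0"
    proof (rule Lim_null_comparison)
      show "(\<lambda>k. C * B / (2 * (real k + l))) \<longlonglongrightarrow> 0" by real_asymp
      show "\<forall>\<^sub>F k in sequentially. norm (g k) \<le> C * B / (2 * (real k + l))"
      proof (intro always_eventually allI)
        fix k
        have "norm (g k) = C * \<bar>G k\<bar> / (2 * (real k + l))" by (rule ng)
        also have "\<dots> \<le> C * B / (2 * (real k + l))"
          using C(1) l GB by (intro divide_right_mono mult_left_mono) auto
        finally show "norm (g k) \<le> C * B / (2 * (real k + l))" .
      qed
    qed
    have hB: "norm (h k) \<le> B" for k using GB[of k] by (simp add: h_def norm_mult)
    have "Bseq g" using g0 by (intro convergent_imp_Bseq) (auto simp: convergent_def)
    then obtain Bg where Bg: "\<And>k. norm (g k) \<le> Bg" unfolding Bseq_def by auto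
    let ?S = "\<lambda>h e. (\<Sum>k. complex_of_real (?b k * exp (- e) ^ k) * h k)"
    have bound: "norm (kernel_laplace n \<theta> (Complex e t) - exp (- (Complex e t * of_real l)) * powr_laplace l (Complex e t) * ?S h e)
          \<le> exp (- (e * l)) * norm (?S g e)" if e: "e > 0" for e
    proof -
      let ?s = "Complex e t"
      let ?\<phi> = "\<lambda>k. riesz_laplace l ?s (real k + l)"
      let ?m = "\<lambda>k. exp (- (?s * of_real l)) * powr_laplace l ?s * (complex_of_real (?b k * exp (- e) ^ k) * h k)"
      have r: "0 \<le> exp (- e)" "exp (- e) < 1" using e by auto
      have n0: "real n > 0" using n by simp
      have mk: "?m k = of_real (a k) * (exp (- (?s * of_real (real k + l))) * of_real ((2 * (real k + l)) powr l) * powr_laplace l ?s)" for k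
      proof -
        have "exp (- (?s * of_real (real k + l))) = exp (- (?s * of_real l)) * exp (- (?s * of_nat k))"
          unfolding exp_add[symmetric] by (rule arg_cong[of _ _ exp]) (simp add: algebra_simps)
        also have "exp (- (?s * of_nat k)) = of_real (exp (- e) ^ k) * cis (- (real k * t))"
        proof -
          have 1: "- (?s * of_nat k) = of_real (real k * (- e)) + \<i> * of_real (- (real k * t))"
            by (simp add: complex_eq_iff)
          have 2: "exp (complex_of_real (real k * (- e))) = of_real (exp (- e) ^ k)"
            unfolding exp_of_nat_mult[symmetric] by (rule exp_of_real)
          show ?thesis unfolding 1 exp_add 2 cis_conv_exp ..
        qed
        finally have "exp (- (?s * of_real (real k + l))) = exp (- (?s * of_real l)) * (of_real (exp (- e) ^ k) * cis (- (real k * t)))" .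
        moreover have "complex_of_real (?b k) * of_real (G k) = of_real (a k * (2 * (real k + l)) powr l)"
          unfolding of_real_mult[symmetric] G_def using b[of k] by (intro arg_cong[of _ _ of_real]) simp
        moreover have "x * p * (bb * r * (g * c)) = aa * (x * (r * c) * w * p)" if "bb * g = aa * w" for x p bb r g c aa w :: complex
        proof -
          have "x * p * (bb * r * (g * c)) = (bb * g) * (x * p * r * c)" by (simp only: mult_ac)
          then show ?thesis unfolding that by (simp only: mult_ac)
        qed
        ultimately show ?thesis
          unfolding h_def of_real_mult by simp
      qed
      have le: "norm (of_real (a k) * ?\<phi> k - ?m k) \<le> exp (- (e * l)) * norm (of_real (?b k * exp (- e) ^ k) * g k)" for k
      proof -
        have u: "2 * (real k + l) \<ge> 1" using l by simp
        have "norm (of_real (a k) * ?\<phi> k - ?m k) = \<bar>a k\<bar> * norm (?\<phi> k - exp (- (?s * of_real (real k + l))) * of_real ((2 * (real k + l)) powr l) * powr_laplace l ?s)"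
          unfolding mk by (simp add: norm_mult flip: right_diff_distrib)
        also have "\<dots> \<le> \<bar>a k\<bar> * (C * (2 * (real k + l)) powr (l - 1) * exp (- (e * (real k + l))))"
          using C(2)[of ?s "real k + l"] e u by (intro mult_left_mono) auto
        also have "(2 * (real k + l)) powr (l - 1) = (2 * (real k + l)) powr l / (2 * (real k + l))"
          using u by (simp add: powr_diff)
        also have "exp (- (e * (real k + l))) = exp (- (e * l)) * exp (- e) ^ k"
          unfolding exp_of_nat_mult[symmetric] exp_add[symmetric] by (rule arg_cong[of _ _ exp]) (simp add: algebra_simps)
        also have "\<bar>a k\<bar> * (C * ((2 * (real k + l)) powr l / (2 * (real k + l))) * (exp (- (e * l)) * exp (- e) ^ k))
           = exp (- (e * l)) * (?b k * exp (- e) ^ k * (C * \<bar>G k\<bar> / (2 * (real k + l))))"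
          unfolding G_def using b[of k] u by (simp add: abs_mult)
        also have "\<dots> = exp (- (e * l)) * norm (of_real (?b k * exp (- e) ^ k) * g k)"
          unfolding norm_mult norm_of_real ng using b[of k] by simp
        finally show ?thesis .
      qed
      have bb: "\<bar>?b k * exp (- e) ^ k\<bar> = ?b k * exp (- e) ^ k" for k
        using b[of k] by simp
      have "summable (\<lambda>k. complex_of_real (?b k * exp (- e) ^ k) * of_real (norm (g k)))"
        using n0 r Bg by (intro binom_coeff_bounded_summable) auto
      then have "summable (\<lambda>k. complex_of_real (?b k * exp (- e) ^ k * norm (g k)))"
        by (simp only: of_real_mult)
      then have sg: "summable (\<lambda>k. norm (of_real (?b k * exp (- e) ^ k) * g k))"
        unfolding norm_mult norm_of_real bb by (simp only: summable_of_real_iff)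
      have sd: "summable (\<lambda>k. of_real (a k) * ?\<phi> k - ?m k)"
        by (rule summable_comparison_test'[OF summable_mult[OF sg, of "exp (- (e * l))"] le])
      have sm: "?m sums (exp (- (?s * of_real l)) * powr_laplace l ?s * ?S h e)"
        by (intro sums_mult summable_sums binom_coeff_bounded_summable[OF n0 r hB])
      have "(\<lambda>k. (of_real (a k) * ?\<phi> k - ?m k) + ?m k) sums ((\<Sum>k. of_real (a k) * ?\<phi> k - ?m k) + exp (- (?s * of_real l)) * powr_laplace l ?s * ?S h e)"
        by (intro sums_add summable_sums sd sm)
      then have "kernel_laplace n \<theta> ?s = (\<Sum>k. of_real (a k) * ?\<phi> k - ?m k) + exp (- (?s * of_real l)) * powr_laplace l ?s * ?S h e"
        unfolding kernel_laplace_def a_def l_def[symmetric] by (simp add: sums_iff)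
      then have "norm (kernel_laplace n \<theta> ?s - exp (- (?s * of_real l)) * powr_laplace l ?s * ?S h e) = norm (\<Sum>k. of_real (a k) * ?\<phi> k - ?m k)"
        by simp
      also have "\<dots> \<le> (\<Sum>k. exp (- (e * l)) * norm (of_real (?b k * exp (- e) ^ k) * g k))"
        by (rule norm_suminf_le[OF le summable_mult[OF sg]])
      also have "\<dots> = exp (- (e * l)) * (\<Sum>k. norm (of_real (?b k * exp (- e) ^ k) * g k))"
        by (rule suminf_mult[OF sg])
      also have "(\<Sum>k. norm (of_real (?b k * exp (- e) ^ k) * g k)) = norm (?S g e)"
      proof -
        have "complex_of_real (?b k * exp (- e) ^ k) * g k = of_real (norm (of_real (?b k * exp (- e) ^ k) * g k))" for k
          unfolding norm_mult norm_of_real using b[of k] by (subst gn) simp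
        then have "?S g e = of_real (\<Sum>k. norm (of_real (?b k * exp (- e) ^ k) * g k))"
          using suminf_of_real[OF sg, where 'a = complex] by simp
        moreover have "0 \<le> (\<Sum>k. norm (of_real (?b k * exp (- e) ^ k) * g k))" by (intro suminf_nonneg sg) simp
        ultimately show ?thesis by simp
      qed
      finally show ?thesis .
    qed
    have lim_s: "((\<lambda>e. Complex e t) \<longlongrightarrow> \<i> * of_real t) (at_right 0)"
    proof -
      have "((\<lambda>e. of_real e + \<i> * of_real t) \<longlongrightarrow> of_real 0 + \<i> * of_real t) (at_right (0::real))"
        by (intro tendsto_intros)
      then show ?thesis by (simp add: Complex_eq)
    qed
    have ev: "eventually (\<lambda>e::real. e > 0) (at_right 0)" by (simp add: eventually_at_right_less)
    have nonpos: "\<i> * of_real t \<notin> \<real>\<^sub>\<le>\<^sub>0" using t by (auto simp: complex_nonpos_Reals_iff)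
    have "((\<lambda>e. of_real (Gamma (l + 1)) * Complex e t powr (of_real (- (l + 1)))) \<longlongrightarrow>
         of_real (Gamma (l + 1)) * (\<i> * of_real t) powr (of_real (- (l + 1)))) (at_right 0)"
      by (intro tendsto_mult tendsto_const tendsto_powr_complex nonpos lim_s)
    moreover have "eventually (\<lambda>e. of_real (Gamma (l + 1)) * Complex e t powr (of_real (- (l + 1))) = powr_laplace l (Complex e t)) (at_right 0)"
      using ev by eventually_elim (use l in \<open>simp add: powr_laplace_eq\<close>)
    ultimately have J: "((\<lambda>e. powr_laplace l (Complex e t)) \<longlongrightarrow> of_real (Gamma (l + 1)) * (\<i> * of_real t) powr (of_real (- (l + 1)))) (at_right 0)"
      by (rule Lim_transform_eventually)
    have E: "((\<lambda>e. exp (- (Complex e t * of_real l))) \<longlongrightarrow> cis (- (l * t))) (at_right 0)"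
    proof -
      have "((\<lambda>e. exp (- (Complex e t * of_real l))) \<longlongrightarrow> exp (- ((\<i> * of_real t) * of_real l))) (at_right 0)"
        by (intro tendsto_intros lim_s)
      then show ?thesis by (simp add: cis_conv_exp mult_ac)
    qed
    define A where "A = (if cis (\<theta> - t) = 1 then P else 0) + (if cis (- \<theta> - t) = 1 then cnj P else 0)"
    have n0: "n > 0" using n by simp
    have Sh: "((\<lambda>e. of_real (e ^ n) * ?S h e) \<longlongrightarrow> A) (at_right 0)"
      unfolding A_def by (rule trig_abel_mean[OF n0 hP])
    have "(\<lambda>k. g k - (0 * cis (real k * 0) + 0 * cis (real k * 0))) \<longlonglongrightarrow> 0" using g0 by simp
    from trig_abel_mean[OF n0 this] have Sg: "((\<lambda>e. of_real (e ^ n) * ?S g e) \<longlongrightarrow> 0) (at_right 0)" by simp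
    have main: "((\<lambda>e. exp (- (Complex e t * of_real l)) * powr_laplace l (Complex e t) * (of_real (e ^ n) * ?S h e)) \<longlongrightarrow>
       cis (- (l * t)) * (of_real (Gamma (l + 1)) * (\<i> * of_real t) powr (of_real (- (l + 1)))) * A) (at_right 0)"
      by (intro tendsto_mult E J Sh)
    have rest: "((\<lambda>e. of_real (e ^ n) * kernel_laplace n \<theta> (Complex e t)
        - exp (- (Complex e t * of_real l)) * powr_laplace l (Complex e t) * (of_real (e ^ n) * ?S h e)) \<longlongrightarrow> 0) (at_right 0)"
    proof (rule Lim_null_comparison)
      show "((\<lambda>e. norm (of_real (e ^ n) * ?S g e)) \<longlongrightarrow> 0) (at_right 0)"
        using tendsto_norm_zero[OF Sg] .
      show "\<forall>\<^sub>F e in at_right 0. norm (of_real (e ^ n) * kernel_laplace n \<theta> (Complex e t)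
        - exp (- (Complex e t * of_real l)) * powr_laplace l (Complex e t) * (of_real (e ^ n) * ?S h e)) \<le> norm (of_real (e ^ n) * ?S g e)"
        using ev
      proof eventually_elim
        case (elim e)
        let ?k = "kernel_laplace n \<theta> (Complex e t)" and ?p = "exp (- (Complex e t * of_real l)) * powr_laplace l (Complex e t)"
        have "of_real (e ^ n) * ?k - ?p * (of_real (e ^ n) * ?S h e) = of_real (e ^ n) * (?k - ?p * ?S h e)"
          by (simp only: right_diff_distrib mult_ac)
        then have "norm (of_real (e ^ n) * ?k - ?p * (of_real (e ^ n) * ?S h e)) = e ^ n * norm (?k - ?p * ?S h e)"
          using elim by (simp only: norm_mult norm_of_real) simp
        also have "\<dots> \<le> e ^ n * norm (?S g e)"
        proof (rule mult_left_mono)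
          have "norm (?k - ?p * ?S h e) \<le> exp (- (e * l)) * norm (?S g e)"
            by (rule bound[OF elim])
          also have "\<dots> \<le> 1 * norm (?S g e)"
            using elim l by (intro mult_right_mono) auto
          finally show "norm (?k - ?p * ?S h e) \<le> norm (?S g e)" by simp
        qed (use elim in simp)
        also have "\<dots> = norm (of_real (e ^ n) * ?S g e)"
          using elim by (simp only: norm_mult norm_of_real) simp
        finally show ?case .
      qed
    qed
    from tendsto_add[OF rest main] show ?thesis
      unfolding A_def[symmetric] by (simp add: mult_ac)
  qed
  have ne1: "cis (2 * \<theta>) \<noteq> 1" "cis (- 2 * \<theta>) \<noteq> 1"
  proof -
    have "Re (cis (2 * \<theta>)) < 1" "Re (cis (- 2 * \<theta>)) < 1"
      using s by (simp_all add: cos_double_sin)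
    then show "cis (2 * \<theta>) \<noteq> 1" "cis (- 2 * \<theta>) \<noteq> 1"
      by (metis less_irrefl one_complex.sel(1))+
  qed
  show ?thesis
  proof (intro exI[of _ L] conjI allI impI)
    have "l + 1 = (real n + 1) / 2" by (simp add: l_def field_simps)
    then show "norm L = Gamma (real n) * \<theta> powr (- ((real n + 1) / 2)) * sin \<theta> powr (- ((real n - 1) / 2))"
      using normL by (simp only: l_def[symmetric])
    fix t assume t: "t \<noteq> 0" and cases: "t = \<theta> \<or> t = - \<theta> \<or> cis (\<theta> - t) \<noteq> 1 \<and> cis (\<theta> + t) \<noteq> 1"
    have conj: "cis (- \<theta> - t) = cnj (cis (\<theta> + t))" by (simp add: cis_cnj)
    have "of_real (Gamma (l + 1)) * (\<i> * of_real t) powr (of_real (- (l + 1))) * cis (- (l * t)) *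
        ((if cis (\<theta> - t) = 1 then P else 0) + (if cis (- \<theta> - t) = 1 then cnj P else 0)) =
       (if t = \<theta> then L else if t = - \<theta> then cnj L else 0)"
    proof -
      consider "t = \<theta>" | "t = - \<theta>" | "t \<noteq> \<theta>" "t \<noteq> - \<theta>" "cis (\<theta> - t) \<noteq> 1" "cis (- \<theta> - t) \<noteq> 1"
        using cases unfolding conj by auto
      then show ?thesis
      proof cases
        case 1
        then have "cis (- \<theta> - t) \<noteq> 1" using ne1 by simp
        then show ?thesis using 1 by (simp add: L_def)
      next
        case 2
        then have "cis (\<theta> - t) \<noteq> 1" using ne1 by simp
        moreover have "cnj ((\<i> * of_real \<theta>) powr (of_real (- (l + 1)))) = (- (\<i> * of_real \<theta>)) powr (of_real (- (l + 1)))"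
        proof -
          show ?thesis using \<theta> by (subst cnj_powr) simp_all
        qed
        ultimately show ?thesis using 2 \<theta> unfolding L_def
          by (simp add: cis_cnj)
      next
        case 3
        then show ?thesis by simp
      qed
    qed
    with lim[OF t] show "((\<lambda>e. of_real (e ^ n) * kernel_laplace n \<theta> (Complex e t)) \<longlongrightarrow>
        (if t = \<theta> then L else if t = - \<theta> then cnj L else 0)) (at_right 0)" by simp
  qed
qed

section \<open>The Riesz product\<close>

text \<open>The numerator of the kernel in terms of \<open>M = sqrt (R\<^sup>2 + \<lambda>\<^sup>2)\<close>.\<close>

definition riesz_sum :: "nat \<Rightarrow> real \<Rightarrow> real \<Rightarrow> real" where
  "riesz_sum n \<theta> M = (\<Sum>k. zonal_coeff n k (cos \<theta>) *
     (indicator {real k + (real n - 1) / 2..} M * (M\<^sup>2 - (real k + (real n - 1) / 2)\<^sup>2) powr ((real n - 1) / 2)))"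

definition bochner_kernel :: "nat \<Rightarrow> real \<Rightarrow> real \<Rightarrow> real" where
  "bochner_kernel n R t = (\<Sum>k | real (k * (k + n - 1)) < R\<^sup>2.
     (1 - real (k * (k + n - 1)) / R\<^sup>2) powr ((real n - 1) / 2) * zonal_coeff n k t)"

lemma zonal_coeff_bound:
  assumes n: "n \<ge> 2" and \<theta>: "0 < \<theta>" "\<theta> < pi"
  shows "\<exists>B. \<forall>k. \<bar>zonal_coeff n k (cos \<theta>)\<bar> \<le> B * binom_coeff (real n) k"
proof -
  define l where "l = (real n - 1) / 2"
  have l: "l \<ge> 1 / 2" using n by (auto simp: l_def)
  let ?b = "binom_coeff (real n)"
  have b: "?b k > 0" for k using n by (intro binom_coeff_pos) auto
  define G where "G = (\<lambda>k. zonal_coeff n k (cos \<theta>) * (2 * (real k + l)) powr l / ?b k)"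
  obtain P where P:
    "(\<lambda>k. of_real (G k) - (P * cis (real k * \<theta>) + cnj P * cis (- (real k * \<theta>)))) \<longlonglongrightarrow> 0"
    using gegenbauer_weighted_asymp[OF n \<theta>] unfolding G_def zonal_coeff_def l_def by blast
  have "Bseq (\<lambda>k. of_real (G k) - (P * cis (real k * \<theta>) + cnj P * cis (- (real k * \<theta>))))"
    using P by (intro convergent_imp_Bseq) (auto simp: convergent_def)
  then obtain B0 where B0: "\<And>k. norm (of_real (G k) - (P * cis (real k * \<theta>) + cnj P * cis (- (real k * \<theta>)))) \<le> B0"
    unfolding Bseq_def by auto
  define B where "B = B0 + 2 * norm P"
  have GB: "\<bar>G k\<bar> \<le> B" for k
  proof -
    have "norm (P * cis (real k * \<theta>) + cnj P * cis (- (real k * \<theta>))) \<le> norm P + norm P"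
      by (rule norm_triangle_mono) (simp_all add: norm_mult)
    from norm_triangle_mono[OF B0[of k] this] show ?thesis by (simp add: B_def)
  qed
  have "\<bar>zonal_coeff n k (cos \<theta>)\<bar> \<le> B * ?b k" for k
  proof -
    have "1 powr l \<le> (2 * (real k + l)) powr l" using l by (intro powr_mono2) auto
    then have 1: "1 \<le> (2 * (real k + l)) powr l" by simp
    have "\<bar>zonal_coeff n k (cos \<theta>)\<bar> * 1 \<le> \<bar>zonal_coeff n k (cos \<theta>)\<bar> * (2 * (real k + l)) powr l"
      using 1 by (intro mult_left_mono) auto
    also have "\<dots> = \<bar>G k\<bar> * ?b k"
      using b[of k] unfolding G_def by (simp add: abs_mult)
    also have "\<dots> \<le> B * ?b k" using b[of k] GB by (intro mult_right_mono) auto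
    finally show ?thesis by simp
  qed
  then show ?thesis by blast
qed

lemma riesz_sum_finite:
  assumes "n \<ge> 2" "M \<le> real N"
  shows "riesz_sum n \<theta> M = (\<Sum>k<N. zonal_coeff n k (cos \<theta>) *
     (indicator {real k + (real n - 1) / 2..} M * (M\<^sup>2 - (real k + (real n - 1) / 2)\<^sup>2) powr ((real n - 1) / 2)))"
  unfolding riesz_sum_def
proof (rule suminf_finite)
  fix k assume "k \<notin> {..<N}"
  then have "real N \<le> real k" by simp
  then have "M < real k + (real n - 1) / 2" using assms by (simp add: field_simps)
  then show "zonal_coeff n k (cos \<theta>) *
     (indicator {real k + (real n - 1) / 2..} M * (M\<^sup>2 - (real k + (real n - 1) / 2)\<^sup>2) powr ((real n - 1) / 2)) = 0"
    by simp
qed simp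

lemma riesz_sum_eq_0:
  assumes "n \<ge> 2" "M \<le> 0" shows "riesz_sum n \<theta> M = 0"
  using riesz_sum_finite[of n M 0 \<theta>] assms by simp

lemma riesz_sum_bound:
  assumes "n \<ge> 2"
  shows "\<exists>B. \<forall>M\<le>M0. \<bar>riesz_sum n \<theta> M\<bar> \<le> B"
proof -
  define N where "N = nat \<lceil>M0\<rceil>"
  have N: "M0 \<le> real N" unfolding N_def by linarith
  have "\<bar>riesz_sum n \<theta> M\<bar> \<le> (\<Sum>k<N. \<bar>zonal_coeff n k (cos \<theta>)\<bar> * (M0\<^sup>2) powr ((real n - 1) / 2))" if M: "M \<le> M0" for M
    unfolding riesz_sum_finite[OF assms order_trans[OF M N]]
  proof (rule order_trans[OF sum_abs sum_mono])
    fix k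
    have "indicator {real k + (real n - 1) / 2..} M * (M\<^sup>2 - (real k + (real n - 1) / 2)\<^sup>2) powr ((real n - 1) / 2)
       \<le> (M0\<^sup>2) powr ((real n - 1) / 2)"
    proof (cases "M \<ge> real k + (real n - 1) / 2")
      case True
      have u: "0 \<le> real k + (real n - 1) / 2" using assms by simp
      have "(real k + (real n - 1) / 2)\<^sup>2 \<le> M\<^sup>2" using True u by (intro power_mono) auto
      moreover have "M\<^sup>2 \<le> M0\<^sup>2" using True u M by (intro power_mono) auto
      moreover have "0 \<le> (real k + (real n - 1) / 2)\<^sup>2" by simp
      ultimately have "0 \<le> M\<^sup>2 - (real k + (real n - 1) / 2)\<^sup>2" "M\<^sup>2 - (real k + (real n - 1) / 2)\<^sup>2 \<le> M0\<^sup>2"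
        by linarith+
      then have "(M\<^sup>2 - (real k + (real n - 1) / 2)\<^sup>2) powr ((real n - 1) / 2) \<le> (M0\<^sup>2) powr ((real n - 1) / 2)"
        using assms by (intro powr_mono2) auto
      then show ?thesis using True by simp
    qed simp
    then show "\<bar>zonal_coeff n k (cos \<theta>) *
     (indicator {real k + (real n - 1) / 2..} M * (M\<^sup>2 - (real k + (real n - 1) / 2)\<^sup>2) powr ((real n - 1) / 2))\<bar>
       \<le> \<bar>zonal_coeff n k (cos \<theta>)\<bar> * (M0\<^sup>2) powr ((real n - 1) / 2)"
      by (simp only: abs_mult) (intro mult_left_mono; simp)
  qed
  then show ?thesis by blast
qed

text \<open>Completing the square in the eigenvalue: \<open>k * (k + n - 1) = (k + \<lambda>)\<^sup>2 - \<lambda>\<^sup>2\<close>.\<close>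

lemma riesz_sum_eq_bochner_kernel:
  assumes n: "n \<ge> 2" and R: "R > 0"
  shows "riesz_sum n \<theta> (sqrt (R\<^sup>2 + ((real n - 1) / 2)\<^sup>2)) = R ^ (n - 1) * bochner_kernel n R (cos \<theta>)"
proof -
  define l where "l = (real n - 1) / 2"
  define M where "M = sqrt (R\<^sup>2 + l\<^sup>2)"
  have l: "l > 0" using n by (simp add: l_def)
  have M2: "M\<^sup>2 = R\<^sup>2 + l\<^sup>2" by (simp add: M_def)
  have M0: "M \<ge> 0" by (simp add: M_def)
  have ku: "real (k * (k + n - 1)) = (real k + l)\<^sup>2 - l\<^sup>2" for k
  proof -
    have "real (k + n - 1) = real k + 2 * l" using n by (simp add: l_def of_nat_diff)
    then show ?thesis by (simp only: of_nat_mult) (simp add: power2_eq_square algebra_simps)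
  qed
  let ?K = "{k. real (k * (k + n - 1)) < R\<^sup>2}"
  have fin: "finite ?K" using n by (intro finite_bochner_riesz_index) simp
  have K: "k \<in> ?K \<longleftrightarrow> real k + l < M" for k
  proof -
    have "k \<in> ?K \<longleftrightarrow> (real k + l)\<^sup>2 < M\<^sup>2" by (simp only: ku M2 mem_Collect_eq) linarith
    also have "\<dots> \<longleftrightarrow> real k + l < M"
      using M0 l by (auto intro: power2_less_imp_less power_strict_mono)
    finally show ?thesis .
  qed
  have "riesz_sum n \<theta> M = (\<Sum>k\<in>?K. zonal_coeff n k (cos \<theta>) * (indicator {real k + l..} M * (M\<^sup>2 - (real k + l)\<^sup>2) powr l))"
    unfolding riesz_sum_def l_def[symmetric]
  proof (rule suminf_finite[OF fin])
    fix k assume "k \<notin> ?K"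
    then have "real k + l \<ge> M" using K by auto
    then show "zonal_coeff n k (cos \<theta>) * (indicator {real k + l..} M * (M\<^sup>2 - (real k + l)\<^sup>2) powr l) = 0"
      by (cases "real k + l = M") auto
  qed
  also have "\<dots> = (\<Sum>k\<in>?K. R ^ (n - 1) * ((1 - real (k * (k + n - 1)) / R\<^sup>2) powr l * zonal_coeff n k (cos \<theta>)))"
  proof (intro sum.cong refl)
    fix k assume k: "k \<in> ?K"
    then have ind: "indicator {real k + l..} M = (1::real)" using K[of k] by simp
    have "(M\<^sup>2 - (real k + l)\<^sup>2) = R\<^sup>2 * (1 - real (k * (k + n - 1)) / R\<^sup>2)"
      using R by (simp only: ku M2) (simp add: field_simps)
    moreover have "0 \<le> 1 - real (k * (k + n - 1)) / R\<^sup>2" using k R by (simp del: of_nat_mult)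
    ultimately have "(M\<^sup>2 - (real k + l)\<^sup>2) powr l = (R\<^sup>2) powr l * (1 - real (k * (k + n - 1)) / R\<^sup>2) powr l"
      by (simp only: powr_mult)
    also have "(R\<^sup>2) powr l = R ^ (n - 1)"
    proof -
      have "(R\<^sup>2) powr l = (R powr 2) powr l" using R by simp
      also have "\<dots> = R powr (2 * l)" by (simp add: powr_powr)
      also have "2 * l = real (n - 1)" using n by (simp add: l_def of_nat_diff)
      finally show ?thesis using R by (simp add: powr_realpow)
    qed
    finally show "zonal_coeff n k (cos \<theta>) * (indicator {real k + l..} M * (M\<^sup>2 - (real k + l)\<^sup>2) powr l)
        = R ^ (n - 1) * ((1 - real (k * (k + n - 1)) / R\<^sup>2) powr l * zonal_coeff n k (cos \<theta>))"
      unfolding ind by simp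
  qed
  also have "\<dots> = R ^ (n - 1) * bochner_kernel n R (cos \<theta>)"
    unfolding bochner_kernel_def l_def[symmetric] by (simp add: sum_distrib_left)
  finally show ?thesis unfolding M_def l_def .
qed

text \<open>Termwise integration; \<open>riesz_laplace_bound\<close> makes the series of the absolute integrals converge
geometrically.\<close>

lemma kernel_laplace_integral:
  assumes n: "n \<ge> 2" and \<theta>: "0 < \<theta>" "\<theta> < pi" and s: "Re s > 0"
  shows "integrable lborel (\<lambda>M. of_real (riesz_sum n \<theta> M) * exp (- (s * of_real M)))"
    and "(LINT M|lborel. of_real (riesz_sum n \<theta> M) * exp (- (s * of_real M))) = kernel_laplace n \<theta> s"
proof -
  define l where "l = (real n - 1) / 2"
  have l: "l \<ge> 1 / 2" "l > 0" "l \<ge> 0" using n by (auto simp: l_def)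
  define a where "a = (\<lambda>k. zonal_coeff n k (cos \<theta>))"
  define \<psi> where "\<psi> = (\<lambda>k M. indicator {real k + l..} M * (M\<^sup>2 - (real k + l)\<^sup>2) powr l)"
  define f where "f = (\<lambda>k M. of_real (a k * \<psi> k M) * exp (- (s * of_real M)))"
  obtain B where B: "\<And>k. \<bar>a k\<bar> \<le> B * binom_coeff (real n) k"
    using zonal_coeff_bound[OF n \<theta>] unfolding a_def by blast
  have \<psi>0: "\<psi> k M \<ge> 0" for k M by (simp add: \<psi>_def)
  have normf: "norm (f k M) = \<bar>a k\<bar> * (\<psi> k M * exp (- (Re s * M)))" for k M
    using \<psi>0[of k M] by (simp add: f_def norm_mult abs_mult)
  have u: "real k + l \<ge> 0" for k using l by simp
  note bnd = riesz_laplace_bound[OF s l(3) u]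
  have int: "integrable lborel (f k)" for k
  proof (rule Bochner_Integration.integrable_bound)
    show "integrable lborel (\<lambda>M. \<bar>a k\<bar> * (\<psi> k M * exp (- (Re s * M))))"
      unfolding \<psi>_def using bnd(1)[of k] by (intro integrable_mult_right)
    show "f k \<in> borel_measurable lborel" unfolding f_def \<psi>_def by measurable
    show "AE M in lborel. norm (f k M) \<le> norm (\<bar>a k\<bar> * (\<psi> k M * exp (- (Re s * M))))"
      unfolding normf by (intro AE_I2) simp
  qed
  have fin: "f k M = 0" if "k \<notin> {..<nat \<lceil>M\<rceil>}" for k M
  proof -
    have "M \<le> real k" using that by simp linarith
    then have "M < real k + l" using l by linarith
    then show ?thesis by (simp add: f_def \<psi>_def)
  qed
  have sumn: "summable (\<lambda>k. norm (f k M))" for M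
    by (rule summable_finite[of "{..<nat \<lceil>M\<rceil>}"]) (use fin in auto)
  have sumi: "summable (\<lambda>k. LINT M|lborel. norm (f k M))"
  proof (rule summable_comparison_test')
    define C where "C = Gamma (2 * l + 1) * (Re s / 2) powr (- (2 * l + 1))"
    have C: "C \<ge> 0" using l by (auto simp: C_def intro!: mult_nonneg_nonneg less_imp_le[OF Gamma_real_pos])
    have r: "0 \<le> exp (- (Re s / 2))" "exp (- (Re s / 2)) < 1" using s by auto
    show "summable (\<lambda>k. B * C * (binom_coeff (real n) k * exp (- (Re s / 2)) ^ k))"
      using binom_coeff_sums_real[OF r, of "real n"] by (intro summable_mult) (simp add: sums_iff)
    fix k :: nat
    have "(LINT M|lborel. norm (f k M)) = \<bar>a k\<bar> * (LINT M|lborel. \<psi> k M * exp (- (Re s * M)))"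
      unfolding normf by simp
    also have "\<dots> \<le> (B * binom_coeff (real n) k) * (C * exp (- (Re s / 2)) ^ k)"
    proof (rule mult_mono)
      have "(LINT M|lborel. \<psi> k M * exp (- (Re s * M))) \<le> C * exp (- (Re s / 2 * (real k + l)))"
        unfolding \<psi>_def C_def by (rule bnd(2))
      also have "\<dots> \<le> C * exp (- (Re s / 2)) ^ k"
        using s l C unfolding exp_of_nat_mult[symmetric] by (intro mult_left_mono) (auto simp: algebra_simps)
      finally show "(LINT M|lborel. \<psi> k M * exp (- (Re s * M))) \<le> C * exp (- (Re s / 2)) ^ k" .
      show "0 \<le> B * binom_coeff (real n) k" using B[of k] by linarith
    qed (use B \<psi>0 in \<open>auto intro!: Bochner_Integration.integral_nonneg\<close>)
    finally show "norm (LINT M|lborel. norm (f k M)) \<le> B * C * (binom_coeff (real n) k * exp (- (Re s / 2)) ^ k)"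
      by (simp add: mult_ac)
  qed
  have eq: "(\<Sum>k. f k M) = of_real (riesz_sum n \<theta> M) * exp (- (s * of_real M))" for M
  proof -
    have sm: "summable (\<lambda>k. a k * \<psi> k M)"
    proof (rule summable_finite[of "{..<nat \<lceil>M\<rceil>}"])
      fix k assume "k \<notin> {..<nat \<lceil>M\<rceil>}"
      then have "M \<le> real k" by simp linarith
      then show "a k * \<psi> k M = 0" using l by (simp add: \<psi>_def)
    qed simp
    have "(\<Sum>k. f k M) = (\<Sum>k. of_real (a k * \<psi> k M)) * exp (- (s * of_real M))"
      unfolding f_def by (rule suminf_mult2[symmetric]) (use sm in \<open>simp only: summable_of_real_iff\<close>)
    also have "(\<Sum>k. complex_of_real (a k * \<psi> k M)) = of_real (\<Sum>k. a k * \<psi> k M)"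
      by (rule suminf_of_real[OF sm, symmetric])
    also have "(\<Sum>k. a k * \<psi> k M) = riesz_sum n \<theta> M"
      unfolding riesz_sum_def a_def \<psi>_def l_def ..
    finally show ?thesis .
  qed
  show "integrable lborel (\<lambda>M. of_real (riesz_sum n \<theta> M) * exp (- (s * of_real M)))"
    using integrable_suminf[OF int _ sumi] sumn unfolding eq by simp
  have "(LINT M|lborel. of_real (riesz_sum n \<theta> M) * exp (- (s * of_real M))) = (\<Sum>k. LINT M|lborel. f k M)"
    using integral_suminf[OF int _ sumi] sumn unfolding eq by simp
  also have "\<dots> = kernel_laplace n \<theta> s"
    unfolding kernel_laplace_def f_def \<psi>_def riesz_laplace_def l_def[symmetric] a_def of_real_mult[of "zonal_coeff _ _ _"] mult.assoc by simp
  finally show "(LINT M|lborel. of_real (riesz_sum n \<theta> M) * exp (- (s * of_real M))) = kernel_laplace n \<theta> s" .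
qed


text \<open>The exponent at \<open>i\<close> records which of the three terms of \<open>1 + z / 2 + cnj z / 2\<close> is taken from the
\<open>i\<close>-th factor.\<close>

lemma riesz_product_expand:
  fixes \<theta> :: "'i \<Rightarrow> real" and w :: "'i \<Rightarrow> complex"
  assumes "finite I"
  defines "c \<equiv> \<lambda>\<sigma>. \<Prod>i\<in>I. (if \<sigma> i = 0 then 1 else if \<sigma> i = 1 then w i / 2 else cnj (w i) / 2)"
  shows "complex_of_real (\<Prod>i\<in>I. 1 + Re (w i * cis (- (\<theta> i * M)))) =
    (\<Sum>\<sigma>\<in>I \<rightarrow>\<^sub>E {-1, 0, 1::int}. c \<sigma> * cis (- ((\<Sum>i\<in>I. real_of_int (\<sigma> i) * \<theta> i) * M)))"
proof -
  define d where "d = (\<lambda>i (k::int). (if k = 0 then 1 else if k = 1 then w i / 2 else cnj (w i) / 2) * cis (- (real_of_int k * \<theta> i * M)))"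
  have "complex_of_real (1 + Re (w i * cis (- (\<theta> i * M)))) = (\<Sum>k\<in>{-1, 0, 1}. d i k)" for i
  proof -
    have "of_real (Re (w i * cis (- (\<theta> i * M)))) = (w i * cis (- (\<theta> i * M)) + cnj (w i * cis (- (\<theta> i * M)))) / 2"
      by (simp only: complex_add_cnj) simp
    then show ?thesis by (simp add: d_def cis_cnj add_divide_distrib)
  qed
  then have "complex_of_real (\<Prod>i\<in>I. 1 + Re (w i * cis (- (\<theta> i * M)))) = (\<Prod>i\<in>I. \<Sum>k\<in>{-1, 0, 1}. d i k)"
    by simp
  also have "\<dots> = (\<Sum>\<sigma>\<in>I \<rightarrow>\<^sub>E {-1, 0, 1}. \<Prod>i\<in>I. d i (\<sigma> i))"
    by (rule prod_sum_PiE) (use assms in auto)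
  also have "\<dots> = (\<Sum>\<sigma>\<in>I \<rightarrow>\<^sub>E {-1, 0, 1::int}. c \<sigma> * cis (- ((\<Sum>i\<in>I. real_of_int (\<sigma> i) * \<theta> i) * M)))"
  proof (intro sum.cong refl)
    fix \<sigma> :: "'i \<Rightarrow> int"
    have "(\<Prod>i\<in>I. cis (- (real_of_int (\<sigma> i) * \<theta> i * M))) = cis (- ((\<Sum>i\<in>I. real_of_int (\<sigma> i) * \<theta> i) * M))"
      using assms(1) by (induction I rule: finite_induct) (simp_all add: cis_mult algebra_simps)
    then show "(\<Prod>i\<in>I. d i (\<sigma> i)) = c \<sigma> * cis (- ((\<Sum>i\<in>I. real_of_int (\<sigma> i) * \<theta> i) * M))"
      by (simp add: d_def c_def prod.distrib)
  qed
  finally show ?thesis .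
qed

lemma powr_laplace_mean_resonant:
  assumes "n \<ge> 2"
  shows "((\<lambda>e. of_real (e ^ n) * powr_laplace (real n - 1) (of_real e)) \<longlongrightarrow> of_real (Gamma (real n))) (at_right 0)"
proof (rule Lim_transform_eventually[OF tendsto_const])
  have "eventually (\<lambda>e::real. e > 0) (at_right 0)" by (simp add: eventually_at_right_less)
  then show "\<forall>\<^sub>F e in at_right 0. complex_of_real (Gamma (real n)) = of_real (e ^ n) * powr_laplace (real n - 1) (of_real e)"
  proof eventually_elim
    case (elim e)
    have "powr_laplace (real n - 1) (of_real e) = of_real (Gamma (real n) * e powr (- real n))"
      using powr_laplace_of_real[OF elim, of "real n - 1"] assms by simp
    also have "e powr (- real n) = inverse (e ^ n)"
      using elim by (simp add: powr_minus powr_realpow)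
    finally show ?case using elim by simp
  qed
qed

lemma powr_laplace_mean_nonresonant:
  assumes "n > 0" "b \<ge> 0" "t \<noteq> 0"
  shows "((\<lambda>e. of_real (e ^ n) * powr_laplace b (Complex e t)) \<longlongrightarrow> 0) (at_right 0)"
proof (rule Lim_null_comparison)
  define C where "C = Gamma (b + 1) * \<bar>t\<bar> powr (- (b + 1))"
  have "((\<lambda>e. e ^ n * C) \<longlongrightarrow> 0 ^ n * C) (at_right 0)" by (intro tendsto_intros)
  then show "((\<lambda>e. e ^ n * C) \<longlongrightarrow> 0) (at_right 0)" using assms(1) by (simp add: zero_power)
  have "eventually (\<lambda>e::real. e > 0) (at_right 0)" by (simp add: eventually_at_right_less)
  then show "\<forall>\<^sub>F e in at_right 0. norm (of_real (e ^ n) * powr_laplace b (Complex e t)) \<le> e ^ n * C"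
  proof eventually_elim
    case (elim e)
    have "norm (powr_laplace b (Complex e t)) \<le> C"
      using norm_powr_laplace_le[of "Complex e t" b] elim assms by (simp add: C_def)
    then show ?case using elim by (simp add: norm_mult norm_power mult_left_mono)
  qed
qed

lemma powr_laplace_mean_lower_order:
  assumes "n \<ge> 2"
  shows "((\<lambda>e. of_real (e ^ n) * powr_laplace 0 (of_real e)) \<longlongrightarrow> 0) (at_right 0)"
proof (rule Lim_transform_eventually)
  have "((\<lambda>e. complex_of_real (e ^ (n - 1))) \<longlongrightarrow> of_real (0 ^ (n - 1))) (at_right 0)"
    by (intro tendsto_intros)
  then show "((\<lambda>e. complex_of_real (e ^ (n - 1))) \<longlongrightarrow> 0) (at_right 0)" using assms by (simp add: zero_power)
  have "eventually (\<lambda>e::real. e > 0) (at_right 0)" by (simp add: eventually_at_right_less)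
  then show "\<forall>\<^sub>F e in at_right 0. complex_of_real (e ^ (n - 1)) = of_real (e ^ n) * powr_laplace 0 (of_real e)"
  proof eventually_elim
    case (elim e)
    have "powr_laplace 0 (of_real e) = of_real (inverse e)"
      using powr_laplace_of_real[OF elim, of 0] elim by (simp add: powr_minus)
    moreover have "e ^ n = e * e ^ (n - 1)" using assms by (cases n) auto
    ultimately show ?case using elim by simp
  qed
qed

text \<open>Let \<open>p\<close> be the Riesz product with phases opposite to those of the resonances \<open>L i\<close>. The mean of the
combination of kernels against \<open>p - 1\<close> is computed in two ways. By resonance it equals the sum of the
\<open>w i * norm (L i)\<close>: independence of the angles guarantees that no frequency of \<open>p - 1\<close> other than the
\<open>\<plusminus> \<theta> i\<close> meets a frequency of a kernel. On the other hand, as \<open>\<bar>p - 1\<bar> \<le> p + 1\<close> has mean at most \<open>2\<close>,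
it is at most twice the bound \<open>A\<close>. Subtracting \<open>1\<close> from \<open>p\<close> avoids the frequency \<open>0\<close>, where
\<open>kernel_laplace_limit\<close> says nothing. Only coefficients up to \<open>2\<close> occur in the independence hypothesis because
frequencies of \<open>p\<close>, whose coefficients are at most \<open>1\<close>, are compared with each other.\<close>

lemma riesz_product_lower_bound:
  fixes \<theta> :: "'i \<Rightarrow> real" and w :: "'i \<Rightarrow> real"
  assumes n: "n \<ge> 2" and I: "finite I"
    and w: "\<And>i. i \<in> I \<Longrightarrow> w i \<ge> 0"
    and \<theta>: "\<And>i. i \<in> I \<Longrightarrow> 0 < \<theta> i \<and> \<theta> i < pi"
    and indep: "\<And>(\<sigma>::'i \<Rightarrow> int) m::int. (\<Sum>i\<in>I. real_of_int (\<sigma> i) * \<theta> i) = 2 * pi * real_of_int m \<Longrightarrow>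
       (\<forall>i\<in>I. \<sigma> i \<in> {-2..2}) \<Longrightarrow> (\<forall>i\<in>I. \<sigma> i = 0)"
    and bound: "\<And>R. R \<ge> R0 \<Longrightarrow> \<bar>\<Sum>i\<in>I. w i * bochner_kernel n R (cos (\<theta> i))\<bar> \<le> A"
  shows "(\<Sum>i\<in>I. w i * (\<theta> i powr (- ((real n + 1) / 2)) * sin (\<theta> i) powr (- ((real n - 1) / 2)))) \<le> 2 * A"
proof -
  define D where "D = (\<lambda>M. \<Sum>i\<in>I. w i * riesz_sum n (\<theta> i) M)"
  have A: "A \<ge> 0" using bound[of R0] abs_ge_zero order_trans by blast
  \<comment> \<open>The hypothesis controls only \<open>R \<ge> R0\<close>. For smaller \<open>R\<close> the sums are bounded, and a constant
      is of lower order in the mean.\<close>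
  have Dbound: "\<exists>B\<ge>0. \<forall>M. \<bar>D M\<bar> \<le> indicator {0..} M * (A * M powr (real n - 1) + B * M powr 0)"
  proof -
    define R1 where "R1 = max R0 1"
    define M0 where "M0 = sqrt (R1\<^sup>2 + ((real n - 1) / 2)\<^sup>2)"
    have "\<forall>i. \<exists>B. \<forall>M\<le>M0. \<bar>riesz_sum n (\<theta> i) M\<bar> \<le> B" using riesz_sum_bound[OF n] by blast
    then obtain Bi where Bi: "\<And>i M. M \<le> M0 \<Longrightarrow> \<bar>riesz_sum n (\<theta> i) M\<bar> \<le> Bi i" by metis
    define B where "B = (\<Sum>i\<in>I. w i * \<bar>Bi i\<bar>)"
    have B: "B \<ge> 0" unfolding B_def using w by (intro sum_nonneg) auto
    have "\<bar>D M\<bar> \<le> indicator {0..} M * (A * M powr (real n - 1) + B * M powr 0)" for M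
    proof -
      consider "M \<le> 0" | "M > 0" "M \<le> M0" | "M > 0" "M \<ge> M0" by linarith
      then show ?thesis
      proof cases
        case 1
        then have "D M = 0" unfolding D_def using riesz_sum_eq_0[OF n] by simp
        moreover have "0 \<le> indicator {0..} M * (A * M powr (real n - 1) + B * M powr 0)"
          using A B by (intro mult_nonneg_nonneg add_nonneg_nonneg) auto
        ultimately show ?thesis by simp
      next
        case 2
        have "\<bar>D M\<bar> \<le> B"
          unfolding D_def B_def
        proof (rule order_trans[OF sum_abs sum_mono])
          fix i assume "i \<in> I"
          then show "\<bar>w i * riesz_sum n (\<theta> i) M\<bar> \<le> w i * \<bar>Bi i\<bar>"
            using w[of i] Bi[OF 2(2), of i] by (simp add: abs_mult mult_left_mono)
        qed
        moreover have "0 \<le> A * M powr (real n - 1)" using A by simp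
        ultimately show ?thesis using 2 by simp
      next
        case 3
        define R where "R = sqrt (M\<^sup>2 - ((real n - 1) / 2)\<^sup>2)"
        have "R1\<^sup>2 + ((real n - 1) / 2)\<^sup>2 = M0\<^sup>2" unfolding M0_def by simp
        also have "\<dots> \<le> M\<^sup>2" using 3 by (intro power_mono) (auto simp: M0_def)
        finally have le: "R1\<^sup>2 \<le> M\<^sup>2 - ((real n - 1) / 2)\<^sup>2" by simp
        then have "R1 \<le> R" unfolding R_def by (intro real_le_rsqrt)
        then have R: "R > 0" "R \<ge> R0" by (auto simp: R1_def)
        have R2: "R\<^sup>2 = M\<^sup>2 - ((real n - 1) / 2)\<^sup>2"
          unfolding R_def using le order_trans[OF zero_le_power2 le] by simp
        then have M: "M = sqrt (R\<^sup>2 + ((real n - 1) / 2)\<^sup>2)" using 3 by simp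
        have "D M = R ^ (n - 1) * (\<Sum>i\<in>I. w i * bochner_kernel n R (cos (\<theta> i)))"
          unfolding D_def by (subst M) (simp only: riesz_sum_eq_bochner_kernel[OF n R(1)] sum_distrib_left mult_ac)
        then have "\<bar>D M\<bar> = R ^ (n - 1) * \<bar>\<Sum>i\<in>I. w i * bochner_kernel n R (cos (\<theta> i))\<bar>"
          using R by (simp add: abs_mult)
        also have "\<dots> \<le> M ^ (n - 1) * A"
        proof (intro mult_mono bound R power_mono)
          have "R\<^sup>2 \<le> M\<^sup>2" using R2 by simp
          then show "R \<le> M" using 3 by (auto intro: power2_le_imp_le[of R M])
        qed (use 3 R in auto)
        also have "M ^ (n - 1) = M powr (real n - 1)"
          using 3 n by (simp add: of_nat_diff flip: powr_realpow)
        finally show ?thesis using 3 B by (simp add: mult.commute)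
      qed
    qed
    with B show ?thesis by blast
  qed
  then obtain B where B: "B \<ge> 0" "\<And>M. \<bar>D M\<bar> \<le> indicator {0..} M * (A * M powr (real n - 1) + B * M powr 0)" by blast
  have "\<forall>i\<in>I. \<exists>L. norm L = Gamma (real n) * \<theta> i powr (- ((real n + 1) / 2)) * sin (\<theta> i) powr (- ((real n - 1) / 2)) \<and>
    (\<forall>t. t \<noteq> 0 \<longrightarrow> (t = \<theta> i \<or> t = - \<theta> i \<or> (cis (\<theta> i - t) \<noteq> 1 \<and> cis (\<theta> i + t) \<noteq> 1)) \<longrightarrow>
      ((\<lambda>e. of_real (e ^ n) * kernel_laplace n (\<theta> i) (Complex e t)) \<longlongrightarrow>
        (if t = \<theta> i then L else if t = - \<theta> i then cnj L else 0)) (at_right 0))"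
    using kernel_laplace_limit[OF n] \<theta> by blast
  from bchoice[OF this] obtain L where
    normL: "\<And>i. i \<in> I \<Longrightarrow> norm (L i) = Gamma (real n) * \<theta> i powr (- ((real n + 1) / 2)) * sin (\<theta> i) powr (- ((real n - 1) / 2))"
    and limL: "\<And>i t. i \<in> I \<Longrightarrow> t \<noteq> 0 \<Longrightarrow> (t = \<theta> i \<or> t = - \<theta> i \<or> (cis (\<theta> i - t) \<noteq> 1 \<and> cis (\<theta> i + t) \<noteq> 1)) \<Longrightarrow>
      ((\<lambda>e. of_real (e ^ n) * kernel_laplace n (\<theta> i) (Complex e t)) \<longlongrightarrow>
        (if t = \<theta> i then L i else if t = - \<theta> i then cnj (L i) else 0)) (at_right 0)"
    by blast
  have G: "Gamma (real n) > 0" using n by (intro Gamma_real_pos) auto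
  have L0: "L i \<noteq> 0" if "i \<in> I" for i
  proof -
    have "sin (\<theta> i) > 0" using \<theta>[OF that] by (intro sin_gt_zero) auto
    then have "norm (L i) > 0" unfolding normL[OF that] using G \<theta>[OF that] by (intro mult_pos_pos) auto
    then show ?thesis by auto
  qed
  \<comment> \<open>unimodular factors that turn every resonance into its absolute value\<close>
  define v where "v = (\<lambda>i. cnj (L i) / of_real (norm (L i)))"
  have v1: "norm (v i) = 1" if "i \<in> I" for i using L0[OF that] by (simp add: v_def norm_divide)
  have vL: "Re (v i * L i) = norm (L i)" if "i \<in> I" for i
  proof -
    have "cnj (L i) * L i = of_real ((norm (L i))\<^sup>2)" by (metis complex_norm_square mult.commute)
    then have "v i * L i = of_real (norm (L i))"
      using L0[OF that] by (simp add: v_def power2_eq_square)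
    then show ?thesis by simp
  qed
  define S where "S = (I \<rightarrow>\<^sub>E {-1, 0, 1::int})"
  define c where "c = (\<lambda>\<sigma>. \<Prod>i\<in>I. (if \<sigma> i = (0::int) then 1 else if \<sigma> i = 1 then v i / 2 else cnj (v i) / 2))"
  define \<tau> where "\<tau> = (\<lambda>\<sigma>. \<Sum>i\<in>I. real_of_int (\<sigma> i) * \<theta> i)"
  define p where "p = (\<lambda>M. \<Prod>i\<in>I. 1 + Re (v i * cis (- (\<theta> i * M))))"
  \<comment> \<open>\<open>z0\<close> is the index of the constant term of the product, \<open>S'\<close> collects all the others\<close>
  define z0 where "z0 = (\<lambda>i\<in>I. 0::int)"
  have finS: "finite S" unfolding S_def using I by (intro finite_PiE) auto
  have z0S: "z0 \<in> S" by (auto simp: S_def z0_def)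
  have cz0: "c z0 = 1" "\<tau> z0 = 0" by (auto simp: c_def \<tau>_def z0_def)
  define S' where "S' = S - {z0}"
  have finS': "finite S'" using finS by (simp add: S'_def)
  have p_exp: "complex_of_real (p M) = 1 + (\<Sum>\<sigma>\<in>S'. c \<sigma> * cis (- (\<tau> \<sigma> * M)))" for M
  proof -
    have "complex_of_real (p M) = (\<Sum>\<sigma>\<in>S. c \<sigma> * cis (- (\<tau> \<sigma> * M)))"
      unfolding p_def S_def c_def \<tau>_def by (rule riesz_product_expand[OF I])
    also have "\<dots> = c z0 * cis (- (\<tau> z0 * M)) + (\<Sum>\<sigma>\<in>S'. c \<sigma> * cis (- (\<tau> \<sigma> * M)))"
      unfolding S'_def by (rule sum.remove[OF finS z0S])
    finally show ?thesis by (simp add: cz0)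
  qed
  have p0: "p M \<ge> 0" for M
    unfolding p_def
  proof (rule prod_nonneg)
    fix i assume i: "i \<in> I"
    have "\<bar>Re (v i * cis (- (\<theta> i * M)))\<bar> \<le> norm (v i * cis (- (\<theta> i * M)))" by (rule abs_Re_le_cmod)
    then show "0 \<le> 1 + Re (v i * cis (- (\<theta> i * M)))" using v1[OF i] by (simp add: norm_mult abs_le_iff)
  qed
  have \<tau>_indep: "\<sigma> = \<sigma>'" if "\<sigma> \<in> S" "\<sigma>' \<in> S" "\<tau> \<sigma> - \<tau> \<sigma>' = 2 * pi * real_of_int m" for \<sigma> \<sigma>' m
  proof -
    have "(\<Sum>i\<in>I. real_of_int (\<sigma> i - \<sigma>' i) * \<theta> i) = 2 * pi * real_of_int m"
      using that(3) by (simp add: \<tau>_def left_diff_distrib sum_subtractf)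
    moreover have "\<forall>i\<in>I. \<sigma> i - \<sigma>' i \<in> {-2..2}"
    proof
      fix i assume "i \<in> I"
      then have "\<sigma> i \<in> {-1, 0, 1}" "\<sigma>' i \<in> {-1, 0, 1}" using that unfolding S_def by (meson PiE_mem)+
      then show "\<sigma> i - \<sigma>' i \<in> {-2..2}" by auto
    qed
    ultimately have "\<forall>i\<in>I. \<sigma> i = \<sigma>' i" using indep[of "\<lambda>i. \<sigma> i - \<sigma>' i" m] by auto
    then show ?thesis using that(1,2) unfolding S_def by (intro PiE_ext) auto
  qed
  have \<tau>0: "\<tau> \<sigma> \<noteq> 0" if "\<sigma> \<in> S'" for \<sigma>
    using \<tau>_indep[of \<sigma> z0 0] that z0S cz0 by (auto simp: S'_def)
  \<comment> \<open>the indices of the two terms with frequencies \<open>\<theta> j\<close> and \<open>- \<theta> j\<close>\<close>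
  define ep em where "ep = (\<lambda>j. \<lambda>i\<in>I. if i = j then 1 else 0::int)" and "em = (\<lambda>j. \<lambda>i\<in>I. if i = j then -1 else 0::int)"
  have eS: "ep j \<in> S" "em j \<in> S" for j by (auto simp: S_def ep_def em_def)
  have e\<tau>: "\<tau> (ep j) = \<theta> j" "\<tau> (em j) = - \<theta> j" if "j \<in> I" for j
  proof -
    have "\<tau> (ep j) = (\<Sum>i\<in>I. if i = j then \<theta> i else 0)" unfolding \<tau>_def ep_def by (intro sum.cong) auto
    then show "\<tau> (ep j) = \<theta> j" using that I by simp
    have "\<tau> (em j) = (\<Sum>i\<in>I. if i = j then - \<theta> i else 0)" unfolding \<tau>_def em_def by (intro sum.cong) auto
    then show "\<tau> (em j) = - \<theta> j" using that I by simp
  qed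
  have ec: "c (ep j) = v j / 2" "c (em j) = cnj (v j) / 2" if "j \<in> I" for j
  proof -
    have "c (ep j) = (\<Prod>i\<in>I. if i = j then v i / 2 else 1)" unfolding c_def ep_def by (intro prod.cong) auto
    then show "c (ep j) = v j / 2" using that I by simp
    have "c (em j) = (\<Prod>i\<in>I. if i = j then cnj (v i) / 2 else 1)" unfolding c_def em_def by (intro prod.cong) auto
    then show "c (em j) = cnj (v j) / 2" using that I by simp
  qed
  have eS': "ep j \<in> S'" "em j \<in> S'" "ep j \<noteq> em j" if "j \<in> I" for j
    using e\<tau>[OF that] \<theta>[OF that] cz0 eS[of j] by (auto simp: S'_def)
  have cis1: "\<exists>m::int. x = 2 * pi * real_of_int m" if "cis x = 1" for x
  proof -
    have "cos x = 1" using that by (metis cis.sel(1) one_complex.sel(1))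
    then show ?thesis using cos_one_2pi_int[of x] by (auto simp: mult_ac)
  qed
  have lim: "((\<lambda>e. of_real (e ^ n) * kernel_laplace n (\<theta> i) (Complex e (\<tau> \<sigma>))) \<longlongrightarrow>
        (if \<sigma> = ep i then L i else if \<sigma> = em i then cnj (L i) else 0)) (at_right 0)"
    if i: "i \<in> I" and \<sigma>: "\<sigma> \<in> S'" for i \<sigma>
  proof -
    have \<sigma>S: "\<sigma> \<in> S" using \<sigma> by (simp add: S'_def)
    have 1: "\<sigma> = ep i" if c1: "cis (\<theta> i - \<tau> \<sigma>) = 1"
    proof -
      obtain m :: int where "\<theta> i - \<tau> \<sigma> = 2 * pi * real_of_int m" using cis1[OF c1] by blast
      then show ?thesis using \<tau>_indep[OF eS(1) \<sigma>S, of i m] e\<tau>[OF i] by simp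
    qed
    have 2: "\<sigma> = em i" if c1: "cis (\<theta> i + \<tau> \<sigma>) = 1"
    proof -
      obtain m :: int where "\<theta> i + \<tau> \<sigma> = 2 * pi * real_of_int m" using cis1[OF c1] by blast
      then show ?thesis using \<tau>_indep[OF \<sigma>S eS(2), of i m] e\<tau>[OF i] by simp
    qed
    have 3: "\<tau> \<sigma> = \<theta> i \<longleftrightarrow> \<sigma> = ep i" using 1 e\<tau>[OF i] by auto
    have 4: "\<tau> \<sigma> = - \<theta> i \<longleftrightarrow> \<sigma> = em i" using 2 e\<tau>[OF i] by auto
    show ?thesis
      using limL[OF i \<tau>0[OF \<sigma>]] 1 2 unfolding 3 4 by blast
  qed
  define Z where "Z = (\<lambda>e. \<Sum>\<sigma>\<in>S'. c \<sigma> * (\<Sum>i\<in>I. of_real (w i) * kernel_laplace n (\<theta> i) (Complex e (\<tau> \<sigma>))))"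
  have limZ: "((\<lambda>e. of_real (e ^ n) * Z e) \<longlongrightarrow> of_real (\<Sum>i\<in>I. w i * norm (L i))) (at_right 0)"
  proof -
    have "((\<lambda>e. \<Sum>\<sigma>\<in>S'. c \<sigma> * (\<Sum>i\<in>I. of_real (w i) * (of_real (e ^ n) * kernel_laplace n (\<theta> i) (Complex e (\<tau> \<sigma>))))) \<longlongrightarrow>
       (\<Sum>\<sigma>\<in>S'. c \<sigma> * (\<Sum>i\<in>I. of_real (w i) * (if \<sigma> = ep i then L i else if \<sigma> = em i then cnj (L i) else 0)))) (at_right 0)"
      by (intro tendsto_sum tendsto_mult tendsto_const lim)
    moreover have "(\<Sum>\<sigma>\<in>S'. c \<sigma> * (\<Sum>i\<in>I. of_real (w i) * (of_real (e ^ n) * kernel_laplace n (\<theta> i) (Complex e (\<tau> \<sigma>))))) = of_real (e ^ n) * Z e" for e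
      unfolding Z_def by (simp add: sum_distrib_left mult_ac)
    moreover have "(\<Sum>\<sigma>\<in>S'. c \<sigma> * (\<Sum>i\<in>I. of_real (w i) * (if \<sigma> = ep i then L i else if \<sigma> = em i then cnj (L i) else 0)))
       = of_real (\<Sum>i\<in>I. w i * norm (L i))"
    proof -
      have "(\<Sum>\<sigma>\<in>S'. c \<sigma> * (\<Sum>i\<in>I. of_real (w i) * (if \<sigma> = ep i then L i else if \<sigma> = em i then cnj (L i) else 0)))
        = (\<Sum>i\<in>I. \<Sum>\<sigma>\<in>S'. c \<sigma> * (of_real (w i) * (if \<sigma> = ep i then L i else if \<sigma> = em i then cnj (L i) else 0)))"
        unfolding sum_distrib_left by (rule sum.swap)
      also have "\<dots> = (\<Sum>i\<in>I. of_real (w i * norm (L i)))"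
      proof (intro sum.cong refl)
        fix i assume i: "i \<in> I"
        have "(\<Sum>\<sigma>\<in>S'. c \<sigma> * (of_real (w i) * (if \<sigma> = ep i then L i else if \<sigma> = em i then cnj (L i) else 0)))
          = (\<Sum>\<sigma>\<in>S'. (if \<sigma> = ep i then c \<sigma> * (of_real (w i) * L i) else 0) + (if \<sigma> = em i then c \<sigma> * (of_real (w i) * cnj (L i)) else 0))"
          using eS'(3)[OF i] by (intro sum.cong) auto
        also have "\<dots> = c (ep i) * (of_real (w i) * L i) + c (em i) * (of_real (w i) * cnj (L i))"
          using finS' eS'(1,2)[OF i] by (simp add: sum.distrib)
        also have "\<dots> = of_real (w i) * ((v i * L i + cnj (v i * L i)) / 2)"
          unfolding ec[OF i] by (simp add: algebra_simps add_divide_distrib)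
        also have "\<dots> = of_real (w i * norm (L i))"
          unfolding complex_add_cnj vL[OF i, symmetric] by simp
        finally show "(\<Sum>\<sigma>\<in>S'. c \<sigma> * (of_real (w i) * (if \<sigma> = ep i then L i else if \<sigma> = em i then cnj (L i) else 0))) = of_real (w i * norm (L i))" .
      qed
      finally show ?thesis by simp
    qed
    ultimately show ?thesis by simp
  qed
  \<comment> \<open>the weighted integral of the majorant: \<open>p + 1\<close> is \<open>2\<close> plus the nonconstant terms\<close>
  define Y where "Y = (\<lambda>e. of_real A * (2 * powr_laplace (real n - 1) (of_real e) + (\<Sum>\<sigma>\<in>S'. c \<sigma> * powr_laplace (real n - 1) (Complex e (\<tau> \<sigma>))))
       + of_real B * (2 * powr_laplace 0 (of_real e) + (\<Sum>\<sigma>\<in>S'. c \<sigma> * powr_laplace 0 (Complex e (\<tau> \<sigma>)))))"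
  have limY: "((\<lambda>e. of_real (e ^ n) * Y e) \<longlongrightarrow> of_real (2 * A * Gamma (real n))) (at_right 0)"
  proof -
    let ?E = "\<lambda>e. complex_of_real (e ^ n)"
    have "((\<lambda>e. of_real A * (2 * (?E e * powr_laplace (real n - 1) (of_real e)) + (\<Sum>\<sigma>\<in>S'. c \<sigma> * (?E e * powr_laplace (real n - 1) (Complex e (\<tau> \<sigma>)))))
       + of_real B * (2 * (?E e * powr_laplace 0 (of_real e)) + (\<Sum>\<sigma>\<in>S'. c \<sigma> * (?E e * powr_laplace 0 (Complex e (\<tau> \<sigma>)))))) \<longlongrightarrow>
       of_real A * (2 * of_real (Gamma (real n)) + (\<Sum>\<sigma>\<in>S'. c \<sigma> * 0)) + of_real B * (2 * 0 + (\<Sum>\<sigma>\<in>S'. c \<sigma> * 0))) (at_right 0)"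
      using n by (intro tendsto_add tendsto_mult tendsto_const tendsto_sum powr_laplace_mean_resonant powr_laplace_mean_nonresonant
           powr_laplace_mean_lower_order \<tau>0) auto
    moreover have "of_real A * (2 * (?E e * powr_laplace (real n - 1) (of_real e)) + (\<Sum>\<sigma>\<in>S'. c \<sigma> * (?E e * powr_laplace (real n - 1) (Complex e (\<tau> \<sigma>)))))
       + of_real B * (2 * (?E e * powr_laplace 0 (of_real e)) + (\<Sum>\<sigma>\<in>S'. c \<sigma> * (?E e * powr_laplace 0 (Complex e (\<tau> \<sigma>))))) = ?E e * Y e" for e
      unfolding Y_def by (simp add: sum_distrib_left algebra_simps)
    ultimately show ?thesis by (simp add: mult_ac)
  qed
  have exp_split: "exp (- (Complex e t * of_real M)) = of_real (exp (- (e * M))) * cis (- (t * M))" for e t M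
  proof -
    have "- (Complex e t * of_real M) = of_real (- (e * M)) + \<i> * of_real (- (t * M))" by (simp add: complex_eq_iff)
    then show ?thesis by (simp only: exp_add exp_of_real cis_conv_exp)
  qed
  have ZY: "norm (Z e) \<le> Re (Y e)" if e: "e > 0" for e
  proof -
    let ?ex = "\<lambda>M. exp (- (e * M))"
    let ?W = "\<lambda>M. indicator {0..} M * (A * M powr (real n - 1) + B * M powr 0)"
    have intK: "integrable lborel (\<lambda>M. c \<sigma> * (\<Sum>i\<in>I. of_real (w i) * (of_real (riesz_sum n (\<theta> i) M) * exp (- (Complex e (\<tau> \<sigma>) * of_real M)))))" for \<sigma>
      using kernel_laplace_integral(1)[OF n] \<theta> e
      by (intro integrable_mult_right Bochner_Integration.integrable_sum) auto
    have "Z e = (\<Sum>\<sigma>\<in>S'. c \<sigma> * (\<Sum>i\<in>I. of_real (w i) * (LINT M|lborel. of_real (riesz_sum n (\<theta> i) M) * exp (- (Complex e (\<tau> \<sigma>) * of_real M)))))"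
      unfolding Z_def using kernel_laplace_integral(2)[OF n] \<theta> e by (intro sum.cong refl arg_cong2[of _ _ _ _ "(*)"]) auto
    also have "\<dots> = (\<Sum>\<sigma>\<in>S'. LINT M|lborel. c \<sigma> * (\<Sum>i\<in>I. of_real (w i) * (of_real (riesz_sum n (\<theta> i) M) * exp (- (Complex e (\<tau> \<sigma>) * of_real M)))))"
      using kernel_laplace_integral(1)[OF n] \<theta> e
      by (intro sum.cong refl) (simp add: Bochner_Integration.integral_sum)
    also have "\<dots> = (LINT M|lborel. (\<Sum>\<sigma>\<in>S'. c \<sigma> * (\<Sum>i\<in>I. of_real (w i) * (of_real (riesz_sum n (\<theta> i) M) * exp (- (Complex e (\<tau> \<sigma>) * of_real M))))))"
      by (rule Bochner_Integration.integral_sum[symmetric]) (rule intK)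
    also have "\<dots> = (LINT M|lborel. of_real (D M * (p M - 1) * ?ex M))"
    proof (intro Bochner_Integration.integral_cong refl)
      fix M
      have "(\<Sum>\<sigma>\<in>S'. c \<sigma> * (\<Sum>i\<in>I. of_real (w i) * (of_real (riesz_sum n (\<theta> i) M) * exp (- (Complex e (\<tau> \<sigma>) * of_real M)))))
         = (\<Sum>\<sigma>\<in>S'. (of_real (D M) * of_real (?ex M)) * (c \<sigma> * cis (- (\<tau> \<sigma> * M))))"
        unfolding exp_split D_def by (intro sum.cong refl) (simp add: sum_distrib_left sum_distrib_right mult_ac)
      also have "\<dots> = (of_real (D M) * of_real (?ex M)) * (of_real (p M) - 1)"
        unfolding p_exp by (simp add: sum_distrib_left)
      finally show "(\<Sum>\<sigma>\<in>S'. c \<sigma> * (\<Sum>i\<in>I. of_real (w i) * (of_real (riesz_sum n (\<theta> i) M) * exp (- (Complex e (\<tau> \<sigma>) * of_real M)))))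
         = of_real (D M * (p M - 1) * ?ex M)" by simp
    qed
    finally have Zeq: "Z e = (LINT M|lborel. of_real (D M * (p M - 1) * ?ex M))" .
    let ?f = "\<lambda>b s M. complex_of_real (indicator {0..} M * M powr b) * exp (- (s * of_real M))"
    have hf: "has_bochner_integral lborel (?f b s) (powr_laplace b s)" if "b \<ge> 0" "Re s > 0" for b s
      using powr_laplace_integrable[of s b] that unfolding powr_laplace_def has_bochner_integral_iff by simp
    have n1: "real n - 1 \<ge> 0" using n by simp
    have "has_bochner_integral lborel
       (\<lambda>M. of_real A * (2 * ?f (real n - 1) (of_real e) M + (\<Sum>\<sigma>\<in>S'. c \<sigma> * ?f (real n - 1) (Complex e (\<tau> \<sigma>)) M))
          + of_real B * (2 * ?f 0 (of_real e) M + (\<Sum>\<sigma>\<in>S'. c \<sigma> * ?f 0 (Complex e (\<tau> \<sigma>)) M))) (Y e)"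
      unfolding Y_def using e n1
      by (intro has_bochner_integral_add has_bochner_integral_mult_right has_bochner_integral_sum hf) auto
    moreover have "of_real A * (2 * ?f (real n - 1) (of_real e) M + (\<Sum>\<sigma>\<in>S'. c \<sigma> * ?f (real n - 1) (Complex e (\<tau> \<sigma>)) M))
          + of_real B * (2 * ?f 0 (of_real e) M + (\<Sum>\<sigma>\<in>S'. c \<sigma> * ?f 0 (Complex e (\<tau> \<sigma>)) M)) = of_real (?W M * ((p M + 1) * ?ex M))" for M
    proof -
      have 1: "2 * ?f b (of_real e) M + (\<Sum>\<sigma>\<in>S'. c \<sigma> * ?f b (Complex e (\<tau> \<sigma>)) M)
          = of_real (indicator {0..} M * M powr b) * (of_real (?ex M) * (of_real (p M) + 1))" for b
      proof -
        have "exp (- (complex_of_real e * of_real M)) = of_real (?ex M)"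
          by (metis exp_of_real of_real_minus of_real_mult)
        moreover have "(\<Sum>\<sigma>\<in>S'. c \<sigma> * ?f b (Complex e (\<tau> \<sigma>)) M) = of_real (indicator {0..} M * M powr b) * of_real (?ex M) * (\<Sum>\<sigma>\<in>S'. c \<sigma> * cis (- (\<tau> \<sigma> * M)))"
          unfolding exp_split by (simp only: sum_distrib_left mult_ac)
        ultimately show ?thesis unfolding p_exp by (simp add: algebra_simps)
      qed
      show ?thesis unfolding 1 by (simp add: algebra_simps)
    qed
    ultimately have hY: "has_bochner_integral lborel (\<lambda>M. complex_of_real (?W M * ((p M + 1) * ?ex M))) (Y e)"
      by (simp only:)
    have intW: "integrable lborel (\<lambda>M. ?W M * ((p M + 1) * ?ex M))"
      using hY by (simp only: has_bochner_integral_iff complex_of_real_integrable_eq)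
    have "norm (Z e) \<le> (LINT M|lborel. ?W M * ((p M + 1) * ?ex M))"
      unfolding Zeq
    proof (rule norm_integral_le_integral[OF intW])
      fix M
      have "norm (complex_of_real (D M * (p M - 1) * ?ex M)) = \<bar>D M\<bar> * (\<bar>p M - 1\<bar> * ?ex M)"
        by (simp only: norm_of_real abs_mult) simp
      also have "\<dots> \<le> ?W M * ((p M + 1) * ?ex M)"
        using p0[of M] B(2)[of M] order_trans[OF abs_ge_zero B(2)[of M]]
        by (intro mult_mono mult_right_mono) auto
      finally show "norm (complex_of_real (D M * (p M - 1) * ?ex M)) \<le> ?W M * ((p M + 1) * ?ex M)" .
    qed
    also have "\<dots> = Re (Y e)"
      unfolding has_bochner_integral_integral_eq[OF hY, symmetric] integral_complex_of_real by (rule Re_complex_of_real[symmetric])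
    finally show ?thesis .
  qed
  have "norm (complex_of_real (\<Sum>i\<in>I. w i * norm (L i))) \<le> Re (of_real (2 * A * Gamma (real n)))"
  proof (rule tendsto_le[OF _ tendsto_Re[OF limY] tendsto_norm[OF limZ]])
    have "eventually (\<lambda>e::real. e > 0) (at_right 0)" by (simp add: eventually_at_right_less)
    then show "\<forall>\<^sub>F e in at_right 0. norm (complex_of_real (e ^ n) * Z e) \<le> Re (complex_of_real (e ^ n) * Y e)"
    proof eventually_elim
      case (elim e)
      have "norm (complex_of_real (e ^ n) * Z e) = e ^ n * norm (Z e)"
        using elim by (simp only: norm_mult norm_of_real) simp
      also have "\<dots> \<le> e ^ n * Re (Y e)" using ZY[OF elim] elim by (intro mult_left_mono) auto
      also have "\<dots> = Re (complex_of_real (e ^ n) * Y e)" by (simp del: of_real_power)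
      finally show ?case .
    qed
  qed simp
  then have "(\<Sum>i\<in>I. w i * norm (L i)) \<le> 2 * A * Gamma (real n)"
    by (simp only: norm_of_real Re_complex_of_real)
  also have "(\<Sum>i\<in>I. w i * norm (L i)) = Gamma (real n) * (\<Sum>i\<in>I. w i * (\<theta> i powr (- ((real n + 1) / 2)) * sin (\<theta> i) powr (- ((real n - 1) / 2))))"
    unfolding sum_distrib_left by (intro sum.cong refl) (simp only: normL mult_ac)
  finally show ?thesis using G by (simp add: mult.commute)
qed

section \<open>Caps and level sets on the sphere\<close>

lemma borel_measurable_sphere_measure:
  "f \<in> borel_measurable borel \<Longrightarrow> f \<in> borel_measurable (sphere_measure :: 'a::euclidean_space measure)"
  by (subst measurable_cong_sets[OF sets_sphere_measure refl]) (rule measurable_restrict_space1)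

lemma sets_sphere_measureI:
  "A \<in> sets borel \<Longrightarrow> A \<subseteq> sphere 0 1 \<Longrightarrow> A \<in> sets (sphere_measure :: 'a::euclidean_space measure)"
  by (auto simp: sets_restrict_space)

interpretation sphere: finite_measure "sphere_measure :: 'a::euclidean_space measure"
  by (rule finite_measure_sphere_measure)

lemma measure_sphere_measure_total: "measure (sphere_measure :: 'a::euclidean_space measure) (sphere 0 1) = 1"
  by (simp add: measure_def emeasure_sphere_measure_total)

lemma measure_sphere_measure:
  fixes A :: "'a::euclidean_space set"
  assumes "A \<in> sets borel" "A \<subseteq> sphere 0 1"
  shows "measure sphere_measure A = measure lborel {x \<in> ball 0 1. sgn x \<in> A} / measure lborel (ball (0::'a) 1)"
proof -
  have "emeasure lborel {x \<in> ball 0 1. sgn x \<in> A} \<le> emeasure lborel (ball (0::'a) 1)"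
    by (intro emeasure_mono) auto
  also have "\<dots> < \<infinity>" by (rule emeasure_bounded_finite) simp
  finally have f: "emeasure lborel {x \<in> ball 0 1. sgn x \<in> A} \<noteq> \<infinity>" by simp
  have "emeasure lborel (ball (0::'a) 1) < \<infinity>" by (rule emeasure_bounded_finite) simp
  moreover have "measure lborel (ball (0::'a) 1) > 0" using content_ball_pos[of 1 "0::'a"] by simp
  ultimately show ?thesis
    using f unfolding measure_def[of sphere_measure] emeasure_sphere_measure[OF assms]
    by (simp add: emeasure_eq_ennreal_measure divide_ennreal)
qed

lemma dist_sgn_less:
  fixes x z :: "'a::real_inner"
  assumes x: "norm x = 1" and s: "1 / 2 \<le> s" and r: "0 < r" "r \<le> 1" and z: "norm (z - s *\<^sub>R x) < r / 8"
  shows "dist (sgn z) x < r"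
proof -
  have "\<bar>norm z - s\<bar> \<le> norm (z - s *\<^sub>R x)"
    using norm_triangle_ineq3[of z "s *\<^sub>R x"] x s by simp
  then have nz: "\<bar>norm z - s\<bar> < r / 8" using z by linarith
  then have pos: "norm z > 3 / 8" using s r by linarith
  have "norm z *\<^sub>R sgn z = z" by (cases "z = 0") (simp_all add: sgn_div_norm)
  then have "norm z *\<^sub>R (sgn z - x) = (z - s *\<^sub>R x) + (s - norm z) *\<^sub>R x"
    by (simp add: algebra_simps)
  then have "norm z * norm (sgn z - x) = norm ((z - s *\<^sub>R x) + (s - norm z) *\<^sub>R x)"
    by (metis abs_norm_cancel norm_scaleR)
  also have "\<dots> \<le> norm (z - s *\<^sub>R x) + \<bar>s - norm z\<bar>"
    using norm_triangle_ineq[of "z - s *\<^sub>R x" "(s - norm z) *\<^sub>R x"] x by simp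
  also have "\<dots> < r / 4" using z nz by linarith
  finally have 1: "norm z * norm (sgn z - x) < r / 4" .
  have "3 / 8 * norm (sgn z - x) \<le> norm z * norm (sgn z - x)"
    using pos by (intro mult_right_mono) auto
  then have "norm (sgn z - x) < r" using 1 r by linarith
  then show ?thesis by (simp add: dist_norm)
qed

text \<open>The cone over a cap of radius \<open>r\<close> contains about \<open>1 / r\<close> disjoint balls of radius \<open>r / 8\<close>, strung
along its axis.\<close>

lemma cap_measure_lower_bound:
  fixes x :: "'a::euclidean_space"
  assumes dim: "DIM('a) = n + 1" and x: "x \<in> sphere 0 1" and r: "0 < r" "r \<le> 1"
  shows "measure sphere_measure (ball x r \<inter> sphere 0 1) \<ge> r ^ n / 8 ^ (n + 1)"
proof -
  let ?A = "ball x r \<inter> sphere 0 1"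
  let ?V = "measure lborel (ball (0::'a) 1)"
  define K where "K = nat \<lceil>1 / r\<rceil>"
  have K: "1 / r \<le> real K" "real K < 1 / r + 1"
    unfolding K_def using r by (auto simp: of_nat_ceiling) (use r in linarith)
  define s where "s = (\<lambda>j::nat. 1 / 2 + real j * (r / 4))"
  define U where "U = (\<lambda>j. ball (s j *\<^sub>R x) (r / 8))"
  have nx: "norm x = 1" using x by simp
  have V: "?V > 0" using content_ball_pos[of 1 "0::'a"] by simp
  have sj: "1 / 2 \<le> s j" "s j \<le> 3 / 4" if "j < K" for j
  proof -
    show "1 / 2 \<le> s j" using r by (simp add: s_def)
    have "real j \<le> real K - 1" using that by linarith
    then have "real j \<le> 1 / r" using K by linarith
    then have "real j * (r / 4) \<le> 1 / r * (r / 4)" using r by (intro mult_right_mono) auto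
    then show "s j \<le> 3 / 4" using r by (simp add: s_def)
  qed
  have disj: "disjoint_family_on U {..<K}"
  proof -
    have "U i \<inter> U j = {}" if "i < j" for i j
    proof -
      have "dist (s i *\<^sub>R x) (s j *\<^sub>R x) = \<bar>s i - s j\<bar>"
        using nx by (simp add: dist_norm flip: scaleR_left_diff_distrib)
      also have "\<dots> = (real j - real i) * (r / 4)" using that r
        by (simp add: s_def abs_if algebra_simps)
      also have "\<dots> \<ge> 1 * (r / 4)" using that r by (intro mult_right_mono) auto
      finally have d: "dist (s i *\<^sub>R x) (s j *\<^sub>R x) \<ge> r / 8 + r / 8" by simp
      show ?thesis
      proof (rule ccontr)
        assume "U i \<inter> U j \<noteq> {}"
        then obtain z where "dist (s i *\<^sub>R x) z < r / 8" "dist (s j *\<^sub>R x) z < r / 8" by (auto simp: U_def)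
        then show False using d dist_triangle2[of "s i *\<^sub>R x" "s j *\<^sub>R x" z] by linarith
      qed
    qed
    then show ?thesis unfolding disjoint_family_on_def by (metis Int_commute nat_neq_iff)
  qed
  have sub: "(\<Union>j<K. U j) \<subseteq> {z \<in> ball 0 1. sgn z \<in> ?A}"
  proof safe
    fix j z assume j: "j < K" and z: "z \<in> U j"
    have nz: "norm (z - s j *\<^sub>R x) < r / 8" using z by (simp add: U_def dist_norm norm_minus_commute)
    have "norm z \<le> norm (z - s j *\<^sub>R x) + norm (s j *\<^sub>R x)" using norm_triangle_ineq[of "z - s j *\<^sub>R x" "s j *\<^sub>R x"] by simp
    then have "norm z < 1" using nz sj[OF j] nx r by simp
    then show "z \<in> ball 0 1" by simp
    have d: "dist (sgn z) x < r" by (rule dist_sgn_less[OF nx sj(1)[OF j] r nz])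
    then show "sgn z \<in> ball x r" by (simp add: dist_commute)
    have "z \<noteq> 0"
    proof
      assume "z = 0"
      then show False using d nx r by (simp add: dist_norm)
    qed
    then show "sgn z \<in> sphere 0 1" by (simp add: norm_sgn)
  qed
  have fin: "emeasure lborel S < \<infinity>" if "S \<subseteq> ball (0::'a) 1" for S
  proof -
    have "emeasure lborel S \<le> emeasure lborel (ball (0::'a) 1)" using that by (intro emeasure_mono) auto
    also have "\<dots> < \<infinity>" by (rule emeasure_bounded_finite) simp
    finally show ?thesis .
  qed
  have borelA: "{z \<in> ball 0 1. sgn z \<in> ?A} \<in> sets lborel"
  proof -
    have "(\<lambda>x::'a. x /\<^sub>R norm x) \<in> borel \<rightarrow>\<^sub>M borel" by measurable
    then have "(sgn :: 'a \<Rightarrow> 'a) \<in> borel \<rightarrow>\<^sub>M borel" by (simp add: sgn_div_norm[abs_def])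
    from measurable_sets[OF this, of ?A] have "sgn -` ?A \<in> sets borel" by simp
    moreover have "{z \<in> ball 0 1. sgn z \<in> ?A} = ball 0 1 \<inter> sgn -` ?A" by auto
    ultimately show ?thesis by simp
  qed
  have Uc: "measure lborel (U j) = (r / 8) ^ (n + 1) * ?V" for j
    unfolding U_def using content_ball_conv_unit_ball[of "r / 8" "s j *\<^sub>R x"] r dim by simp
  have "real K * ((r / 8) ^ (n + 1) * ?V) = (\<Sum>j<K. measure lborel (U j))" by (simp add: Uc)
  also have "\<dots> = measure lborel (\<Union>j<K. U j)"
  proof (rule measure_finite_Union[symmetric])
    fix i assume "i \<in> {..<K}"
    have "emeasure lborel (U i) < \<infinity>" unfolding U_def by (rule emeasure_bounded_finite) simp
    then show "emeasure lborel (U i) \<noteq> \<infinity>" by simp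
  qed (use disj in \<open>auto simp: U_def\<close>)
  also have "\<dots> \<le> measure lborel {z \<in> ball 0 1. sgn z \<in> ?A}"
  proof (rule measure_mono_fmeasurable[OF sub])
    have "{z \<in> ball 0 1. sgn z \<in> ?A} \<subseteq> ball 0 1" by blast
    from fin[OF this] borelA show "{z \<in> ball 0 1. sgn z \<in> ?A} \<in> fmeasurable lborel"
      unfolding fmeasurable_def by blast
  qed (simp add: U_def)
  finally have 1: "real K * (r / 8) ^ (n + 1) * ?V \<le> measure lborel {z \<in> ball 0 1. sgn z \<in> ?A}" by (simp add: mult.assoc)
  have "measure sphere_measure ?A = measure lborel {z \<in> ball 0 1. sgn z \<in> ?A} / ?V"
    by (rule measure_sphere_measure) auto
  also have "\<dots> \<ge> real K * (r / 8) ^ (n + 1)" using 1 V by (simp add: field_simps)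
  finally have "real K * (r / 8) ^ (n + 1) \<le> measure sphere_measure ?A" .
  moreover have "1 / r * (r / 8) ^ (n + 1) \<le> real K * (r / 8) ^ (n + 1)" using K r by (intro mult_right_mono) auto
  moreover have "1 / r * (r / 8) ^ (n + 1) = r ^ n / 8 ^ (n + 1)" using r by (simp add: power_divide)
  ultimately show ?thesis by linarith
qed

text \<open>For \<open>0 \<le> c < 1\<close> the set is contained in the frontier of a convex cone, and for \<open>c \<ge> 1\<close> it is at most a ray.
Negative \<open>c\<close> are reduced to positive ones by the reflection \<open>x \<mapsto> - x\<close>.\<close>

lemma negligible_cone:
  fixes x :: "'a::euclidean_space"
  assumes dim: "DIM('a) \<ge> 2" and x: "norm x = 1"
  shows "negligible {z. x \<bullet> z = c * norm z}"
proof -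
  have main: "negligible {z. x \<bullet> z = c * norm z}" if x: "norm x = 1" and c: "c \<ge> 0" for x :: 'a and c
  proof (cases "c < 1")
    case True
    let ?S = "{z. c * norm z \<le> x \<bullet> z}"
    have "convex ?S"
    proof (rule convexI)
      fix y z and u v :: real assume *: "y \<in> ?S" "z \<in> ?S" "0 \<le> u" "0 \<le> v" "u + v = 1"
      have "c * norm (u *\<^sub>R y + v *\<^sub>R z) \<le> c * (u * norm y + v * norm z)"
        using c * by (intro mult_left_mono order_trans[OF norm_triangle_ineq]) auto
      also have "\<dots> = u * (c * norm y) + v * (c * norm z)" by (simp add: algebra_simps)
      also have "\<dots> \<le> u * (x \<bullet> y) + v * (x \<bullet> z)" using * by (intro add_mono mult_left_mono) auto
      finally show "u *\<^sub>R y + v *\<^sub>R z \<in> ?S" by (simp add: inner_add_right)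
    qed
    then have "negligible (frontier ?S)" by (rule negligible_convex_frontier)
    moreover have "{z. x \<bullet> z = c * norm z} \<subseteq> frontier ?S"
    proof
      fix z assume "z \<in> {z. x \<bullet> z = c * norm z}"
      then have z: "x \<bullet> z = c * norm z" by simp
      have "z \<notin> interior ?S"
      proof
        assume "z \<in> interior ?S"
        then obtain e where e: "e > 0" "ball z e \<subseteq> ?S" by (auto simp: mem_interior)
        have "z - (e / 2) *\<^sub>R x \<in> ball z e" using e x by (simp add: dist_norm)
        then have "c * norm (z - (e / 2) *\<^sub>R x) \<le> x \<bullet> (z - (e / 2) *\<^sub>R x)" using subsetD[OF e(2)] by blast
        also have "\<dots> = c * norm z - e / 2" using x by (simp add: inner_diff_right z dot_square_norm)
        finally have "c * norm (z - (e / 2) *\<^sub>R x) \<le> c * norm z - e / 2" .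
        moreover have "norm z - e / 2 \<le> norm (z - (e / 2) *\<^sub>R x)"
          using norm_triangle_ineq2[of z "(e / 2) *\<^sub>R x"] x e by simp
        then have "c * (norm z - e / 2) \<le> c * norm (z - (e / 2) *\<^sub>R x)" using c by (intro mult_left_mono)
        ultimately have "e / 2 \<le> c * (e / 2)" by (simp add: algebra_simps)
        then show False using e True by simp
      qed
      moreover have "z \<in> closure ?S" using z closure_subset by force
      ultimately show "z \<in> frontier ?S" by (simp add: frontier_def)
    qed
    ultimately show ?thesis by (rule negligible_subset)
  next
    case False
    obtain w where w: "w \<noteq> 0" "orthogonal x w" using orthogonal_to_vector_exists[OF dim, of x] by blast
    have "{z. x \<bullet> z = c * norm z} \<subseteq> {z. w \<bullet> z = 0}"
    proof safe
      fix z assume z: "x \<bullet> z = c * norm z"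
      have "c * norm z \<le> norm z" using z norm_cauchy_schwarz[of x z] x by simp
      moreover have "norm z \<le> c * norm z" using False by (simp add: mult_right_mono[of 1 c "norm z", simplified])
      ultimately have "x \<bullet> z = norm x * norm z" using z x by simp
      then have "norm x *\<^sub>R z = norm z *\<^sub>R x" by (simp add: norm_cauchy_schwarz_eq)
      then have "z = norm z *\<^sub>R x" using x by simp
      then have "w \<bullet> z = norm z * (w \<bullet> x)" by (metis inner_scaleR_right)
      then show "w \<bullet> z = 0" using w by (simp add: orthogonal_def inner_commute)
    qed
    moreover have "negligible {z. w \<bullet> z = 0}" using w by (intro negligible_hyperplane) auto
    ultimately show ?thesis by (rule negligible_subset[rotated])
  qed
  show ?thesis
  proof (cases "c \<ge> 0")
    case True then show ?thesis using main[OF x] by blast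
  next
    case False
    have "{z. x \<bullet> z = c * norm z} = {z. (- x) \<bullet> z = (- c) * norm z}" by auto
    then show ?thesis using main[of "- x" "- c"] x False by simp
  qed
qed

lemma AE_sphere_inner_neq:
  fixes x :: "'a::euclidean_space"
  assumes dim: "DIM('a) \<ge> 2" and x: "x \<in> sphere 0 1"
  shows "AE y in sphere_measure. x \<bullet> y \<noteq> c"
proof (rule AE_I)
  let ?A = "{y. x \<bullet> y = c} \<inter> sphere 0 1"
  have cl: "closed {y. x \<bullet> y = c}" by (intro closed_Collect_eq continuous_intros)
  show "{y \<in> space sphere_measure. \<not> x \<bullet> y \<noteq> c} \<subseteq> ?A" by auto
  show A: "?A \<in> sets sphere_measure" using cl by (intro sets_sphere_measureI) auto
  have "{z \<in> ball 0 1. sgn z \<in> ?A} \<subseteq> {z. x \<bullet> z = c * norm z}"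
    by (auto simp: sgn_div_norm field_simps split: if_splits)
  moreover have "{z. x \<bullet> z = c * norm z} \<in> null_sets lborel"
  proof -
    have "closed {z. x \<bullet> z = c * norm z}" by (intro closed_Collect_eq continuous_intros)
    then show ?thesis using negligible_cone[OF dim, of x c] x negligible_iff_null_sets[of "{z. x \<bullet> z = c * norm z}"]
      by (auto simp: null_sets_completion_iff)
  qed
  ultimately have "emeasure lborel {z \<in> ball 0 1. sgn z \<in> ?A} = 0"
    by (metis (no_types, lifting) emeasure_mono le_zero_eq null_setsD1 null_setsD2)
  then show "emeasure sphere_measure ?A = 0"
    using cl by (subst emeasure_sphere_measure) auto
qed

lemma AE_sphere_imp_ex:
  fixes c :: "'a::euclidean_space"
  assumes dim: "DIM('a) \<ge> 2" and AE: "AE y in sphere_measure. P y" and c: "c \<in> sphere 0 1" and h: "h > 0"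
  shows "\<exists>y \<in> sphere 0 1 \<inter> ball c h. P y"
proof (rule ccontr)
  assume neg: "\<not> ?thesis"
  define n where "n = DIM('a) - 1"
  have n: "DIM('a) = n + 1" using dim by (simp add: n_def)
  define r where "r = min h 1"
  have r: "0 < r" "r \<le> 1" using h by (auto simp: r_def)
  have "AE y in sphere_measure. y \<notin> ball c r \<inter> sphere 0 1"
    using AE by eventually_elim (use neg in \<open>auto simp: r_def\<close>)
  moreover have "ball c r \<inter> sphere 0 1 \<in> sets sphere_measure" by (intro sets_sphere_measureI) auto
  ultimately have "emeasure sphere_measure (ball c r \<inter> sphere 0 1) = 0"
    using AE_iff_null_sets by blast
  then have "measure sphere_measure (ball c r \<inter> sphere 0 1) = 0" by (simp add: measure_def)
  moreover have "r ^ n / 8 ^ (n + 1) > 0" using r by simp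
  ultimately show False using cap_measure_lower_bound[OF n c r] by linarith
qed

text \<open>Clamping the inner product to the domain of \<open>arccos\<close> makes the angle a continuous function on the whole
space, which settles all questions of measurability.\<close>

definition sphere_angle :: "'a::euclidean_space \<Rightarrow> 'a \<Rightarrow> real" where
  "sphere_angle x y = arccos (max (-1) (min 1 (x \<bullet> y)))"

lemma inner_sphere_bounds:
  fixes x y :: "'a::euclidean_space"
  assumes "x \<in> sphere 0 1" "y \<in> sphere 0 1" shows "-1 \<le> x \<bullet> y" "x \<bullet> y \<le> 1"
  using Cauchy_Schwarz_ineq2[of x y] assms by (auto simp: abs_le_iff)

lemma cos_sphere_angle: "x \<in> sphere 0 1 \<Longrightarrow> y \<in> sphere 0 1 \<Longrightarrow> cos (sphere_angle x y) = x \<bullet> y"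
  using inner_sphere_bounds[of x y] by (simp add: sphere_angle_def)

lemma sphere_angle_bounds: "0 \<le> sphere_angle x y" "sphere_angle x y \<le> pi"
  unfolding sphere_angle_def by (intro arccos_lbound arccos_ubound; simp)+

lemma continuous_on_sphere_angle: "continuous_on UNIV (\<lambda>p. sphere_angle (fst p) (snd p))"
  unfolding sphere_angle_def by (intro continuous_on_arccos continuous_intros) auto

lemma borel_measurable_sphere_angle_pair:
  "(\<lambda>p. sphere_angle (fst p) (snd p)) \<in> borel_measurable ((sphere_measure :: 'a::euclidean_space measure) \<Otimes>\<^sub>M sphere_measure)"
proof -
  have 1: "(\<lambda>p::'a \<times> 'a. sphere_angle (fst p) (snd p)) \<in> borel_measurable borel"
    by (rule borel_measurable_continuous_onI[OF continuous_on_sphere_angle])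
  have id: "(\<lambda>x. x) \<in> borel_measurable (sphere_measure :: 'a measure)" by (rule borel_measurable_sphere_measure) simp
  have "(\<lambda>p. (fst p, snd p)) \<in> (sphere_measure :: 'a measure) \<Otimes>\<^sub>M (sphere_measure :: 'a measure) \<rightarrow>\<^sub>M borel \<Otimes>\<^sub>M borel"
    by (intro measurable_Pair measurable_compose[OF measurable_fst id] measurable_compose[OF measurable_snd id])
  then have "(\<lambda>p. p) \<in> (sphere_measure :: 'a measure) \<Otimes>\<^sub>M (sphere_measure :: 'a measure) \<rightarrow>\<^sub>M borel"
    by (simp add: borel_prod)
  from measurable_compose[OF this 1] show ?thesis by simp
qed

lemma borel_measurable_sphere_angle: "(\<lambda>x. sphere_angle x y) \<in> borel_measurable (sphere_measure :: 'a::euclidean_space measure)"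
proof (rule borel_measurable_sphere_measure, rule borel_measurable_continuous_onI)
  show "continuous_on UNIV (\<lambda>x. sphere_angle x y)"
    unfolding sphere_angle_def by (intro continuous_on_arccos continuous_intros) auto
qed

section \<open>Generic and dense points\<close>

text \<open>For fixed \<open>x\<close> the excluded points \<open>z\<close> lie on one level set of the angle, a null set. The order of the
two quantifiers is then exchanged by Fubini's theorem.\<close>

lemma AE_angle_combination_neq:
  fixes y :: "nat \<Rightarrow> 'a::euclidean_space" and \<sigma> :: "nat \<Rightarrow> int" and k m :: int
  assumes dim: "DIM('a) \<ge> 2" and k: "k \<noteq> 0"
  shows "AE z in sphere_measure. AE x in sphere_measure.
     (\<Sum>i<N. real_of_int (\<sigma> i) * sphere_angle x (y i)) + real_of_int k * sphere_angle x z \<noteq> 2 * pi * real_of_int m"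
proof -
  interpret pair: pair_sigma_finite "sphere_measure :: 'a measure" "sphere_measure :: 'a measure"
    by (intro pair_sigma_finite.intro sphere.sigma_finite_measure_axioms)
  let ?P = "\<lambda>x z. (\<Sum>i<N. real_of_int (\<sigma> i) * sphere_angle x (y i)) + real_of_int k * sphere_angle x z \<noteq> 2 * pi * real_of_int m"
  let ?M = "(sphere_measure :: 'a measure) \<Otimes>\<^sub>M (sphere_measure :: 'a measure)"
  have "(\<lambda>p. (\<Sum>i<N. real_of_int (\<sigma> i) * sphere_angle (fst p) (y i)) + real_of_int k * sphere_angle (fst p) (snd p)) \<in> borel_measurable ?M"
    by (intro borel_measurable_add borel_measurable_sum borel_measurable_times borel_measurable_const borel_measurable_sphere_angle_pair
       measurable_compose[OF measurable_fst borel_measurable_sphere_angle])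
  from measurable_sets[OF this, of "- {2 * pi * real_of_int m}"]
  have S: "{p \<in> space ?M. ?P (fst p) (snd p)} \<in> sets ?M"
    by (simp add: vimage_def Int_def conj_commute)
  have "AE x in sphere_measure. AE z in sphere_measure. ?P x z"
  proof (rule AE_I2)
    fix x :: 'a assume "x \<in> space sphere_measure"
    then have x: "x \<in> sphere 0 1" by simp
    define c where "c = (2 * pi * real_of_int m - (\<Sum>i<N. real_of_int (\<sigma> i) * sphere_angle x (y i))) / real_of_int k"
    have "AE z in sphere_measure. x \<bullet> z \<noteq> cos c" by (rule AE_sphere_inner_neq[OF dim x])
    moreover have "AE z in sphere_measure. z \<in> sphere (0::'a) 1" by (rule AE_I2) simp
    ultimately show "AE z in sphere_measure. ?P x z"
    proof eventually_elim
      case (elim z)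
      show ?case
      proof
        assume "(\<Sum>i<N. real_of_int (\<sigma> i) * sphere_angle x (y i)) + real_of_int k * sphere_angle x z = 2 * pi * real_of_int m"
        then have "sphere_angle x z = c" using k by (simp add: c_def field_simps)
        then show False using elim cos_sphere_angle[OF x elim(2)] by simp
      qed
    qed
  qed
  then show ?thesis using pair.AE_commute[OF S] by simp
qed

text \<open>The points are chosen one after the other; each must avoid the null sets that belong to the countably
many relations in which its angle occurs with a nonzero coefficient.\<close>

lemma generic_points:
  fixes c :: "nat \<Rightarrow> 'a::euclidean_space"
  assumes dim: "DIM('a) \<ge> 2" and h: "h > 0" and c: "\<And>i. i < N \<Longrightarrow> c i \<in> sphere 0 1"
  shows "\<exists>y. (\<forall>i<N. y i \<in> sphere 0 1 \<inter> ball (c i) h) \<and>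
    (AE x in sphere_measure. \<forall>(\<sigma>::nat \<Rightarrow> int) m::int. (\<forall>i<N. \<sigma> i \<in> {-2..2}) \<longrightarrow>
        (\<Sum>i<N. real_of_int (\<sigma> i) * sphere_angle x (y i)) = 2 * pi * real_of_int m \<longrightarrow> (\<forall>i<N. \<sigma> i = 0))"
  using c
proof (induction N)
  case 0
  then show ?case by simp
next
  case (Suc N)
  then obtain y where y: "\<And>i. i < N \<Longrightarrow> y i \<in> sphere 0 1 \<inter> ball (c i) h"
    and AE1: "AE x in sphere_measure. \<forall>(\<sigma>::nat \<Rightarrow> int) m::int. (\<forall>i<N. \<sigma> i \<in> {-2..2}) \<longrightarrow>
        (\<Sum>i<N. real_of_int (\<sigma> i) * sphere_angle x (y i)) = 2 * pi * real_of_int m \<longrightarrow> (\<forall>i<N. \<sigma> i = 0)"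
    by auto
  define X where "X = (({..<N} \<rightarrow>\<^sub>E {-2..2::int}) \<times> {-2, -1, 1, 2::int} \<times> (UNIV :: int set))"
  have "finite ({..<N} \<rightarrow>\<^sub>E {-2..2::int})" by (rule finite_PiE) simp_all
  moreover have "countable ({-2, -1, 1, 2::int} \<times> (UNIV :: int set))"
    by (rule countableI_type)
  ultimately have X: "countable X" unfolding X_def
    by (rule countable_SIGMA[OF countable_finite])
  define Q where "Q = (\<lambda>z x (q :: (nat \<Rightarrow> int) \<times> int \<times> int).
     (\<Sum>i<N. real_of_int (fst q i) * sphere_angle x (y i)) + real_of_int (fst (snd q)) * sphere_angle x z \<noteq> 2 * pi * real_of_int (snd (snd q)))"
  have "AE z in sphere_measure. AE x in sphere_measure. Q z x q" if "q \<in> X" for q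
  proof -
    have "fst (snd q) \<in> {-2, -1, 1, 2}" using that unfolding X_def mem_Times_iff by (elim conjE)
    then have "fst (snd q) \<noteq> 0" by (elim insertE emptyE) simp_all
    from AE_angle_combination_neq[OF dim this, where N = N and \<sigma> = "fst q" and y = y and m = "snd (snd q)"] show ?thesis unfolding Q_def .
  qed
  then have "\<forall>q\<in>X. AE z in sphere_measure. AE x in sphere_measure. Q z x q" by blast
  then have "AE z in sphere_measure. \<forall>q\<in>X. AE x in sphere_measure. Q z x q"
    using AE_ball_countable[OF X, of "\<lambda>z q. AE x in sphere_measure. Q z x q" sphere_measure] by blast
  from AE_sphere_imp_ex[OF dim this, of "c N" h] Suc.prems[of N] h
  obtain z where z: "z \<in> sphere 0 1 \<inter> ball (c N) h" and "\<forall>q\<in>X. AE x in sphere_measure. Q z x q" by blast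
  then have AE2: "AE x in sphere_measure. \<forall>q\<in>X. Q z x q"
    using AE_ball_countable[OF X, of "\<lambda>x q. Q z x q" sphere_measure] by blast
  have "AE x in sphere_measure. \<forall>(\<sigma>::nat \<Rightarrow> int) m::int. (\<forall>i<Suc N. \<sigma> i \<in> {-2..2}) \<longrightarrow>
        (\<Sum>i<Suc N. real_of_int (\<sigma> i) * sphere_angle x ((y(N := z)) i)) = 2 * pi * real_of_int m \<longrightarrow> (\<forall>i<Suc N. \<sigma> i = 0)"
    using AE1 AE2
  proof eventually_elim
    case (elim x)
    show ?case
    proof (intro allI impI)
      fix \<sigma> :: "nat \<Rightarrow> int" and m :: int and i
      assume \<sigma>: "\<forall>i<Suc N. \<sigma> i \<in> {-2..2}"
        and eq: "(\<Sum>i<Suc N. real_of_int (\<sigma> i) * sphere_angle x ((y(N := z)) i)) = 2 * pi * real_of_int m" and i: "i < Suc N"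
      have eq': "(\<Sum>i<N. real_of_int (\<sigma> i) * sphere_angle x (y i)) + real_of_int (\<sigma> N) * sphere_angle x z = 2 * pi * real_of_int m"
        using eq by simp
      have \<sigma>N: "\<sigma> N = 0"
      proof (rule ccontr)
        assume "\<sigma> N \<noteq> 0"
        moreover have "\<sigma> N \<in> {-2..2}" using \<sigma> by blast
        ultimately have "\<sigma> N \<in> {-2, -1, 1, 2}" by auto
        moreover have "restrict \<sigma> {..<N} \<in> {..<N} \<rightarrow>\<^sub>E {-2..2}"
          using \<sigma> by (intro restrict_PiE_iff[THEN iffD2] ballI) simp
        ultimately have "(restrict \<sigma> {..<N}, \<sigma> N, m) \<in> X" unfolding X_def mem_Times_iff fst_conv snd_conv by blast
        then have "Q z x (restrict \<sigma> {..<N}, \<sigma> N, m)" using elim(2) by blast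
        then show False using eq' by (simp add: Q_def)
      qed
      then have "(\<Sum>i<N. real_of_int (\<sigma> i) * sphere_angle x (y i)) = 2 * pi * real_of_int m" using eq' by simp
      moreover have "\<forall>i<N. \<sigma> i \<in> {-2..2}" using \<sigma> by auto
      ultimately have "\<forall>i<N. \<sigma> i = 0" using elim(1) by blast
      then show "\<sigma> i = 0" using i \<sigma>N by (cases "i = N") auto
    qed
  qed
  moreover have "\<forall>i<Suc N. (y(N := z)) i \<in> sphere 0 1 \<inter> ball (c i) h"
    using y z by (auto simp: less_Suc_eq)
  ultimately show ?case by blast
qed

lemma geometric_sum_le:
  fixes q :: real assumes "q \<ge> 2" shows "(\<Sum>s\<le>k. q ^ s) \<le> 2 * q ^ k"
proof (induction k)
  case (Suc k)
  have "2 * q ^ k \<le> q * q ^ k" using assms by (intro mult_right_mono) auto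
  with Suc show ?case by simp
qed simp

text \<open>A sum over dyadic scales in which the largest term that occurs dominates. It converts lower bounds for
the mass of balls into lower bounds for the potential \<open>inverse d ^ n\<close>.\<close>

lemma dyadic_sum_le:
  fixes d :: real
  assumes d: "d > 0" and n: "n \<ge> 1"
  shows "(\<Sum>s\<le>k. if d < (1 / 2) ^ s then (2 ^ n) ^ s else 0) \<le> 2 * inverse d ^ n"
proof (induction k)
  case 0
  show ?case
  proof (cases "d < 1")
    case True
    then have "1 \<le> inverse d ^ n" using d by (intro one_le_power) (simp add: one_le_inverse)
    then show ?thesis using True by simp
  qed (use d in simp)
next
  case (Suc k)
  show ?case
  proof (cases "d < (1 / 2) ^ Suc k")
    case True
    have 1: "d < (1 / 2) ^ s" if "s \<le> Suc k" for s
      using True power_decreasing[OF that, of "1 / 2 :: real"] by simp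
    have "(2::real) ^ 1 \<le> 2 ^ n" using n by (intro power_increasing) auto
    then have q: "(2::real) ^ n \<ge> 2" by simp
    have "(\<Sum>s\<le>Suc k. if d < (1 / 2) ^ s then (2 ^ n) ^ s else 0) = (\<Sum>s\<le>Suc k. ((2::real) ^ n) ^ s)"
      using 1 by (intro sum.cong) auto
    also have "\<dots> \<le> 2 * ((2::real) ^ n) ^ Suc k" by (rule geometric_sum_le[OF q])
    also have "((2::real) ^ n) ^ Suc k = (2 ^ Suc k) ^ n"
      by (simp only: power_mult[symmetric] mult.commute)
    also have "\<dots> \<le> inverse d ^ n"
    proof (rule power_mono)
      have "d < 1 / 2 ^ Suc k" using True by (simp only: power_one_over)
      then have "d * 2 ^ Suc k < 1" by (simp only: pos_less_divide_eq zero_less_power zero_less_numeral)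
      then have "2 ^ Suc k * d \<le> 1" by (simp only: mult.commute less_imp_le)
      then show "2 ^ Suc k \<le> inverse d" using d by (simp only: inverse_eq_divide pos_le_divide_eq)
    qed simp
    finally show ?thesis by simp
  next
    case False
    then show ?thesis using Suc by simp
  qed
qed

text \<open>A discrete form of the divergence of \<open>\<integral> dist x y powr (- n) dy\<close>. Each dyadic scale down to the
mesh width contributes a fixed amount, since a ball of radius \<open>r\<close> carries mass of order \<open>r ^ n\<close>. The
points may be moved within distance \<open>h\<close>, which leaves room for genericity.\<close>

lemma weighted_points:
  assumes dim: "DIM('a::euclidean_space) = n + 1" and n: "n \<ge> 1"
  shows "\<exists>N (c :: nat \<Rightarrow> 'a) h w. h > 0 \<and> (\<forall>i<N. c i \<in> sphere 0 1) \<and> (\<forall>i. w i \<ge> 0) \<and> (\<Sum>i<N. w i) = (1::real) \<and>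
    (\<forall>y. (\<forall>i<N. y i \<in> sphere 0 1 \<inter> ball (c i) h) \<longrightarrow> (\<forall>x\<in>sphere 0 1. (\<forall>i<N. x \<noteq> y i) \<longrightarrow>
        A \<le> (\<Sum>i<N. w i * inverse (dist x (y i)) ^ n)))"
proof -
  define \<kappa> :: real where "\<kappa> = 1 / (2 ^ n * 8 ^ (n + 1))"
  have \<kappa>: "\<kappa> > 0" by (simp add: \<kappa>_def)
  \<comment> \<open>the number of dyadic scales; each of them contributes at least \<open>\<kappa>\<close> to twice the potential\<close>
  define k where "k = nat \<lceil>2 * A / \<kappa>\<rceil>"
  have k: "2 * A / \<kappa> \<le> real k" unfolding k_def by linarith
  \<comment> \<open>a quarter of the smallest scale, so that errors of \<open>2 * h\<close> at most double a radius\<close>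
  define h :: real where "h = (1 / 2) ^ (k + 2)"
  have h: "h > 0" by (simp add: h_def)
  have cover: "sphere (0::'a) 1 \<subseteq> (\<Union>x\<in>sphere 0 1. ball x h)"
    using h centre_in_ball by blast
  obtain C where "C \<subseteq> sphere (0::'a) 1" "finite C" "sphere 0 1 \<subseteq> (\<Union>x\<in>C. ball x h)"
    by (rule compactE_image[OF compact_sphere _ cover]) (rule open_ball)
  then have C: "finite C" "C \<subseteq> sphere (0::'a) 1" "sphere 0 1 \<subseteq> (\<Union>x\<in>C. ball x h)" by blast+
  obtain cs where cs: "set cs = C" using finite_list[OF C(1)] by blast
  define N where "N = length cs"
  define c where "c = (\<lambda>i. cs ! i)"
  have cC: "c i \<in> sphere 0 1" if "i < N" for i using that C(2) cs nth_mem[of i cs] by (auto simp: c_def N_def)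
  have Cc: "C = c ` {..<N}" unfolding cs[symmetric] c_def N_def by (auto simp: set_conv_nth)
  let ?B = "\<lambda>i. ball (c i) h \<inter> sphere 0 1"
  define P where "P = disjointed ?B"
  define w where "w = (\<lambda>i. measure sphere_measure (P i))"
  have Pm: "P i \<in> sets sphere_measure" for i
    unfolding P_def disjointed_def by (intro sets.Diff sets.finite_UN sets_sphere_measureI) auto
  have Psub: "P i \<subseteq> ?B i" for i unfolding P_def by (rule disjointed_subset)
  have Pdisj: "disjoint_family_on P S" for S
    using disjoint_family_disjointed[of ?B] unfolding P_def by (auto simp: disjoint_family_on_def)
  have Pcov: "(\<Union>i<N. P i) = sphere 0 1"
  proof -
    have "(\<Union>i<N. P i) = (\<Union>i<N. ?B i)"
      using finite_UN_disjointed_eq[of ?B N] unfolding P_def by (simp add: atLeast0LessThan)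
    also have "\<dots> = sphere 0 1" using C(3) unfolding Cc by auto
    finally show ?thesis .
  qed
  have sumw: "(\<Sum>i\<in>S. w i) = measure sphere_measure (\<Union>i\<in>S. P i)" if "finite S" for S
  proof -
    have "P ` S \<subseteq> sets sphere_measure" using Pm by blast
    from sphere.finite_measure_finite_Union[OF that this Pdisj] show ?thesis unfolding w_def by (rule sym)
  qed
  have w1: "(\<Sum>i<N. w i) = 1" using sumw[of "{..<N}"] Pcov measure_sphere_measure_total by simp
  have main: "A \<le> (\<Sum>i<N. w i * inverse (dist x (y i)) ^ n)"
    if y: "\<forall>i<N. y i \<in> sphere 0 1 \<inter> ball (c i) h" and x: "x \<in> sphere 0 1" and ne: "\<forall>i<N. x \<noteq> y i" for y and x :: 'a
  proof -
    let ?d = "\<lambda>i. dist x (y i)"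
    have cap: "\<kappa> \<le> (2 ^ n) ^ s * (\<Sum>i<N. if ?d i < (1 / 2) ^ s then w i else 0)" if s: "s \<le> k" for s
    proof -
      let ?S = "{i. i < N \<and> ?d i < (1 / 2) ^ s}"
      define r :: real where "r = (1 / 2) ^ (s + 1)"
      have r: "0 < r" "r \<le> 1" unfolding r_def by (simp, rule power_le_one) auto
      have "h * 2 \<le> r"
      proof -
        have "h * 2 = (1 / 2) ^ (k + 1)" by (simp add: h_def)
        also have "\<dots> \<le> r" unfolding r_def using s by (intro power_decreasing) auto
        finally show ?thesis .
      qed
      have sub: "ball x r \<inter> sphere 0 1 \<subseteq> (\<Union>i\<in>?S. P i)"
      proof
        fix z assume z: "z \<in> ball x r \<inter> sphere 0 1"
        then obtain i where i: "i < N" "z \<in> P i" using Pcov by blast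
        have "dist x z < r" "dist (c i) z < h" "dist (c i) (y i) < h" using z i Psub[of i] y by auto
        then have "?d i < r + h + h"
          using dist_triangle[of x "y i" z] dist_triangle[of z "y i" "c i"] by (simp add: dist_commute)
        also have "\<dots> \<le> (1 / 2) ^ s" using \<open>h * 2 \<le> r\<close> by (simp add: r_def)
        finally show "z \<in> (\<Union>i\<in>?S. P i)" using i by blast
      qed
      have "r ^ n / 8 ^ (n + 1) \<le> measure sphere_measure (ball x r \<inter> sphere 0 1)"
        by (rule cap_measure_lower_bound[OF dim x r])
      also have "\<dots> \<le> measure sphere_measure (\<Union>i\<in>?S. P i)"
        by (rule sphere.finite_measure_mono[OF sub]) (use Pm in auto)
      also have "\<dots> = (\<Sum>i\<in>?S. w i)" by (rule sumw[symmetric]) simp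
      also have "\<dots> = (\<Sum>i<N. if ?d i < (1 / 2) ^ s then w i else 0)"
        by (subst sum.inter_filter[symmetric]) (auto intro!: sum.cong)
      finally have "(2 ^ n) ^ s * (r ^ n / 8 ^ (n + 1)) \<le> (2 ^ n) ^ s * (\<Sum>i<N. if ?d i < (1 / 2) ^ s then w i else 0)"
        by (intro mult_left_mono) auto
      moreover have "(2 ^ n) ^ s * (r ^ n / 8 ^ (n + 1)) = \<kappa>"
      proof -
        have "(2 ^ n) ^ s * r ^ n = (2 ^ s * r) ^ n"
          by (simp only: power_mult_distrib power_mult[symmetric] mult.commute)
        also have "2 ^ s * r = 1 / 2" by (simp add: r_def power_one_over)
        finally show ?thesis by (simp add: \<kappa>_def power_one_over divide_simps)
      qed
      ultimately show ?thesis by simp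
    qed
    have "2 * A \<le> \<kappa> * real k" using k \<kappa> by (simp add: field_simps)
    also have "\<dots> \<le> \<kappa> * real (Suc k)" using \<kappa> by (intro mult_left_mono) auto
    also have "\<dots> = (\<Sum>s\<le>k. \<kappa>)" by simp
    also have "\<dots> \<le> (\<Sum>s\<le>k. (2 ^ n) ^ s * (\<Sum>i<N. if ?d i < (1 / 2) ^ s then w i else 0))"
      by (intro sum_mono cap) auto
    also have "\<dots> = (\<Sum>s\<le>k. \<Sum>i<N. w i * (if ?d i < (1 / 2) ^ s then (2 ^ n) ^ s else 0))"
      unfolding sum_distrib_left by (intro sum.cong refl) auto
    also have "\<dots> = (\<Sum>i<N. w i * (\<Sum>s\<le>k. if ?d i < (1 / 2) ^ s then (2 ^ n) ^ s else 0))"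
      unfolding sum_distrib_left by (rule sum.swap)
    also have "\<dots> \<le> (\<Sum>i<N. w i * (2 * inverse (?d i) ^ n))"
      using ne n by (intro sum_mono mult_left_mono dyadic_sum_le) (auto simp: w_def)
    also have "\<dots> = 2 * (\<Sum>i<N. w i * inverse (?d i) ^ n)" by (simp add: sum_distrib_left mult_ac)
    finally show ?thesis by simp
  qed
  show ?thesis
    using h cC w1 main by (intro exI[of _ N] exI[of _ c] exI[of _ h] exI[of _ w]) (auto simp: w_def)
qed

text \<open>Half of the argument is not optimal, but a Taylor polynomial of degree \<open>1\<close> suffices for it.\<close>

lemma half_le_sin:
  fixes x :: real assumes "0 \<le> x" "x \<le> pi / 2" shows "x / 2 \<le> sin x"
proof -
  have "\<bar>sin x - (\<Sum>m<3. sin_coeff m * x ^ m)\<bar> \<le> inverse (fact 3) * \<bar>x\<bar> ^ 3"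
    by (rule Maclaurin_sin_bound)
  moreover have "(\<Sum>m<3. sin_coeff m * x ^ m) = x" by (simp add: sin_coeff_def numeral_3_eq_3)
  ultimately have "\<bar>sin x - x\<bar> \<le> x ^ 3 / 6" using assms by (simp add: fact_numeral)
  then have "x - x ^ 3 / 6 \<le> sin x" by linarith
  moreover have "x ^ 3 / 6 \<le> x / 2"
  proof -
    have "x \<le> 1.7" using assms pi_approx by simp
    then have "x * x \<le> 1.7 * 1.7" using assms by (intro mult_mono) auto
    then have "x * (x * x) \<le> x * 3" using assms by (intro mult_left_mono) auto
    then show ?thesis by (simp add: power3_eq_cube)
  qed
  ultimately show ?thesis by simp
qed

lemma kernel_amplitude_lower_bound:
  fixes x y :: "'a::euclidean_space"
  assumes x: "x \<in> sphere 0 1" and y: "y \<in> sphere 0 1" and \<theta>: "0 < sphere_angle x y" "sphere_angle x y < pi" and n: "n \<ge> 1"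
  shows "inverse (dist x y) ^ n / 2 ^ n \<le> sphere_angle x y powr (- ((real n + 1) / 2)) * sin (sphere_angle x y) powr (- ((real n - 1) / 2))"
proof -
  let ?\<theta> = "sphere_angle x y"
  have s: "0 < sin ?\<theta>" using \<theta> by (intro sin_gt_zero)
  have "(dist x y)\<^sup>2 = 2 - 2 * (x \<bullet> y)"
    using x y by (simp add: dist_norm power2_norm_eq_inner inner_diff_left inner_diff_right inner_commute norm_eq_1)
  also have "\<dots> = (2 * sin (?\<theta> / 2))\<^sup>2"
    using cos_double_sin[of "?\<theta> / 2"] cos_sphere_angle[OF x y] by (simp add: power2_eq_square)
  finally have "dist x y = 2 * sin (?\<theta> / 2)"
    by (rule power2_eq_imp_eq) (use \<theta> in \<open>auto intro!: sin_ge_zero\<close>)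
  then have d: "?\<theta> \<le> 2 * dist x y" using half_le_sin[of "?\<theta> / 2"] \<theta> by simp
  have "inverse (dist x y) ^ n / 2 ^ n = inverse (2 * dist x y) ^ n" by (simp only: inverse_mult_distrib power_mult_distrib power_inverse divide_inverse mult.commute)
  also have "\<dots> \<le> inverse ?\<theta> ^ n" using d \<theta> by (intro power_mono le_imp_inverse_le) auto
  also have "\<dots> = ?\<theta> powr (- real n)" using \<theta> by (simp add: powr_minus powr_realpow power_inverse)
  also have "- real n = - ((real n + 1) / 2) + - ((real n - 1) / 2)" by (simp add: field_simps)
  also have "?\<theta> powr \<dots> = ?\<theta> powr (- ((real n + 1) / 2)) * ?\<theta> powr (- ((real n - 1) / 2))" by (rule powr_add)
  also have "\<dots> \<le> ?\<theta> powr (- ((real n + 1) / 2)) * sin ?\<theta> powr (- ((real n - 1) / 2))"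
    using s sin_x_le_x[of ?\<theta>] \<theta> n by (intro mult_left_mono powr_mono2') auto
  finally show ?thesis .
qed

section \<open>From point masses to integrable functions\<close>

lemma continuous_on_gegenbauer: "continuous_on S (gegenbauer k l)"
  unfolding gegenbauer_def[abs_def] by (intro continuous_intros)

lemma continuous_on_zonal_coeff: "continuous_on S (zonal_coeff n k)"
  unfolding zonal_coeff_def[abs_def] by (intro continuous_intros continuous_on_gegenbauer)

lemma continuous_on_bochner_kernel: "continuous_on S (bochner_kernel n R)"
  unfolding bochner_kernel_def[abs_def] by (intro continuous_intros continuous_on_zonal_coeff)

lemma continuous_bounded_interval:
  fixes g :: "real \<Rightarrow> real"
  assumes "continuous_on UNIV g"
  shows "\<exists>C\<ge>0. \<forall>t\<in>{-1..1}. \<bar>g t\<bar> \<le> C"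
proof -
  have "compact (g ` {-1..1})"
    by (intro compact_continuous_image continuous_on_subset[OF assms]) auto
  then have "bounded (g ` {-1..1})" by (rule compact_imp_bounded)
  then obtain C where "\<forall>t\<in>g ` {-1..1}. norm t \<le> C" by (auto simp: bounded_iff)
  then show ?thesis by (intro exI[of _ "max C 0"]) auto
qed

lemma zonal_integrable:
  fixes f :: "'a::euclidean_space \<Rightarrow> real" and g :: "real \<Rightarrow> real"
  assumes g: "continuous_on UNIV g" and C: "\<And>t. t \<in> {-1..1} \<Longrightarrow> \<bar>g t\<bar> \<le> C"
    and f: "integrable sphere_measure f" and x: "x \<in> sphere 0 1"
  shows "integrable sphere_measure (\<lambda>y. g (x \<bullet> y) * f y)"
    and "\<bar>LINT y|sphere_measure. g (x \<bullet> y) * f y\<bar> \<le> C * (LINT y|sphere_measure. \<bar>f y\<bar>)"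
proof -
  have "continuous_on UNIV (\<lambda>y. g (x \<bullet> y))"
    by (rule continuous_on_compose2[OF g]) (auto intro!: continuous_intros)
  then have m: "(\<lambda>y. g (x \<bullet> y)) \<in> borel_measurable sphere_measure"
    by (intro borel_measurable_sphere_measure borel_measurable_continuous_onI)
  have le: "norm (g (x \<bullet> y) * f y) \<le> C * \<bar>f y\<bar>" if "y \<in> space sphere_measure" for y
  proof -
    have "\<bar>g (x \<bullet> y)\<bar> \<le> C" using inner_sphere_bounds[OF x, of y] that by (intro C) auto
    then show ?thesis by (simp add: abs_mult mult_right_mono)
  qed
  have iC: "integrable sphere_measure (\<lambda>y. C * \<bar>f y\<bar>)" using f by simp
  show i: "integrable sphere_measure (\<lambda>y. g (x \<bullet> y) * f y)"
  proof (rule Bochner_Integration.integrable_bound[OF iC])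
    show "(\<lambda>y. g (x \<bullet> y) * f y) \<in> borel_measurable sphere_measure"
      using m f by (intro borel_measurable_times) auto
    show "AE y in sphere_measure. norm (g (x \<bullet> y) * f y) \<le> norm (C * \<bar>f y\<bar>)"
    proof (rule AE_I2)
      fix y :: 'a assume "y \<in> space sphere_measure"
      from le[OF this] show "norm (g (x \<bullet> y) * f y) \<le> norm (C * \<bar>f y\<bar>)" by simp
    qed
  qed
  have "norm (LINT y|sphere_measure. g (x \<bullet> y) * f y) \<le> (LINT y|sphere_measure. C * \<bar>f y\<bar>)"
    by (rule norm_integral_le_integral[OF iC le])
  then show "\<bar>LINT y|sphere_measure. g (x \<bullet> y) * f y\<bar> \<le> C * (LINT y|sphere_measure. \<bar>f y\<bar>)" by simp
qed

lemma bochner_riesz_eq_integral: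
  fixes f :: "'a::euclidean_space \<Rightarrow> real"
  assumes n: "n \<ge> 2" and f: "integrable sphere_measure f" and x: "x \<in> sphere 0 1"
  shows "bochner_riesz n ((real n - 1) / 2) R f x = (LINT y|sphere_measure. bochner_kernel n R (x \<bullet> y) * f y)"
proof -
  let ?K = "{k. real (k * (k + n - 1)) < R\<^sup>2}"
  let ?c = "\<lambda>k. (1 - real (k * (k + n - 1)) / R\<^sup>2) powr ((real n - 1) / 2)"
  have int: "integrable sphere_measure (\<lambda>y. zonal_coeff n k (x \<bullet> y) * f y)" for k
  proof -
    obtain C where "\<forall>t\<in>{-1..1}. \<bar>zonal_coeff n k t\<bar> \<le> C"
      using continuous_bounded_interval[OF continuous_on_zonal_coeff] by blast
    then show ?thesis by (intro zonal_integrable(1)[OF continuous_on_zonal_coeff _ f x, of _ _ C]) blast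
  qed
  have "sphere_proj n k f x = (LINT y|sphere_measure. zonal_coeff n k (x \<bullet> y) * f y)" for k
    unfolding sphere_proj_def zonal_def zonal_coeff_def Let_def ..
  then have "bochner_riesz n ((real n - 1) / 2) R f x = (\<Sum>k\<in>?K. LINT y|sphere_measure. ?c k * (zonal_coeff n k (x \<bullet> y) * f y))"
    unfolding bochner_riesz_def by simp
  also have "\<dots> = (LINT y|sphere_measure. (\<Sum>k\<in>?K. ?c k * (zonal_coeff n k (x \<bullet> y) * f y)))"
    by (rule Bochner_Integration.integral_sum[symmetric]) (intro integrable_mult_right int)
  also have "\<dots> = (LINT y|sphere_measure. bochner_kernel n R (x \<bullet> y) * f y)"
    unfolding bochner_kernel_def sum_distrib_right by (simp only: mult.assoc)
  finally show ?thesis .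
qed

text \<open>Independence also excludes the angles \<open>0\<close> and \<open>pi\<close>, through the relations \<open>\<theta> = 0\<close> and
\<open>2 * \<theta> = 2 * pi\<close>.\<close>

lemma discrete_divergence:
  assumes dim: "DIM('a::euclidean_space) = n + 1" and n: "n \<ge> 2"
  shows "\<exists>N (y :: nat \<Rightarrow> 'a) w. (\<forall>i<N. y i \<in> sphere 0 1) \<and> (\<forall>i. w i \<ge> 0) \<and> (\<Sum>i<N. w i) = (1::real) \<and>
    (AE x in sphere_measure. \<forall>R0. \<exists>R\<ge>R0. \<bar>\<Sum>i<N. w i * bochner_kernel n R (x \<bullet> y i)\<bar> > A)"
proof -
  have dim2: "DIM('a) \<ge> 2" and n1: "n \<ge> 1" using dim n by auto
  obtain N :: nat and c :: "nat \<Rightarrow> 'a" and h w where h: "h > 0" and c: "\<forall>i<N. c i \<in> sphere 0 1"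
    and w: "\<forall>i. w i \<ge> 0" "(\<Sum>i<N. w i) = 1"
    and big: "\<forall>y. (\<forall>i<N. y i \<in> sphere 0 1 \<inter> ball (c i) h) \<longrightarrow> (\<forall>x\<in>sphere 0 1. (\<forall>i<N. x \<noteq> y i) \<longrightarrow>
        2 ^ n * (2 * A + 1) \<le> (\<Sum>i<N. w i * inverse (dist x (y i)) ^ n))"
    using weighted_points[OF dim n1, of "2 ^ n * (2 * A + 1)"] by blast
  obtain y where y: "\<forall>i<N. y i \<in> sphere 0 1 \<inter> ball (c i) h"
    and gen: "AE x in sphere_measure. \<forall>(\<sigma>::nat \<Rightarrow> int) m::int. (\<forall>i<N. \<sigma> i \<in> {-2..2}) \<longrightarrow>
        (\<Sum>i<N. real_of_int (\<sigma> i) * sphere_angle x (y i)) = 2 * pi * real_of_int m \<longrightarrow> (\<forall>i<N. \<sigma> i = 0)"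
    using generic_points[OF dim2 h, of N c] c by blast
  have "AE x in sphere_measure. x \<in> sphere (0::'a) 1" by (rule AE_I2) simp
  with gen have "AE x in sphere_measure. \<forall>R0. \<exists>R\<ge>R0. \<bar>\<Sum>i<N. w i * bochner_kernel n R (x \<bullet> y i)\<bar> > A"
  proof eventually_elim
    case (elim x)
    have ys: "y i \<in> sphere 0 1" if "i < N" for i using y that by blast
    have nondeg: "real_of_int k * sphere_angle x (y i) \<noteq> 2 * pi * real_of_int m" if i: "i < N" and k: "k \<in> {1, 2}" for i k m
    proof
      assume eq: "real_of_int k * sphere_angle x (y i) = 2 * pi * real_of_int m"
      let ?\<sigma> = "\<lambda>j. if j = i then k else (0::int)"
      have "(\<Sum>j<N. real_of_int (?\<sigma> j) * sphere_angle x (y j)) = (\<Sum>j<N. if j = i then real_of_int k * sphere_angle x (y j) else 0)"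
        by (intro sum.cong) auto
      also have "\<dots> = 2 * pi * real_of_int m" using i eq by simp
      finally have "(\<Sum>j<N. real_of_int (?\<sigma> j) * sphere_angle x (y j)) = 2 * pi * real_of_int m" .
      moreover have "\<forall>j<N. ?\<sigma> j \<in> {-2..2}" using k by auto
      ultimately have "\<forall>j<N. ?\<sigma> j = 0" using elim(1)[rule_format, of ?\<sigma> m] by blast
      then have "k = 0" using i by auto
      then show False using k by simp
    qed
    have \<theta>: "0 < sphere_angle x (y i)" "sphere_angle x (y i) < pi" if i: "i < N" for i
    proof -
      have "sphere_angle x (y i) \<noteq> 0" using nondeg[OF i, of 1 0] by simp
      then show "0 < sphere_angle x (y i)" using sphere_angle_bounds(1)[of x "y i"] by linarith
      have "sphere_angle x (y i) \<noteq> pi" using nondeg[OF i, of 2 1] by simp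
      then show "sphere_angle x (y i) < pi" using sphere_angle_bounds(2)[of x "y i"] by linarith
    qed
    have ne: "x \<noteq> y i" if i: "i < N" for i
    proof
      assume "x = y i"
      then have "x \<bullet> y i = 1" using elim(2) by (simp add: dot_square_norm)
      then have "sphere_angle x (y i) = 0" by (simp add: sphere_angle_def)
      then show False using \<theta>[OF i] by simp
    qed
    show ?case
    proof (rule ccontr)
      assume "\<not> ?case"
      then obtain R0 where R0: "\<And>R. R \<ge> R0 \<Longrightarrow> \<bar>\<Sum>i<N. w i * bochner_kernel n R (x \<bullet> y i)\<bar> \<le> A"
        by (auto simp: not_less)
      have "(\<Sum>i<N. w i * (sphere_angle x (y i) powr (- ((real n + 1) / 2)) * sin (sphere_angle x (y i)) powr (- ((real n - 1) / 2)))) \<le> 2 * A"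
      proof (rule riesz_product_lower_bound[OF n, where ?R0.0 = R0])
        fix \<sigma> :: "nat \<Rightarrow> int" and m :: int
        assume "(\<Sum>i<N. real_of_int (\<sigma> i) * sphere_angle x (y i)) = 2 * pi * real_of_int m" "\<forall>i\<in>{..<N}. \<sigma> i \<in> {-2..2}"
        then show "\<forall>i\<in>{..<N}. \<sigma> i = 0" using elim(1) by blast
      next
        fix R assume R: "R \<ge> R0"
        have "(\<Sum>i<N. w i * bochner_kernel n R (cos (sphere_angle x (y i)))) = (\<Sum>i<N. w i * bochner_kernel n R (x \<bullet> y i))"
          using elim(2) ys by (intro sum.cong) (simp_all add: cos_sphere_angle)
        then show "\<bar>\<Sum>i<N. w i * bochner_kernel n R (cos (sphere_angle x (y i)))\<bar> \<le> A" using R0[OF R] by simp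
      qed (use w \<theta> in auto)
      moreover have "(\<Sum>i<N. w i * (inverse (dist x (y i)) ^ n / 2 ^ n)) \<le> (\<Sum>i<N. w i * (sphere_angle x (y i) powr (- ((real n + 1) / 2)) * sin (sphere_angle x (y i)) powr (- ((real n - 1) / 2))))"
        using w n1 elim(2) ys \<theta> by (intro sum_mono mult_left_mono kernel_amplitude_lower_bound) auto
      moreover have "(\<Sum>i<N. w i * (inverse (dist x (y i)) ^ n / 2 ^ n)) = (\<Sum>i<N. w i * inverse (dist x (y i)) ^ n) / 2 ^ n"
        by (simp add: sum_divide_distrib)
      moreover have "(2 ^ n * (2 * A + 1)) / 2 ^ n \<le> (\<Sum>i<N. w i * inverse (dist x (y i)) ^ n) / 2 ^ n"
        using big[rule_format, OF _ elim(2), of y] y ne by (intro divide_right_mono) auto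
      ultimately show False by simp
    qed
  qed
  moreover have "\<forall>i<N. y i \<in> sphere 0 1" using y by blast
  ultimately show ?thesis using w by (intro exI[of _ N] exI[of _ y] exI[of _ w]) blast
qed

text \<open>Lindelof's theorem and continuity of the measure from below. Openness of the sets where a mean is
large thus replaces any regularity in \<open>R\<close>.\<close>

lemma finite_subfamily_covers_almost:
  fixes U :: "real \<Rightarrow> 'a::euclidean_space set"
  assumes U: "\<And>R. open (U R)" and AE: "AE x in sphere_measure. \<exists>R\<in>J. x \<in> U R" and \<eta>: "\<eta> > 0"
  shows "\<exists>F. finite F \<and> F \<subseteq> J \<and> measure sphere_measure (sphere 0 1 - (\<Union>R\<in>F. U R)) \<le> \<eta>"
proof -
  let ?M = "sphere_measure :: 'a measure"
  obtain F' where F': "F' \<subseteq> U ` J" "countable F'" "\<Union>F' = \<Union>(U ` J)"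
    using Lindelof[of "U ` J"] U by blast
  obtain J' where J': "J' \<subseteq> J" "countable J'" "F' = U ` J'"
    using F'(1,2) countable_subset_image[of F' U J] by blast
  show ?thesis
  proof (cases "J' = {}")
    case True
    then have "\<Union>(U ` J) = {}" using F'(3) J'(3) by simp
    then have "AE x in ?M. False" using AE by (auto elim!: eventually_mono)
    then obtain Z where Z: "Z \<in> null_sets ?M" "{x \<in> space ?M. \<not> False} \<subseteq> Z"
      unfolding eventually_ae_filter by blast
    then have "emeasure ?M (space ?M) \<le> emeasure ?M Z" by (intro emeasure_mono) (use Z in blast)+
    then show ?thesis using Z by (simp add: emeasure_sphere_measure_total null_setsD1)
  next
    case False
    define g where "g = from_nat_into J'"
    have g: "range g = J'" unfolding g_def using range_from_nat_into[OF False J'(2)] .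
    define S where "S = (\<lambda>k. sphere 0 1 \<inter> (\<Union>i<k. U (g i)))"
    have Sm: "range S \<subseteq> sets ?M" unfolding S_def using U by (intro image_subsetI sets_sphere_measureI) auto
    have "incseq S" by (rule incseq_SucI) (auto simp: S_def less_Suc_eq)
    from sphere.finite_Lim_measure_incseq[OF Sm this]
    have lim: "(\<lambda>k. measure ?M (S k)) \<longlonglongrightarrow> measure ?M (\<Union>k. S k)" .
    have eq: "(\<Union>k. S k) = sphere 0 1 \<inter> (\<Union>R\<in>J. U R)"
    proof -
      have "(\<Union>k. S k) = sphere 0 1 \<inter> (\<Union>i. U (g i))" by (auto simp: S_def)
      also have "(\<Union>i. U (g i)) = (\<Union>R\<in>J'. U R)" using g by auto
      also have "\<dots> = (\<Union>R\<in>J. U R)" using F'(3) J'(3) by simp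
      finally show ?thesis .
    qed
    have "measure ?M (\<Union>k. S k) = measure ?M (sphere 0 1)"
    proof (rule measure_eq_AE)
      show "AE x in ?M. (x \<in> (\<Union>k. S k)) = (x \<in> sphere 0 1)"
        unfolding eq using AE by eventually_elim auto
      show "(\<Union>k. S k) \<in> sets ?M" using Sm by blast
      show "sphere 0 1 \<in> sets ?M" by (rule sets_sphere_measureI) auto
    qed
    then have "measure ?M (\<Union>k. S k) = 1" by (simp add: measure_sphere_measure_total)
    with lim have "eventually (\<lambda>k. 1 - \<eta> < measure ?M (S k)) sequentially"
      using \<eta> by (intro order_tendstoD(1)) auto
    then obtain k where k: "1 - \<eta> < measure ?M (S k)" by (auto simp: eventually_sequentially)
    have "sphere 0 1 - (\<Union>R\<in>g ` {..<k}. U R) = sphere 0 1 - S k" by (auto simp: S_def)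
    moreover have "measure ?M (sphere 0 1 - S k) = measure ?M (sphere 0 1) - measure ?M (S k)"
    proof (rule sphere.finite_measure_Diff)
      show "sphere 0 1 \<in> sets ?M" by (rule sets_sphere_measureI) auto
      show "S k \<in> sets ?M" using Sm by blast
    qed (auto simp: S_def)
    ultimately have "measure ?M (sphere 0 1 - (\<Union>R\<in>g ` {..<k}. U R)) \<le> \<eta>"
      using k measure_sphere_measure_total[where ?'a = 'a] by simp
    then show ?thesis using g J'(1) by (intro exI[of _ "g ` {..<k}"]) auto
  qed
qed


lemma uniform_modulus:
  assumes "finite F"
  shows "\<exists>\<rho>>0. \<forall>R\<in>F. \<forall>s\<in>{-1..1}. \<forall>t\<in>{-1..1}. \<bar>s - t\<bar> < \<rho> \<longrightarrow> \<bar>bochner_kernel n R s - bochner_kernel n R t\<bar> < 1"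
  using assms
proof (induction F rule: finite_induct)
  case empty
  show ?case by (intro exI[of _ 1]) simp
next
  case (insert R F)
  then obtain \<rho> where \<rho>: "\<rho> > 0" "\<forall>R\<in>F. \<forall>s\<in>{-1..1}. \<forall>t\<in>{-1..1}. \<bar>s - t\<bar> < \<rho> \<longrightarrow> \<bar>bochner_kernel n R s - bochner_kernel n R t\<bar> < 1"
    by blast
  have "uniformly_continuous_on {-1..1} (bochner_kernel n R)"
    by (intro compact_uniformly_continuous continuous_on_bochner_kernel) simp
  then obtain d where d: "d > 0" "\<forall>s\<in>{-1..1}. \<forall>t\<in>{-1..1}. dist t s < d \<longrightarrow> dist (bochner_kernel n R t) (bochner_kernel n R s) < 1"
    unfolding uniformly_continuous_on_def by (meson zero_less_one)
  show ?case
    using \<rho> d by (intro exI[of _ "min \<rho> d"]) (auto simp: dist_real_def abs_minus_commute)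
qed

text \<open>Finitely many kernels have a common modulus of continuity, so replacing the point masses by normalized
indicator functions of small caps changes the finitely many means concerned by at most \<open>1\<close>.\<close>

lemma large_on_most_of_sphere:
  assumes dim: "DIM('a::euclidean_space) = n + 1" and n: "n \<ge> 2" and \<eta>: "\<eta> > 0"
  shows "\<exists>(f :: 'a \<Rightarrow> real) F. integrable sphere_measure f \<and> (LINT x|sphere_measure. \<bar>f x\<bar>) \<le> 1 \<and> finite F \<and> F \<subseteq> {R0..} \<and>
    measure sphere_measure {x \<in> sphere 0 1. \<forall>R\<in>F. \<bar>bochner_riesz n ((real n - 1) / 2) R f x\<bar> < A} \<le> \<eta>"
proof -
  let ?M = "sphere_measure :: 'a measure"
  obtain N and y :: "nat \<Rightarrow> 'a" and w where y: "\<forall>i<N. y i \<in> sphere 0 1" and w: "\<forall>i. w i \<ge> 0" "(\<Sum>i<N. w i) = (1::real)"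
    and div: "AE x in ?M. \<forall>R0. \<exists>R\<ge>R0. \<bar>\<Sum>i<N. w i * bochner_kernel n R (x \<bullet> y i)\<bar> > A + 1"
    using discrete_divergence[OF dim n, of "A + 1"] by blast
  define G where "G = (\<lambda>R x. \<Sum>i<N. w i * bochner_kernel n R (x \<bullet> y i))"
  define U where "U = (\<lambda>R. {x. A + 1 < \<bar>G R x\<bar>})"
  have contG: "continuous_on UNIV (G R)" for R
    unfolding G_def
    by (intro continuous_intros continuous_on_compose2[OF continuous_on_bochner_kernel[of UNIV]]) auto
  have "open (U R)" for R
    unfolding U_def by (intro open_Collect_less continuous_intros contG)
  moreover have "AE x in ?M. \<exists>R\<in>{R0..}. x \<in> U R"
    using div by eventually_elim (auto simp: U_def G_def)
  ultimately obtain F where F: "finite F" "F \<subseteq> {R0..}" "measure ?M (sphere 0 1 - (\<Union>R\<in>F. U R)) \<le> \<eta>"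
    using finite_subfamily_covers_almost[of U "{R0..}" \<eta>] \<eta> by blast
  obtain \<rho> where \<rho>: "\<rho> > 0" and mod: "\<forall>R\<in>F. \<forall>s\<in>{-1..1}. \<forall>t\<in>{-1..1}. \<bar>s - t\<bar> < \<rho> \<longrightarrow> \<bar>bochner_kernel n R s - bochner_kernel n R t\<bar> < 1"
    using uniform_modulus[OF F(1)] by blast
  define cap where "cap = (\<lambda>i. ball (y i) \<rho> \<inter> sphere 0 1)"
  define m where "m = (\<lambda>i. measure ?M (cap i))"
  have capm: "cap i \<in> sets ?M" for i unfolding cap_def by (intro sets_sphere_measureI) auto
  have mpos: "m i > 0" if "i < N" for i
  proof -
    define r where "r = min \<rho> 1"
    have r: "0 < r" "r \<le> 1" using \<rho> by (auto simp: r_def)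
    have "0 < r ^ n / 8 ^ (n + 1)" using r by simp
    also have "\<dots> \<le> measure ?M (ball (y i) r \<inter> sphere 0 1)"
      using cap_measure_lower_bound[OF dim _ r, of "y i"] y that by blast
    also have "\<dots> \<le> m i"
      unfolding m_def using capm by (intro sphere.finite_measure_mono) (auto simp: cap_def r_def)
    finally show ?thesis .
  qed
  have int_cap: "integrable ?M (indicator (cap i) :: 'a \<Rightarrow> real)" for i
    using capm by (intro integrable_real_indicator) (auto simp: sphere.emeasure_finite less_top[symmetric])
  have LINT_cap: "(LINT z|?M. indicator (cap i) z) = m i" for i
    using capm[of i] sets.sets_into_space[OF capm[of i]] by (simp add: m_def Int_absorb2)
  define f where "f = (\<lambda>z. \<Sum>i<N. w i / m i * indicator (cap i) z)"
  have f: "integrable ?M f" unfolding f_def by (intro Bochner_Integration.integrable_sum integrable_mult_right int_cap)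
  have "f z \<ge> 0" for z unfolding f_def using w by (intro sum_nonneg) (auto simp: m_def)
  then have "(LINT z|?M. \<bar>f z\<bar>) = (LINT z|?M. f z)" by simp
  also have "\<dots> = (\<Sum>i<N. w i / m i * m i)"
    unfolding f_def
    by (subst Bochner_Integration.integral_sum)
       (simp_all only: integral_mult_right_zero LINT_cap integrable_mult_right int_cap)
  also have "\<dots> = (\<Sum>i<N. w i)"
  proof (intro sum.cong refl)
    fix i assume "i \<in> {..<N}"
    then show "w i / m i * m i = w i" using mpos[of i] by simp
  qed
  finally have normf: "(LINT z|?M. \<bar>f z\<bar>) \<le> 1" using w by simp
  have close: "\<bar>bochner_riesz n ((real n - 1) / 2) R f x - G R x\<bar> \<le> 1" if R: "R \<in> F" and x: "x \<in> sphere 0 1" for R x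
  proof -
    let ?K = "bochner_kernel n R"
    obtain C where C: "\<forall>t\<in>{-1..1}. \<bar>?K t\<bar> \<le> C" using continuous_bounded_interval[OF continuous_on_bochner_kernel] by blast
    have intK: "integrable ?M (\<lambda>z. ?K (x \<bullet> z) * indicator (cap i) z)" for i
      using C by (intro zonal_integrable(1)[OF continuous_on_bochner_kernel _ int_cap x, of _ _ C]) blast
    have "bochner_riesz n ((real n - 1) / 2) R f x = (LINT z|?M. ?K (x \<bullet> z) * f z)"
      by (rule bochner_riesz_eq_integral[OF n f x])
    also have "\<dots> = (LINT z|?M. (\<Sum>i<N. w i / m i * (?K (x \<bullet> z) * indicator (cap i) z)))"
      unfolding f_def sum_distrib_left by (simp only: mult_ac)
    also have "\<dots> = (\<Sum>i<N. w i / m i * (LINT z|?M. ?K (x \<bullet> z) * indicator (cap i) z))"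
      by (subst Bochner_Integration.integral_sum) (auto intro!: integrable_mult_right intK)
    finally have B: "bochner_riesz n ((real n - 1) / 2) R f x = (\<Sum>i<N. w i / m i * (LINT z|?M. ?K (x \<bullet> z) * indicator (cap i) z))" .
    have each: "\<bar>(LINT z|?M. ?K (x \<bullet> z) * indicator (cap i) z) - m i * ?K (x \<bullet> y i)\<bar> \<le> m i" if i: "i < N" for i
    proof -
      have "(LINT z|?M. ?K (x \<bullet> z) * indicator (cap i) z) - m i * ?K (x \<bullet> y i) =
         (LINT z|?M. ?K (x \<bullet> z) * indicator (cap i) z - indicator (cap i) z * ?K (x \<bullet> y i))"
        by (subst Bochner_Integration.integral_diff)
           (simp_all only: integral_mult_left_zero LINT_cap integrable_mult_left intK int_cap)
      then have "\<bar>(LINT z|?M. ?K (x \<bullet> z) * indicator (cap i) z) - m i * ?K (x \<bullet> y i)\<bar> =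
         norm (LINT z|?M. ?K (x \<bullet> z) * indicator (cap i) z - indicator (cap i) z * ?K (x \<bullet> y i))" by simp
      also have "\<dots> \<le> (LINT z|?M. indicator (cap i) z)"
      proof (rule norm_integral_le_integral[OF int_cap])
        fix z assume "z \<in> space ?M"
        show "norm (?K (x \<bullet> z) * indicator (cap i) z - indicator (cap i) z * ?K (x \<bullet> y i)) \<le> indicator (cap i) z"
        proof (cases "z \<in> cap i")
          case True
          then have z: "z \<in> sphere 0 1" "dist (y i) z < \<rho>" by (auto simp: cap_def)
          have "\<bar>x \<bullet> z - x \<bullet> y i\<bar> = \<bar>x \<bullet> (z - y i)\<bar>" by (simp add: inner_diff_right)
          also have "\<dots> \<le> norm x * norm (z - y i)" by (rule Cauchy_Schwarz_ineq2)
          also have "\<dots> < \<rho>" using x z by (simp add: dist_norm norm_minus_commute)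
          finally have "\<bar>?K (x \<bullet> z) - ?K (x \<bullet> y i)\<bar> < 1"
            using mod R inner_sphere_bounds[OF x z(1)] inner_sphere_bounds[OF x, of "y i"] y i by simp
          then show ?thesis using True by simp
        qed simp
      qed
      finally show ?thesis by (simp only: LINT_cap)
    qed
    have "bochner_riesz n ((real n - 1) / 2) R f x - G R x =
       (\<Sum>i<N. w i / m i * ((LINT z|?M. ?K (x \<bullet> z) * indicator (cap i) z) - m i * ?K (x \<bullet> y i)))"
      unfolding B G_def sum_subtractf[symmetric]
    proof (intro sum.cong refl)
      fix i assume "i \<in> {..<N}"
      then have "m i \<noteq> 0" using mpos[of i] by simp
      then show "w i / m i * (LINT z|?M. ?K (x \<bullet> z) * indicator (cap i) z) - w i * ?K (x \<bullet> y i) =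
         w i / m i * ((LINT z|?M. ?K (x \<bullet> z) * indicator (cap i) z) - m i * ?K (x \<bullet> y i))"
        by (simp add: right_diff_distrib)
    qed
    also have "\<bar>\<dots>\<bar> \<le> (\<Sum>i<N. w i)"
    proof (rule order_trans[OF sum_abs sum_mono])
      fix i assume "i \<in> {..<N}"
      then have i: "i < N" by simp
      have "\<bar>w i / m i * ((LINT z|?M. ?K (x \<bullet> z) * indicator (cap i) z) - m i * ?K (x \<bullet> y i))\<bar>
         = w i / m i * \<bar>(LINT z|?M. ?K (x \<bullet> z) * indicator (cap i) z) - m i * ?K (x \<bullet> y i)\<bar>"
        using w mpos[OF i] by (simp add: abs_mult)
      also have "\<dots> \<le> w i / m i * m i"
        using w mpos[OF i] each[OF i] by (intro mult_left_mono) auto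
      also have "\<dots> = w i" using mpos[OF i] by simp
      finally show "\<bar>w i / m i * ((LINT z|?M. ?K (x \<bullet> z) * indicator (cap i) z) - m i * ?K (x \<bullet> y i))\<bar> \<le> w i" .
    qed
    finally show ?thesis using w by simp
  qed
  have "{x \<in> sphere 0 1. \<forall>R\<in>F. \<bar>bochner_riesz n ((real n - 1) / 2) R f x\<bar> < A} \<subseteq> sphere 0 1 - (\<Union>R\<in>F. U R)"
  proof safe
    fix x R assume x: "x \<in> sphere 0 1" and small: "\<forall>R\<in>F. \<bar>bochner_riesz n ((real n - 1) / 2) R f x\<bar> < A" and R: "R \<in> F" "x \<in> U R"
    have "\<bar>bochner_riesz n ((real n - 1) / 2) R f x\<bar> < A" using small R(1) by blast
    moreover have "A + 1 < \<bar>G R x\<bar>" using R(2) by (simp add: U_def)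
    ultimately show False using close[OF R(1) x] by linarith
  qed
  moreover have "sphere 0 1 - (\<Union>R\<in>F. U R) \<in> sets ?M"
  proof (rule sets_sphere_measureI)
    have "open (\<Union>R\<in>F. U R)" using \<open>\<And>R. open (U R)\<close> by blast
    then show "sphere 0 1 - (\<Union>R\<in>F. U R) \<in> sets borel" by (intro sets.Diff borel_open borel_closed) auto
  qed auto
  ultimately have "measure ?M {x \<in> sphere 0 1. \<forall>R\<in>F. \<bar>bochner_riesz n ((real n - 1) / 2) R f x\<bar> < A} \<le> measure ?M (sphere 0 1 - (\<Union>R\<in>F. U R))"
    by (rule sphere.finite_measure_mono)
  then show ?thesis using f normf F by (intro exI[of _ f] exI[of _ F]) linarith
qed

section \<open>The gliding hump\<close>

lemma bochner_riesz_measurable: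
  fixes f :: "'a::euclidean_space \<Rightarrow> real"
  assumes n: "n \<ge> 2" and f: "integrable sphere_measure f"
  shows "(\<lambda>x. bochner_riesz n ((real n - 1) / 2) R f x) \<in> borel_measurable sphere_measure"
proof -
  let ?M = "sphere_measure :: 'a measure"
  have id: "(\<lambda>x. x) \<in> borel_measurable ?M" by (rule borel_measurable_sphere_measure) simp
  have "(\<lambda>p. fst p \<bullet> snd p) \<in> borel_measurable (?M \<Otimes>\<^sub>M ?M)"
    by (intro borel_measurable_inner measurable_compose[OF measurable_fst id] measurable_compose[OF measurable_snd id])
  from measurable_compose[OF this borel_measurable_continuous_onI[OF continuous_on_bochner_kernel[of UNIV n R]]]
  have "(\<lambda>p. bochner_kernel n R (fst p \<bullet> snd p) * f (snd p)) \<in> borel_measurable (?M \<Otimes>\<^sub>M ?M)"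
    using f by (intro borel_measurable_times measurable_compose[OF measurable_snd]) auto
  then have "(\<lambda>x. LINT y|?M. bochner_kernel n R (x \<bullet> y) * f y) \<in> borel_measurable ?M"
    by (intro sphere.borel_measurable_lebesgue_integral) (simp add: split_beta)
  then show ?thesis
    by (subst measurable_cong[where g = "\<lambda>x. LINT y|?M. bochner_kernel n R (x \<bullet> y) * f y"])
       (simp_all add: bochner_riesz_eq_integral[OF n f])
qed

lemma bochner_riesz_linear:
  fixes f g :: "'a::euclidean_space \<Rightarrow> real"
  assumes n: "n \<ge> 2" and g: "integrable sphere_measure g" and f: "integrable sphere_measure f" and x: "x \<in> sphere 0 1"
  shows "bochner_riesz n ((real n - 1) / 2) R (\<lambda>z. g z + c * f z) x =
     bochner_riesz n ((real n - 1) / 2) R g x + c * bochner_riesz n ((real n - 1) / 2) R f x"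
proof -
  obtain C where C: "\<forall>t\<in>{-1..1}. \<bar>bochner_kernel n R t\<bar> \<le> C" using continuous_bounded_interval[OF continuous_on_bochner_kernel] by blast
  have int: "integrable sphere_measure (\<lambda>y. bochner_kernel n R (x \<bullet> y) * u y)" if "integrable sphere_measure u" for u
    using C by (intro zonal_integrable(1)[OF continuous_on_bochner_kernel _ that x, of _ _ C]) blast
  have gf: "integrable sphere_measure (\<lambda>z. g z + c * f z)" using g f by simp
  have "(LINT y|sphere_measure. bochner_kernel n R (x \<bullet> y) * (g y + c * f y)) =
     (LINT y|sphere_measure. bochner_kernel n R (x \<bullet> y) * g y + c * (bochner_kernel n R (x \<bullet> y) * f y))"
    by (intro Bochner_Integration.integral_cong refl) (simp add: algebra_simps)
  also have "\<dots> = (LINT y|sphere_measure. bochner_kernel n R (x \<bullet> y) * g y) + c * (LINT y|sphere_measure. bochner_kernel n R (x \<bullet> y) * f y)"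
    by (subst Bochner_Integration.integral_add) (simp_all only: integral_mult_right_zero integrable_mult_right int g f)
  finally show ?thesis
    by (simp only: bochner_riesz_eq_integral[OF n gf x] bochner_riesz_eq_integral[OF n g x] bochner_riesz_eq_integral[OF n f x])
qed

text \<open>Add \<open>c t\<close> times the function \<open>f\<close> of \<open>large_on_most_of_sphere\<close> with \<open>c t\<close> one of \<open>q\<close> equally
spaced numbers up to \<open>\<delta>\<close>. If at some \<open>x\<close> where \<open>f\<close> has a mean as large as \<open>A\<close> the means of \<open>g + c s * f\<close> and \<open>g + c t * f\<close> were both
smaller than \<open>K\<close>, then those of \<open>(c t - c s) * f\<close> would be smaller than \<open>2 * K\<close>, contradicting the choice of \<open>A\<close>.
Hence the bad sets for different \<open>t\<close> are disjoint, and one of them has measure at most \<open>1 / q\<close>.\<close>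

lemma enlarge_on_most_of_sphere:
  fixes g :: "'a::euclidean_space \<Rightarrow> real"
  assumes dim: "DIM('a::euclidean_space) = n + 1" and n: "n \<ge> 2"
    and g: "integrable sphere_measure g" and \<delta>: "\<delta> > 0" and \<eta>: "\<eta> > 0"
  shows "\<exists>g' F. integrable sphere_measure g' \<and> (LINT x|sphere_measure. \<bar>g' x - g x\<bar>) \<le> \<delta> \<and> finite F \<and> F \<subseteq> {R0..} \<and>
    measure sphere_measure {x \<in> sphere 0 1. \<forall>R\<in>F. \<bar>bochner_riesz n ((real n - 1) / 2) R g' x\<bar> < K} \<le> \<eta>"
proof -
  let ?M = "sphere_measure :: 'a measure"
  let ?B = "bochner_riesz n ((real n - 1) / 2)"
  \<comment> \<open>large enough for \<open>1 / q \<le> \<eta> / 2\<close>\<close>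
  define q where "q = nat \<lceil>2 / \<eta>\<rceil> + 1"
  have q: "q \<ge> 1" "2 / \<eta> \<le> real q" unfolding q_def by (simp, linarith)
  have q2: "1 / real q \<le> \<eta> / 2" using q \<eta> by (simp add: field_simps)
  \<comment> \<open>the distance \<open>\<delta> / q\<close> of consecutive coefficients, times \<open>A\<close>, is \<open>2 * K\<close>\<close>
  define A where "A = 2 * K * real q / \<delta>"
  obtain f :: "'a \<Rightarrow> real" and F where f: "integrable ?M f" "(LINT x|?M. \<bar>f x\<bar>) \<le> 1" and F: "finite F" "F \<subseteq> {R0..}"
    and bad0: "measure ?M {x \<in> sphere 0 1. \<forall>R\<in>F. \<bar>?B R f x\<bar> < A} \<le> \<eta> / 2"
    using large_on_most_of_sphere[OF dim n, of "\<eta> / 2" R0 A] \<eta> by auto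
  define c where "c = (\<lambda>t::nat. real t * \<delta> / real q)"
  define G where "G = (\<lambda>t z. g z + c t * f z)"
  have G: "integrable ?M (G t)" for t unfolding G_def using g f by simp
  define bad where "bad = (\<lambda>t. {x \<in> sphere 0 1. (\<exists>R\<in>F. A \<le> \<bar>?B R f x\<bar>) \<and> (\<forall>R\<in>F. \<bar>?B R (G t) x\<bar> < K)})"
  have badm: "bad t \<in> sets ?M" for t
  proof -
    note [measurable] = bochner_riesz_measurable[OF n f(1)] bochner_riesz_measurable[OF n G]
    have "{x \<in> space ?M. (\<exists>R\<in>F. A \<le> \<bar>?B R f x\<bar>) \<and> (\<forall>R\<in>F. \<bar>?B R (G t) x\<bar> < K)} \<in> sets ?M"
      using F(1) by measurable
    then show ?thesis by (simp add: bad_def)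
  qed
  have disj: "bad s \<inter> bad t = {}" if "s < t" for s t
  proof (rule ccontr)
    assume "bad s \<inter> bad t \<noteq> {}"
    then obtain x where x: "x \<in> sphere 0 1" "x \<in> bad s" "x \<in> bad t" by (auto simp: bad_def)
    then obtain R where R: "R \<in> F" "A \<le> \<bar>?B R f x\<bar>" by (auto simp: bad_def)
    have s: "\<bar>?B R g x + c s * ?B R f x\<bar> < K" and t: "\<bar>?B R g x + c t * ?B R f x\<bar> < K"
      using x R(1) unfolding bad_def G_def by (simp_all add: bochner_riesz_linear[OF n g f(1) x(1)])
    have "c t - c s = (real t - real s) * (\<delta> / real q)" by (simp add: c_def left_diff_distrib diff_divide_distrib)
    also have "\<dots> \<ge> 1 * (\<delta> / real q)" using that \<delta> by (intro mult_right_mono) auto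
    finally have ct: "\<delta> / real q \<le> c t - c s" by simp
    moreover have "0 < \<delta> / real q" using \<delta> q by simp
    ultimately have ct0: "0 \<le> c t - c s" by linarith
    have K: "0 < K" using s abs_ge_zero le_less_trans by blast
    have "2 * K = \<delta> / real q * A" using q \<delta> by (simp add: A_def)
    also have "\<dots> \<le> (c t - c s) * \<bar>?B R f x\<bar>"
      using ct R(2) ct0 K \<delta> by (intro mult_mono) (auto simp: A_def)
    also have "\<dots> = \<bar>(?B R g x + c t * ?B R f x) - (?B R g x + c s * ?B R f x)\<bar>"
    proof -
      have "(c t - c s) * \<bar>?B R f x\<bar> = \<bar>(c t - c s) * ?B R f x\<bar>"
        using ct0 by (simp only: abs_mult abs_of_nonneg)
      then show ?thesis by (simp add: algebra_simps)
    qed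
    also have "\<dots> < 2 * K" using s t by linarith
    finally show False by simp
  qed
  have "\<exists>t\<in>{1..q}. measure ?M (bad t) \<le> 1 / real q"
  proof (rule ccontr)
    assume "\<not> ?thesis"
    then have "(\<Sum>t\<in>{1..q}. 1 / real q) < (\<Sum>t\<in>{1..q}. measure ?M (bad t))"
      using q by (intro sum_strict_mono) (auto simp: not_le)
    moreover have "(\<Sum>t\<in>{1..q}. 1 / real q) = 1" using q by simp
    moreover have "(\<Sum>t\<in>{1..q}. measure ?M (bad t)) = measure ?M (\<Union>t\<in>{1..q}. bad t)"
    proof (rule sphere.finite_measure_finite_Union[symmetric])
      show "bad ` {1..q} \<subseteq> sets ?M" using badm by blast
      show "disjoint_family_on bad {1..q}"
        unfolding disjoint_family_on_def using disj by (metis Int_commute nat_neq_iff)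
    qed simp
    moreover have "measure ?M (\<Union>t\<in>{1..q}. bad t) \<le> measure ?M (sphere 0 1)"
      by (intro sphere.finite_measure_mono sets_sphere_measureI) (auto simp: bad_def)
    ultimately show False using measure_sphere_measure_total[where ?'a = 'a] by simp
  qed
  then obtain t where t: "t \<in> {1..q}" "measure ?M (bad t) \<le> 1 / real q" by blast
  have "(LINT x|?M. \<bar>G t x - g x\<bar>) = c t * (LINT x|?M. \<bar>f x\<bar>)"
    using \<delta> by (simp add: G_def abs_mult c_def)
  also have "\<dots> \<le> \<delta> * 1"
  proof (rule mult_mono)
    show "c t \<le> \<delta>" using t q \<delta> by (simp add: c_def divide_le_eq)
  qed (use f(2) \<delta> in auto)
  finally have norm: "(LINT x|?M. \<bar>G t x - g x\<bar>) \<le> \<delta>" by simp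
  have m0: "{x \<in> sphere 0 1. \<forall>R\<in>F. \<bar>?B R f x\<bar> < A} \<in> sets ?M"
  proof -
    note [measurable] = bochner_riesz_measurable[OF n f(1)]
    have "{x \<in> space ?M. \<forall>R\<in>F. \<bar>?B R f x\<bar> < A} \<in> sets ?M" using F(1) by measurable
    then show ?thesis by simp
  qed
  have "measure ?M {x \<in> sphere 0 1. \<forall>R\<in>F. \<bar>?B R (G t) x\<bar> < K} \<le> measure ?M (bad t \<union> {x \<in> sphere 0 1. \<forall>R\<in>F. \<bar>?B R f x\<bar> < A})"
    by (rule sphere.finite_measure_mono) (use m0 badm in \<open>auto simp: bad_def not_less\<close>)
  also have "\<dots> \<le> measure ?M (bad t) + measure ?M {x \<in> sphere 0 1. \<forall>R\<in>F. \<bar>?B R f x\<bar> < A}"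
    by (rule measure_Un_le[OF badm m0])
  also have "\<dots> \<le> \<eta>" using t(2) q2 bad0 by linarith
  finally show ?thesis using G[of t] norm F by (intro exI[of _ "G t"] exI[of _ F]) blast
qed

lemma L1_limit_of_fast_sequence:
  fixes g :: "nat \<Rightarrow> 'a \<Rightarrow> real"
  assumes g: "\<And>k. integrable M (g k)" and step: "\<And>k. (LINT x|M. \<bar>g (Suc k) x - g k x\<bar>) \<le> \<delta> k / 2"
    and dec: "\<And>k. \<delta> (Suc k) \<le> \<delta> k / 2"
  shows "\<exists>f. integrable M f \<and> (\<forall>k. (LINT x|M. \<bar>f x - g k x\<bar>) \<le> \<delta> k)"
proof -
  define d where "d = (\<lambda>k x. g (Suc k) x - g k x)"
  have d: "integrable M (d k)" for k unfolding d_def using g by simp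
  have decay: "\<delta> (i + k) \<le> \<delta> k * (1 / 2) ^ i" for i k
  proof (induction i)
    case (Suc i)
    have "\<delta> (Suc i + k) \<le> \<delta> (i + k) / 2" using dec[of "i + k"] by simp
    also have "\<dots> \<le> \<delta> k * (1 / 2) ^ i / 2" using Suc by simp
    finally show ?case by simp
  qed simp
  have le: "(LINT x|M. norm (d (i + k) x)) \<le> \<delta> k / 2 * (1 / 2) ^ i" for i k
    using order_trans[OF step[of "i + k"], of "\<delta> k / 2 * (1 / 2) ^ i"] decay[of i k] by (simp add: d_def)
  have geo: "(\<lambda>i. \<delta> k / 2 * (1 / 2) ^ i) sums \<delta> k" for k
    using sums_mult[OF geometric_sums[of "1 / 2 :: real"], of "\<delta> k / 2"] by simp
  have sumn: "summable (\<lambda>i. LINT x|M. norm (d (i + k) x))" for k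
  proof (rule summable_comparison_test')
    show "summable (\<lambda>i. \<delta> k / 2 * (1 / 2) ^ i)" using geo by (rule sums_summable)
    fix i :: nat
    show "norm (LINT x|M. norm (d (i + k) x)) \<le> \<delta> k / 2 * (1 / 2) ^ i" using le[of i k] by simp
  qed
  have AEs: "AE x in M. summable (\<lambda>i. norm (d i x))"
  proof -
    have "(\<integral>\<^sup>+x. (\<Sum>i. ennreal (norm (d i x))) \<partial>M) = (\<Sum>i. \<integral>\<^sup>+x. ennreal (norm (d i x)) \<partial>M)"
      using d by (intro nn_integral_suminf) auto
    also have "\<dots> = (\<Sum>i. ennreal (LINT x|M. norm (d i x)))"
      using d by (intro suminf_cong nn_integral_eq_integral) auto
    also have "\<dots> \<noteq> \<infinity>"
      using sumn[of 0] by (simp add: ennreal_suminf_neq_top)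
    finally have "AE x in M. (\<Sum>i. ennreal (norm (d i x))) \<noteq> \<infinity>"
      using d by (intro nn_integral_noteq_infinite) auto
    then show ?thesis
      by eventually_elim (rule summable_suminf_not_top; simp)
  qed
  define f where "f = (\<lambda>x. g 0 x + (\<Sum>i. d i x))"
  have f: "integrable M f"
    unfolding f_def using integrable_suminf[OF d AEs] sumn[of 0] g[of 0] by simp
  have tele: "g k x = g 0 x + (\<Sum>i<k. d i x)" for k x by (induction k) (simp_all add: d_def)
  have "(LINT x|M. \<bar>f x - g k x\<bar>) \<le> \<delta> k" for k
  proof -
    have AEk: "AE x in M. summable (\<lambda>i. norm (norm (d (i + k) x)))"
      using AEs
    proof eventually_elim
      case (elim x)
      from summable_ignore_initial_segment[OF this, of k] show ?case by simp
    qed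
    have intk: "integrable M (\<lambda>x. \<Sum>i. norm (d (i + k) x))"
      by (rule integrable_suminf[OF _ AEk]) (use d sumn[of k] in auto)
    have "(LINT x|M. \<bar>f x - g k x\<bar>) \<le> (LINT x|M. (\<Sum>i. norm (d (i + k) x)))"
    proof (rule integral_mono_AE)
      show "AE x in M. \<bar>f x - g k x\<bar> \<le> (\<Sum>i. norm (d (i + k) x))"
        using AEs
      proof eventually_elim
        case (elim x)
        then have s: "summable (\<lambda>i. d i x)" by (rule summable_norm_cancel)
        have "f x - g k x = (\<Sum>i. d (i + k) x)"
          unfolding f_def tele[of k x] using suminf_split_initial_segment[OF s, of k] by simp
        moreover have "\<bar>\<Sum>i. d (i + k) x\<bar> \<le> (\<Sum>i. norm (d (i + k) x))"
          using summable_norm[OF summable_ignore_initial_segment[OF elim, of k]] by simp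
        ultimately show ?case by simp
      qed
    qed (use f g intk in auto)
    also have "\<dots> = (\<Sum>i. LINT x|M. norm (d (i + k) x))"
      by (rule integral_suminf[OF _ AEk]) (use d sumn[of k] in auto)
    also have "\<dots> \<le> (\<Sum>i. \<delta> k / 2 * (1 / 2) ^ i)"
      by (rule suminf_le[OF le sumn sums_summable[OF geo]])
    also have "\<dots> = \<delta> k" using geo by (simp add: sums_iff)
    finally show ?thesis .
  qed
  then show ?thesis using f by blast
qed

text \<open>A sequence \<open>g k\<close> is built together with finite sets \<open>F k\<close> of parameters \<open>R \<ge> k\<close> such that, outside a
set of measure \<open>(1 / 2) ^ k\<close>, some mean of \<open>g k\<close> with parameter in \<open>F k\<close> is at least \<open>k\<close>. All later
steps are so small that they change these finitely many means by at most \<open>1 / 2\<close>. By Borel and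
Cantelli, almost every \<open>x\<close> is exceptional only finitely often.\<close>

lemma bochner_riesz_diverges:
  assumes dim: "DIM('a::euclidean_space) = n + 1" and n: "n \<ge> 2"
  shows "\<exists>f :: 'a \<Rightarrow> real. integrable sphere_measure f \<and>
    (AE x in sphere_measure. Limsup at_top (\<lambda>R. ereal \<bar>bochner_riesz n ((real n - 1) / 2) R f x\<bar>) = \<infinity>)"
proof -
  let ?M = "sphere_measure :: 'a measure"
  let ?B = "bochner_riesz n ((real n - 1) / 2)"
  have "\<forall>R. \<exists>C\<ge>0. \<forall>t\<in>{-1..1}. \<bar>bochner_kernel n R t\<bar> \<le> C"
    using continuous_bounded_interval[OF continuous_on_bochner_kernel] by blast
  then obtain C where C0: "\<And>R. C R \<ge> 0" and C: "\<And>R t. t \<in> {-1..1} \<Longrightarrow> \<bar>bochner_kernel n R t\<bar> \<le> C R" by metis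
  \<comment> \<open>A state consists of the current function, a bound for all its future changes, and the parameters
      that witness its large means.\<close>
  define P where "P = (\<lambda>k (s :: ('a \<Rightarrow> real) \<times> real \<times> real set). case s of (g, \<delta>, F) \<Rightarrow>
     integrable ?M g \<and> \<delta> > 0 \<and> finite F \<and> F \<subseteq> {real k..} \<and> (\<forall>R\<in>F. C R * \<delta> \<le> 1 / 2) \<and>
     measure ?M {x \<in> sphere 0 1. \<forall>R\<in>F. \<bar>?B R g x\<bar> < real k} \<le> (1 / 2) ^ k)"
  define Q where "Q = (\<lambda>(k::nat) (s :: ('a \<Rightarrow> real) \<times> real \<times> real set) (s' :: ('a \<Rightarrow> real) \<times> real \<times> real set).
     case s of (g, \<delta>, F) \<Rightarrow> case s' of (g', \<delta>', F') \<Rightarrow> (LINT x|?M. \<bar>g' x - g x\<bar>) \<le> \<delta> / 2 \<and> \<delta>' \<le> \<delta> / 2)"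
  have "\<exists>s. \<forall>k. P k (s k) \<and> Q k (s k) (s (Suc k))"
  proof (rule dependent_nat_choice)
    have "P 0 (\<lambda>x. 0, 1, {})" using measure_sphere_measure_total[where ?'a = 'a] by (simp add: P_def sphere_def)
    then show "\<exists>s. P 0 s" ..
    fix s k assume Ps: "P k s"
    obtain g \<delta> F where s: "s = (g, \<delta>, F)" by (cases s)
    have g: "integrable ?M g" and \<delta>: "\<delta> / 2 > 0" using Ps by (auto simp: P_def s)
    have "((1::real) / 2) ^ Suc k > 0" by simp
    from enlarge_on_most_of_sphere[OF dim n g \<delta> this, of "real (Suc k)" "real (Suc k)"]
    obtain g' F' where g': "integrable ?M g'" "(LINT x|?M. \<bar>g' x - g x\<bar>) \<le> \<delta> / 2" "finite F'" "F' \<subseteq> {real (Suc k)..}"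
      "measure ?M {x \<in> sphere 0 1. \<forall>R\<in>F'. \<bar>?B R g' x\<bar> < real (Suc k)} \<le> (1 / 2) ^ Suc k" by blast
    \<comment> \<open>The second entry makes every change in \<open>L\<^sup>1\<close> of size \<open>\<delta>'\<close> harmless for the means with \<open>R\<close> in \<open>F'\<close>.\<close>
    define \<delta>' where "\<delta>' = min (\<delta> / 2) (1 / (2 * ((\<Sum>R\<in>F'. C R) + 1)))"
    have S: "0 \<le> (\<Sum>R\<in>F'. C R)" using C0 by (intro sum_nonneg) auto
    have \<delta>': "\<delta>' > 0" "\<delta>' \<le> \<delta> / 2" using \<delta> S by (auto simp: \<delta>'_def)
    have "C R * \<delta>' \<le> 1 / 2" if "R \<in> F'" for R
    proof -
      have "C R \<le> (\<Sum>R\<in>F'. C R)" using C0 g'(3) that by (intro member_le_sum) auto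
      then have "C R * \<delta>' \<le> ((\<Sum>R\<in>F'. C R) + 1) * (1 / (2 * ((\<Sum>R\<in>F'. C R) + 1)))"
        using C0 S \<delta>' by (intro mult_mono) (auto simp: \<delta>'_def)
      also have "\<dots> = 1 / 2" using S by (simp add: field_simps)
      finally show ?thesis .
    qed
    then have "P (Suc k) (g', \<delta>', F') \<and> Q k s (g', \<delta>', F')" using g' \<delta>' by (simp add: P_def Q_def s)
    then show "\<exists>s'. P (Suc k) s' \<and> Q k s s'" by blast
  qed
  then obtain s where s: "\<And>k. P k (s k)" "\<And>k. Q k (s k) (s (Suc k))" by blast
  define g \<delta> F where "g = (\<lambda>k. fst (s k))" and "\<delta> = (\<lambda>k. fst (snd (s k)))" and "F = (\<lambda>k. snd (snd (s k)))"
  have gk: "integrable ?M (g k)" and \<delta>0: "\<delta> k > 0" and Fk: "finite (F k)" "F k \<subseteq> {real k..}" "\<And>R. R \<in> F k \<Longrightarrow> C R * \<delta> k \<le> 1 / 2"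
    and bad: "measure ?M {x \<in> sphere 0 1. \<forall>R\<in>F k. \<bar>?B R (g k) x\<bar> < real k} \<le> (1 / 2) ^ k" for k
    using s(1)[of k] by (auto simp: P_def g_def \<delta>_def F_def split_beta)
  have step: "(LINT x|?M. \<bar>g (Suc k) x - g k x\<bar>) \<le> \<delta> k / 2" and dec: "\<delta> (Suc k) \<le> \<delta> k / 2" for k
    using s(2)[of k] by (auto simp: Q_def g_def \<delta>_def split_beta)
  obtain f where f: "integrable ?M f" and fg: "\<And>k. (LINT x|?M. \<bar>f x - g k x\<bar>) \<le> \<delta> k"
    using L1_limit_of_fast_sequence[of ?M g \<delta>, OF gk step dec] by blast
  have close: "\<bar>?B R f x - ?B R (g k) x\<bar> \<le> 1 / 2" if x: "x \<in> sphere 0 1" and R: "R \<in> F k" for x R k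
  proof -
    have d: "integrable ?M (\<lambda>z. f z - g k z)" using f gk by simp
    have "?B R f x = ?B R (\<lambda>z. g k z + 1 * (f z - g k z)) x" by simp
    also have "\<dots> = ?B R (g k) x + 1 * ?B R (\<lambda>z. f z - g k z) x" by (rule bochner_riesz_linear[OF n gk d x])
    finally have "\<bar>?B R f x - ?B R (g k) x\<bar> = \<bar>LINT y|?M. bochner_kernel n R (x \<bullet> y) * (f y - g k y)\<bar>"
      by (simp add: bochner_riesz_eq_integral[OF n d x])
    also have "\<dots> \<le> C R * (LINT y|?M. \<bar>f y - g k y\<bar>)"
      by (rule zonal_integrable(2)[OF continuous_on_bochner_kernel C d x])
    also have "\<dots> \<le> C R * \<delta> k" using C0 fg by (intro mult_left_mono)
    also have "\<dots> \<le> 1 / 2" by (rule Fk(3)[OF R])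
    finally show ?thesis .
  qed
  let ?A = "\<lambda>k. {x \<in> sphere 0 1. \<forall>R\<in>F k. \<bar>?B R (g k) x\<bar> < real k}"
  have Am: "?A k \<in> sets ?M" for k
  proof -
    note [measurable] = bochner_riesz_measurable[OF n gk]
    have "{x \<in> space ?M. \<forall>R\<in>F k. \<bar>?B R (g k) x\<bar> < real k} \<in> sets ?M" using Fk(1) by measurable
    then show ?thesis by simp
  qed
  have "AE x in ?M. eventually (\<lambda>k. x \<in> space ?M - ?A k) sequentially"
  proof (rule borel_cantelli_AE1[OF Am])
    show "emeasure ?M (?A k) < \<infinity>" for k by (simp add: sphere.emeasure_finite less_top[symmetric])
    show "summable (\<lambda>k. measure ?M (?A k))"
    proof (rule summable_comparison_test')
      show "summable (\<lambda>k. (1 / 2 :: real) ^ k)" by (rule summable_geometric) simp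
      show "norm (measure ?M (?A k)) \<le> (1 / 2) ^ k" for k using bad[of k] by simp
    qed
  qed
  then have "AE x in ?M. Limsup at_top (\<lambda>R. ereal \<bar>?B R f x\<bar>) = \<infinity>"
  proof eventually_elim
    case (elim x)
    show ?case
    proof (rule ccontr)
      assume "Limsup at_top (\<lambda>R. ereal \<bar>?B R f x\<bar>) \<noteq> \<infinity>"
      then obtain m :: nat where "Limsup at_top (\<lambda>R. ereal \<bar>?B R f x\<bar>) < ereal (real m)"
        unfolding less_PInf_Ex_of_nat by blast
      then have "eventually (\<lambda>R. ereal \<bar>?B R f x\<bar> < ereal (real m)) at_top" by (rule Limsup_lessD)
      then obtain R1 where R1: "\<And>R. R \<ge> R1 \<Longrightarrow> \<bar>?B R f x\<bar> < real m"
        by (auto simp: eventually_at_top_linorder)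
      from elim obtain k0 where k0: "\<And>k. k \<ge> k0 \<Longrightarrow> x \<in> space ?M - ?A k"
        unfolding eventually_sequentially by blast
      define k where "k = k0 + m + nat \<lceil>R1\<rceil> + 1"
      have k: "k \<ge> k0" "real k \<ge> real m + 1" "real k \<ge> R1" unfolding k_def by (simp, simp, linarith)
      have x: "x \<in> sphere 0 1" using k0[OF k(1)] by simp
      obtain R where R: "R \<in> F k" "real k \<le> \<bar>?B R (g k) x\<bar>" using k0[OF k(1)] x by (auto simp: not_less)
      have "R \<ge> R1" using Fk(2)[of k] R(1) k(3) by force
      then have "\<bar>?B R f x\<bar> < real m" by (rule R1)
      then show False using close[OF x R(1)] R(2) k(2) by linarith
    qed
  qed
  then show ?thesis using f by blast
qed

theorem corollary4:
  fixes n :: nat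
  assumes "n \<ge> 2" and "CARD('d::finite) = n + 1"
  shows "\<exists>f :: real ^ 'd \<Rightarrow> real. integrable sphere_measure f \<and>
    (AE x in sphere_measure.
       Limsup at_top (\<lambda>R. ereal \<bar>bochner_riesz n ((real n - 1) / 2) R f x\<bar>) = \<infinity>)"
  by (rule bochner_riesz_diverges) (use assms in simp_all)

end
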